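(* Let $(B,A)$ be a random vector with values in $[0,\infty)^2$, let $(B_i,A_i)_{i\ge1}$ be i.i.d. copies of $(B,A)$, and put $S_0=0$, $S_n=\sum_{i=1}^n(B_i-A_i)$, $b_n=\sum_{i=1}^nB_i$, $N=\min\{n\ge1:S_n<0\}$, $P=b_N$. Assume $\mathbb{P}(S_n=0)=0$ for all $n\ge1$. Let $h(s_1,s_2)=\mathbb{E}e^{-s_1B-s_2A}$ and assume that: (i) for all $s_2$ with $\mathrm{Re}\,s_2\ge0$, $h(s_1,s_2)=h_1(s_1,s_2)/h_2(s_1,s_2)$ is a rational function of $s_1$, where $h_1(\cdot,s_2)$, $h_2(\cdot,s_2)$ are polynomials, and the zeroes of $h_2(\cdot,s_2)$ all have negative real part; (ii) for $\mathrm{Re}\,s\ge0$, the function $\xi\mapsto h(\xi,s-\xi)$ is meromorphic in $\{\mathrm{Re}\,\xi<0\}$ with finitely many poles there; (iii) $h(s_1,s_2)\to0$ as $s_1\to\infty$, $\mathrm{Re}\,s_1>0$, uniformly in $s_2$ with $\mathrm{Re}\,s_2\ge0$; in particular $\deg h_1(\cdot,s_2)<\deg h_2(\cdot,s_2)$ for all $\mathrm{Re}\,s_2\ge0$. Then for $\mathrm{Re}\,s>0$ and $|z|<1$, $$\mathbb{E}\{z^Ne^{-sP}\}=1-[1-zh(s,0)]\,\frac{\prod_{i=1}^n[s-\xi_i(s)]}{\prod_{i=1}^n[s-\xi_i(z,s)]},$$ where $\xi_i(s)$ and $\xi_i(z,s)$, $i=1,\dots,n$, are the zeroes with negative real part of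 $h_2(\xi,s-\xi)$ and of $h_2(\xi,s-\xi)-zh_1(\xi,s-\xi)$, respectively, as functions of $\xi$; these two functions have the same number $n=n(s,z)$ of such zeroes.
   Context: Zeroes are counted with multiplicity. For fixed $s_2$ with $\mathrm{Re}\,s_2\ge0$, $h(\cdot,s_2)$ is extended to the whole $s_1$-plane as the rational function $h_1(\cdot,s_2)/h_2(\cdot,s_2)$; thus $h(\xi,s-\xi)$ makes sense for $\mathrm{Re}\,\xi\le0$, $\mathrm{Re}\,s\ge0$. On the event $\{N=\infty\}$ the quantity $z^Ne^{-sP}$ is understood to be $0$.
   Formalization: The formal statement additionally assumes that for Re s > 0 the functions h_1(ξ,s−ξ) and h_2(ξ,s−ξ) are holomorphic in ξ for Re ξ < 0; without this, multiplicities are undefined and a bad common factor can give infinitely many zeroes. *)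

theory Defs
  imports "HOL-Probability.Probability" "HOL-Complex_Analysis.Complex_Analysis"
begin

definition joint_transform ::
  "'a measure \<Rightarrow> ('a \<Rightarrow> real) \<Rightarrow> ('a \<Rightarrow> real) \<Rightarrow> complex \<Rightarrow> complex \<Rightarrow> complex" where
  "joint_transform M B A s1 s2 =
     (CLINT \<omega>|M. exp (- s1 * complex_of_real (B \<omega>) - s2 * complex_of_real (A \<omega>)))"

(* The polynomial h1 s2 (resp. h2 s2) is h_1(., s_2) (resp. h_2(., s_2)), i.e. its variable is s_1.
   Where numerator and denominator have a common zero the value is 0 instead of the limit;
   meromorphic_on and is_pole do not see isolated values. *)
definition rat_ext ::
  "(complex \<Rightarrow> complex poly) \<Rightarrow> (complex \<Rightarrow> complex poly) \<Rightarrow> complex \<Rightarrow> complex \<Rightarrow> complex" where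
  "rat_ext h1 h2 s1 s2 = poly (h1 s2) s1 / poly (h2 s2) s1"

definition partial_sum :: "(nat \<Rightarrow> 'a \<Rightarrow> real) \<Rightarrow> nat \<Rightarrow> 'a \<Rightarrow> real" where
  "partial_sum X n \<omega> = (\<Sum>i=1..n. X i \<omega>)"

definition walk :: "(nat \<Rightarrow> 'a \<Rightarrow> real) \<Rightarrow> (nat \<Rightarrow> 'a \<Rightarrow> real) \<Rightarrow> nat \<Rightarrow> 'a \<Rightarrow> real" where
  "walk Bs As n \<omega> = (\<Sum>i=1..n. Bs i \<omega> - As i \<omega>)"

(* The infimum of the empty set is infinity in enat. *)
definition ladder_epoch :: "(nat \<Rightarrow> 'a \<Rightarrow> real) \<Rightarrow> (nat \<Rightarrow> 'a \<Rightarrow> real) \<Rightarrow> 'a \<Rightarrow> enat" where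
  "ladder_epoch Bs As \<omega> = (INF n \<in> {n. 1 \<le> n \<and> walk Bs As n \<omega> < 0}. enat n)"

definition ladder_term ::
  "(nat \<Rightarrow> 'a \<Rightarrow> real) \<Rightarrow> (nat \<Rightarrow> 'a \<Rightarrow> real) \<Rightarrow> complex \<Rightarrow> complex \<Rightarrow> 'a \<Rightarrow> complex" where
  "ladder_term Bs As z s \<omega> =
     (case ladder_epoch Bs As \<omega> of
        enat N \<Rightarrow> z ^ N * exp (- s * complex_of_real (partial_sum Bs N \<omega>))
      | \<infinity> \<Rightarrow> 0)"

(* xi 1, ..., xi n lists the zeroes of f in S, each repeated according to its multiplicity.
   The meaning is as intended for f analytic at the points of S. *)
definition lists_zeroes ::
  "(complex \<Rightarrow> complex) \<Rightarrow> complex set \<Rightarrow> nat \<Rightarrow> (nat \<Rightarrow> complex) \<Rightarrow> bool" where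
  "lists_zeroes f S n \<xi> \<longleftrightarrow>
     \<xi> ` {1..n} = {w \<in> S. f w = 0} \<and>
     (\<forall>w \<in> \<xi> ` {1..n}. int (card {i \<in> {1..n}. \<xi> i = w}) = zorder f w)"

end

theory Submission
  imports Defs "HOL-Real_Asymp.Real_Asymp"
begin

text \<open>
  The proof is a Wiener-Hopf factorisation. Give a path of length \<open>n\<close> the weight
  \<open>exp (- \<xi> S\<^sub>n - s a\<^sub>n)\<close>, where \<open>a\<^sub>n\<close> is the sum of the \<open>A\<^sub>i\<close>; one step then has transform
  \<open>h(\<xi>, s - \<xi>)\<close>. Let \<open>G\<^sub>+\<close> be the generating function in \<open>z\<close> of the weights of the paths that have not yet
  become negative, and \<open>G\<^sub>-\<close> be one minus that of the weights at the ladder epoch. As steps are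
  independent, \<open>G\<^sub>+(\<xi>) (1 - z h(\<xi>, s - \<xi>)) = G\<^sub>-(\<xi>)\<close> for \<open>0 \<le> Re \<xi> \<le> Re s\<close> (\<open>Wiener_Hopf_identity\<close>). At
  \<open>\<xi> = s\<close> the weight is \<open>exp (- s b\<^sub>n)\<close>, so \<open>G\<^sub>-(s)\<close> is one minus the expectation in question, and it
  remains to find \<open>G\<^sub>+(s)\<close>.

  Now \<open>G\<^sub>+\<close> is bounded and holomorphic for \<open>Re \<xi> > 0\<close>, has no zeroes there
  (\<open>plus_factor_nonzero\<close>), and tends to \<open>1\<close> at \<open>+\<infinity>\<close>; \<open>G\<^sub>-\<close> is bounded, holomorphic and without zeroes
  for \<open>Re \<xi> < Re s\<close>. Writing \<open>f0(\<xi>)\<close> and \<open>fz(\<xi>)\<close> for \<open>h\<^sub>2(\<xi>, s - \<xi>)\<close> and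
  \<open>h\<^sub>2(\<xi>, s - \<xi>) - z h\<^sub>1(\<xi>, s - \<xi>)\<close>, \<open>G\<^sub>+\<close> continues to the left as \<open>G\<^sub>- f0 / fz\<close>. So \<open>G\<^sub>+\<close> times the product
  over the zeroes of \<open>fz\<close>, divided by the product over those of \<open>f0\<close>, is entire and without
  zeroes. If it grows at most like a power, it is constant; the limit \<open>1\<close> at \<open>+\<infinity>\<close> shows that the
  constant is \<open>1\<close> and the numbers of zeroes are equal (\<open>Wiener_Hopf_factor_eq\<close>).

  What is needed about \<open>f0\<close> and \<open>fz\<close> is thus that they have finitely many zeroes and that
  \<open>f0 / fz\<close> has at most power growth on the left (\<open>diag_zeroes_and_growth\<close>). Here the rational
  structure enters. The coefficients of the polynomials are holomorphic in \<open>s\<^sub>2\<close>, and the degree of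
  \<open>h\<^sub>2(\<sqdot>, s\<^sub>2)\<close> is constant for \<open>Re s\<^sub>2 > 0\<close> (\<open>diagonal_holomorphic_imp_holomorphic_coeffs\<close>,
  \<open>top_coeff_nonzero\<close>). Replace the argument \<open>s - \<xi>\<close> by a function with values in a compact part of
  the right half-plane. Then everything is holomorphic up to and across the boundary of the left half-plane
  including infinity; Rouche's theorem shows that the two functions have the same number of zeroes
  and that this number does not depend on the replacement. On the boundary
  \<open>\<bar>fz / f0 - 1\<bar> \<le> \<bar>z\<bar> < 1\<close>, so after its zeroes and poles have been removed in a way that respects the
  argument, \<open>f0 / fz\<close> has positive real part in the half-plane, and Harnack's inequality gives
  bounds (\<open>Harnack_for_quotient\<close>) that persist in the limit. The zeroes of the limits are limits
  of zeroes, hence finite in number (\<open>zeroes_of_limit\<close>).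
\<close>

section \<open>Zeroes and linear factors\<close>

lemma exists_listing_with_multiplicities:
  fixes m :: "'a \<Rightarrow> nat"
  assumes "finite Z" "\<And>w. w \<in> Z \<Longrightarrow> 0 < m w"
  shows "\<exists>n (\<xi>::nat \<Rightarrow> 'a). \<xi> ` {1..n} = Z \<and> (\<forall>w\<in>Z. card {i\<in>{1..n}. \<xi> i = w} = m w) \<and> n = sum m Z"
proof -
  define T where "T = (SIGMA w:Z. {..<m w})"
  have fT: "finite T" unfolding T_def using assms(1) by auto
  have cT: "card T = sum m Z" unfolding T_def using assms(1) by simp
  obtain h where h: "bij_betw h {1..card T} T"
    using ex_bij_betw_nat_finite_1[OF fT] by blast
  have im: "(\<lambda>i. fst (h i)) ` {1..card T} = Z"
  proof -
    have "(\<lambda>i. fst (h i)) ` {1..card T} = fst ` (h ` {1..card T})" by (simp add: image_image)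
    also have "h ` {1..card T} = T" using h by (simp add: bij_betw_def)
    also have "fst ` T = Z" unfolding T_def using assms(2) by force
    finally show ?thesis .
  qed
  have "card {i\<in>{1..card T}. fst (h i) = w} = m w" if "w \<in> Z" for w
  proof -
    have "bij_betw h {i\<in>{1..card T}. fst (h i) = w} ({w} \<times> {..<m w})"
    proof (rule bij_betw_subset[OF h])
      show "h ` {i \<in> {1..card T}. fst (h i) = w} = {w} \<times> {..<m w}"
      proof -
        have "h ` {i \<in> {1..card T}. fst (h i) = w} = {t \<in> h ` {1..card T}. fst t = w}" by auto
        also have "\<dots> = {t \<in> T. fst t = w}" using h by (simp add: bij_betw_def)
        also have "\<dots> = {w} \<times> {..<m w}" unfolding T_def using that by auto
        finally show ?thesis .
      qed
    qed auto
    then show ?thesis by (simp add: bij_betw_same_card card_cartesian_product)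
  qed
  with im cT show ?thesis by blast
qed

lemma zorder_prod_linear:
  fixes \<xi> :: "nat \<Rightarrow> complex"
  shows
  "zorder (\<lambda>w. \<Prod>i=1..n. w - \<xi> i) z = int (card {i\<in>{1..n}. \<xi> i = z})"
proof (rule zorder_eqI)
  show "(\<lambda>w. \<Prod>i\<in>{i\<in>{1..n}. \<xi> i \<noteq> z}. w - \<xi> i) holomorphic_on UNIV"
    by (intro holomorphic_intros)
  have fin: "finite {i\<in>{1..n}. \<xi> i \<noteq> z}" by (rule finite_subset[of _ "{1..n}"]) auto
  show "(\<Prod>i\<in>{i\<in>{1..n}. \<xi> i \<noteq> z}. z - \<xi> i) \<noteq> 0"
    unfolding prod_zero_iff[OF fin] by auto
  fix w assume "w \<noteq> z"
  have "{1..n} = {i\<in>{1..n}. \<xi> i \<noteq> z} \<union> {i\<in>{1..n}. \<xi> i = z}" by auto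
  then have "(\<Prod>i=1..n. w - \<xi> i) = (\<Prod>i\<in>{i\<in>{1..n}. \<xi> i \<noteq> z} \<union> {i\<in>{1..n}. \<xi> i = z}. w - \<xi> i)" by (rule arg_cong)
  also have "\<dots> = (\<Prod>i\<in>{i\<in>{1..n}. \<xi> i \<noteq> z}. w - \<xi> i) * (\<Prod>i\<in>{i\<in>{1..n}. \<xi> i = z}. w - \<xi> i)"
    by (rule prod.union_disjoint) auto
  also have "(\<Prod>i\<in>{i\<in>{1..n}. \<xi> i = z}. w - \<xi> i) = (\<Prod>i\<in>{i\<in>{1..n}. \<xi> i = z}. w - z)"
    by (rule prod.cong) auto
  finally show "(\<Prod>i=1..n. w - \<xi> i) = (\<Prod>i\<in>{i\<in>{1..n}. \<xi> i \<noteq> z}. w - \<xi> i) * (w - z) powi int (card {i\<in>{1..n}. \<xi> i = z})"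
    by simp
qed auto

lemma factor_out_zeroes:
  assumes hol: "f holomorphic_on S" and S: "open S" "connected S"
    and fin: "finite {w\<in>S. f w = 0}" and nz: "\<exists>w\<in>S. f w \<noteq> 0"
  obtains n \<xi> k where "lists_zeroes f S n \<xi>" "k holomorphic_on S" "\<And>w. w \<in> S \<Longrightarrow> k w \<noteq> 0"
    "\<And>w. w \<in> S \<Longrightarrow> f w = (\<Prod>i=1..n. w - \<xi> i) * k w"
    "int n = (\<Sum>p\<in>{w\<in>S. f w = 0}. zorder f p)"
proof -
  let ?Z = "{w\<in>S. f w = 0}"
  have zo: "if f z = 0 then zorder f z > 0 else zorder f z = 0" if "z \<in> S" for z
    using zorder_exist_zero[OF hol S that nz] by blast
  have pos: "0 < nat (zorder f w)" if "w \<in> ?Z" for w using zo[of w] that by auto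
  obtain n \<xi> where im: "\<xi> ` {1..n} = ?Z" and card: "\<And>w. w \<in> ?Z \<Longrightarrow> card {i\<in>{1..n}. \<xi> i = w} = nat (zorder f w)"
    and n: "n = (\<Sum>w\<in>?Z. nat (zorder f w))"
    using exists_listing_with_multiplicities[of ?Z "\<lambda>w. nat (zorder f w)", OF fin pos] by blast
  have int_n: "int n = (\<Sum>p\<in>?Z. zorder f p)"
    unfolding n of_nat_sum using zo by (intro sum.cong) (auto simp: less_imp_le)
  have lz: "lists_zeroes f S n \<xi>"
    unfolding lists_zeroes_def using im card zo by (auto simp: less_imp_le)
  have prod0: "(\<Prod>i=1..n. z - \<xi> i) = 0 \<longleftrightarrow> f z = 0" if "z \<in> S" for z
  proof -
    have "(\<Prod>i=1..n. z - \<xi> i) = 0 \<longleftrightarrow> z \<in> \<xi> ` {1..n}" by (auto simp: prod_zero_iff)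
    with im that show ?thesis by auto
  qed
  have ord: "zorder (\<lambda>w. \<Prod>i=1..n. w - \<xi> i) z = zorder f z" if "z \<in> S" for z
  proof (cases "f z = 0")
    case True
    with that have "z \<in> ?Z" by simp
    with card[OF this] zo[OF that] True show ?thesis by (simp only: zorder_prod_linear) simp
  next
    case False
    then have "{i\<in>{1..n}. \<xi> i = z} = {}" using im that by fastforce
    with zo[OF that] False show ?thesis by (simp only: zorder_prod_linear) simp
  qed
  obtain k where "k holomorphic_on S" "\<And>z. z \<in> S \<Longrightarrow> k z \<noteq> 0" "\<And>z. z \<in> S \<Longrightarrow> f z = k z * (\<Prod>i=1..n. z - \<xi> i)"
  proof (rule holomorphic_zorder_factorization[OF hol S, of "\<lambda>w. \<Prod>i=1..n. w - \<xi> i"])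
    show "(\<lambda>w. \<Prod>i=1..n. w - \<xi> i) holomorphic_on S" by (intro holomorphic_intros)
  qed (use prod0 ord in blast)+
  then show ?thesis using that[OF lz, of k] int_n by (simp add: mult.commute)
qed

lemma Rouche_unit_circle:
  fixes f g :: "complex \<Rightarrow> complex"
  assumes \<rho>: "1 < \<rho>" and hol: "f holomorphic_on ball 0 \<rho>" "g holomorphic_on ball 0 \<rho>"
    and less: "\<And>w. norm w = 1 \<Longrightarrow> norm (g w - f w) < norm (f w)"
  shows "finite {w\<in>ball 0 1. f w = 0}" "finite {w\<in>ball 0 1. g w = 0}"
    "(\<Sum>p\<in>{w\<in>ball 0 1. g w = 0}. zorder g p) = (\<Sum>p\<in>{w\<in>ball 0 1. f w = 0}. zorder f p)"
proof -
  define \<rho>' where "\<rho>' = (1 + \<rho>) / 2"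
  have r': "1 < \<rho>'" "\<rho>' < \<rho>" using \<rho> by (auto simp: \<rho>'_def)
  have fin: "finite {w\<in>ball 0 \<rho>'. h w = 0}" if h: "h holomorphic_on ball 0 \<rho>" "h 1 \<noteq> 0" for h :: "complex \<Rightarrow> complex"
  proof (cases "h constant_on ball 0 \<rho>")
    case True
    then obtain c where c: "\<And>w. w \<in> ball 0 \<rho> \<Longrightarrow> h w = c" by (auto simp: constant_on_def)
    have "c \<noteq> 0" using c[of 1] h \<rho> by simp
    then have "{w\<in>ball 0 \<rho>'. h w = 0} = {}" using c r' by auto
    then show ?thesis by (simp only: finite.emptyI)
  next
    case False
    have "finite {w\<in>cball 0 \<rho>'. h w = 0}"
      by (rule holomorphic_compact_finite_zeros[OF h(1)]) (use False r' in auto)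
    then show ?thesis by (rule finite_subset[rotated]) auto
  qed
  have f1: "f 1 \<noteq> 0" using less[of 1] by auto
  have g1: "g 1 \<noteq> 0" using less[of 1] by auto
  have sph: "f w \<noteq> 0" "g w \<noteq> 0" if "norm w = 1" for w using less[OF that] by auto
  have fgeq: "(\<lambda>p. f p + (g p - f p)) = g" by auto
  have wn1: "winding_number (circlepath 0 1) p = (if p \<in> ball 0 1 then 1 else 0)" if "norm p \<noteq> 1" for p
  proof (cases "norm p < 1")
    case True
    then show ?thesis by (simp add: winding_number_circlepath)
  next
    case False
    have "winding_number (circlepath 0 1) p = 0"
      by (rule winding_number_zero_outside[where s = "cball 0 1"]) (use False that in auto)
    then show ?thesis using False by simp
  qed
  have red: "(\<Sum>p\<in>{w\<in>ball 0 \<rho>'. h w = 0}. winding_number (circlepath 0 1) p * of_int (zorder h p))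
      = of_int (\<Sum>p\<in>{w\<in>ball 0 1. h w = 0}. zorder h p)"
    if h: "h holomorphic_on ball 0 \<rho>" "h 1 \<noteq> 0" "\<And>w. norm w = 1 \<Longrightarrow> h w \<noteq> 0" for h :: "complex \<Rightarrow> complex"
  proof -
    have "(\<Sum>p\<in>{w\<in>ball 0 \<rho>'. h w = 0}. winding_number (circlepath 0 1) p * of_int (zorder h p))
       = (\<Sum>p\<in>{w\<in>ball 0 1. h w = 0}. winding_number (circlepath 0 1) p * of_int (zorder h p))"
    proof (rule sum.mono_neutral_right[OF fin[OF h(1,2)]])
      show "{w \<in> ball 0 1. h w = 0} \<subseteq> {w \<in> ball 0 \<rho>'. h w = 0}" using r' by auto
      show "\<forall>i\<in>{w \<in> ball 0 \<rho>'. h w = 0} - {w \<in> ball 0 1. h w = 0}.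
              winding_number (circlepath 0 1) i * of_int (zorder h i) = 0"
      proof
        fix i assume i: "i \<in> {w \<in> ball 0 \<rho>'. h w = 0} - {w \<in> ball 0 1. h w = 0}"
        then have "norm i \<noteq> 1" using h(3) by blast
        then show "winding_number (circlepath 0 1) i * of_int (zorder h i) = 0"
          using wn1[of i] i by auto
      qed
    qed
    also have "\<dots> = (\<Sum>p\<in>{w\<in>ball 0 1. h w = 0}. of_int (zorder h p))"
    proof (rule sum.cong[OF refl])
      fix p assume p: "p \<in> {w\<in>ball 0 1. h w = 0}"
      then have "norm p \<noteq> 1" by auto
      with p show "winding_number (circlepath 0 1) p * of_int (zorder h p) = of_int (zorder h p)"
        by (subst wn1) auto
    qed
    finally show ?thesis by simp
  qed
  have "(\<Sum>p\<in>{p\<in>ball 0 \<rho>'. f p + (g p - f p) = 0}. winding_number (circlepath 0 1) p * zorder (\<lambda>p. f p + (g p - f p)) p)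
      = (\<Sum>p\<in>{p\<in>ball 0 \<rho>'. f p = 0}. winding_number (circlepath 0 1) p * zorder f p)"
  proof (rule Rouche_theorem)
    show "finite {p \<in> ball 0 \<rho>'. f p = 0}" by (rule fin[OF hol(1) f1])
    show "finite {p \<in> ball 0 \<rho>'. f p + (g p - f p) = 0}" using fin[OF hol(2) g1] by simp
    show "f holomorphic_on ball 0 \<rho>'" by (rule holomorphic_on_subset[OF hol(1)]) (use r' in auto)
    have "g holomorphic_on ball 0 \<rho>'" by (rule holomorphic_on_subset[OF hol(2)]) (use r' in auto)
    then show "(\<lambda>p. g p - f p) holomorphic_on ball 0 \<rho>'"
      using \<open>f holomorphic_on ball 0 \<rho>'\<close> by (intro holomorphic_intros)
    show "\<forall>z\<in>path_image (circlepath 0 1). cmod (g z - f z) < cmod (f z)"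
      using less by auto
    show "\<forall>z. z \<notin> ball 0 \<rho>' \<longrightarrow> winding_number (circlepath 0 1) z = 0"
      using r' wn1 by auto
  qed (use r' in auto)
  then have "(of_int (\<Sum>p\<in>{w\<in>ball 0 1. g w = 0}. zorder g p) :: complex) = of_int (\<Sum>p\<in>{w\<in>ball 0 1. f w = 0}. zorder f p)"
    using red[OF hol(1) f1 sph(1)] red[OF hol(2) g1 sph(2)] by (simp add: fgeq)
  then show "(\<Sum>p\<in>{w\<in>ball 0 1. g w = 0}. zorder g p) = (\<Sum>p\<in>{w\<in>ball 0 1. f w = 0}. zorder f p)"
    by (simp only: of_int_eq_iff)
  show "finite {w\<in>ball 0 1. f w = 0}" by (rule finite_subset[OF _ fin[OF hol(1) f1]]) (use r' in auto)
  show "finite {w\<in>ball 0 1. g w = 0}" by (rule finite_subset[OF _ fin[OF hol(2) g1]]) (use r' in auto)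
qed

section \<open>Growth of holomorphic functions\<close>

text \<open>Schwarz's lemma for \<open>(g - g(0)) / (g + cnj (g(0)))\<close>, which maps the disc into itself.\<close>

lemma Re_pos_growth:
  fixes g :: "complex \<Rightarrow> complex"
  assumes hol: "g holomorphic_on ball 0 1" and pos: "\<And>w. norm w < 1 \<Longrightarrow> 0 < Re (g w)"
    and w: "norm w < 1"
  shows "norm (g w) * (1 - norm w) \<le> 2 * norm (g 0)"
proof -
  let ?b = "g 0"
  define \<phi> where "\<phi> = (\<lambda>w. (g w - ?b) / (g w + cnj ?b))"
  have den: "g w + cnj ?b \<noteq> 0" if "norm w < 1" for w
  proof
    assume "g w + cnj ?b = 0"
    then have "Re (g w + cnj ?b) = 0" by simp
    then show False using pos[OF that] pos[of 0] by simp
  qed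
  have lt: "norm (\<phi> w) < 1" if "norm w < 1" for w
  proof -
    have "(norm (g w - ?b))\<^sup>2 < (norm (g w + cnj ?b))\<^sup>2"
    proof -
      have "(norm (g w + cnj ?b))\<^sup>2 - (norm (g w - ?b))\<^sup>2 = 4 * (Re (g w) * Re ?b)"
        unfolding cmod_power2 by (simp add: power2_eq_square algebra_simps)
      then show ?thesis using mult_pos_pos[OF pos[OF that] pos[of 0]] by simp
    qed
    then have "norm (g w - ?b) < norm (g w + cnj ?b)" by (rule power2_less_imp_less) simp
    then show ?thesis using den[OF that] by (simp add: \<phi>_def norm_divide)
  qed
  have "\<phi> holomorphic_on ball 0 1"
    unfolding \<phi>_def using hol den by (intro holomorphic_intros) auto
  moreover have "\<phi> 0 = 0" by (simp add: \<phi>_def)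
  ultimately have sch: "norm (\<phi> w) \<le> norm w" using Schwarz_Lemma(1)[of \<phi> w] lt w by blast
  have "g w * (1 - \<phi> w) = ?b + \<phi> w * cnj ?b"
    using den[OF w] unfolding \<phi>_def by (simp add: field_simps)
  then have "norm (g w) * norm (1 - \<phi> w) = norm (?b + \<phi> w * cnj ?b)" by (metis norm_mult)
  also have "\<dots> \<le> norm ?b + norm (\<phi> w) * norm ?b"
    by (metis complex_mod_cnj norm_mult norm_triangle_ineq)
  also have "\<dots> \<le> norm ?b + 1 * norm ?b"
    using lt[OF w] by (intro add_left_mono mult_right_mono) auto
  finally have 1: "norm (g w) * norm (1 - \<phi> w) \<le> 2 * norm ?b" by simp
  have "1 - norm w \<le> norm (1 - \<phi> w)"
    using sch norm_triangle_ineq2[of 1 "\<phi> w"] by simp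
  then have "norm (g w) * (1 - norm w) \<le> norm (g w) * norm (1 - \<phi> w)"
    by (intro mult_left_mono) auto
  with 1 show ?thesis by linarith
qed

text \<open>Harnack's inequality in the form needed here: both \<open>g\<close> and \<open>1 / g\<close> are compared with the
  value at the centre.\<close>

lemma Re_pos_Harnack:
  fixes g :: "complex \<Rightarrow> complex"
  assumes hol: "g holomorphic_on ball 0 1" and pos: "\<And>w. norm w < 1 \<Longrightarrow> 0 < Re (g w)"
    and w: "norm w < 1" and v: "norm v < 1"
  shows "norm (g w) * ((1 - norm w) * (1 - norm v)) \<le> 4 * norm (g v)"
proof -
  have nz: "g u \<noteq> 0" if "norm u < 1" for u using pos[OF that] by auto
  have "norm (1 / g v) * (1 - norm v) \<le> 2 * norm (1 / g 0)"
  proof (rule Re_pos_growth[OF _ _ v])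
    show "(\<lambda>w. 1 / g w) holomorphic_on ball 0 1" using hol nz by (intro holomorphic_intros) auto
    show "0 < Re (1 / g u)" if "norm u < 1" for u
    proof -
      have "(Re (g u))\<^sup>2 + (Im (g u))\<^sup>2 > 0" using pos[OF that] by (simp add: sum_power2_gt_zero_iff)
      then show ?thesis using pos[OF that] by (simp add: Re_divide)
    qed
  qed
  then have 2: "norm (g 0) * (1 - norm v) \<le> 2 * norm (g v)"
    using nz[of 0] nz[OF v] by (simp add: norm_divide field_simps)
  have 1: "norm (g w) * (1 - norm w) \<le> 2 * norm (g 0)" by (rule Re_pos_growth[OF hol pos w])
  have "norm (g w) * ((1 - norm w) * (1 - norm v)) = (norm (g w) * (1 - norm w)) * (1 - norm v)" by simp
  also have "\<dots> \<le> (2 * norm (g 0)) * (1 - norm v)"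
    using 1 v by (intro mult_right_mono) auto
  also have "\<dots> \<le> 4 * norm (g v)" using 2 by simp
  finally show ?thesis .
qed

text \<open>The factor \<open>\<bar>Re \<xi>\<bar>\<^sup>b\<close> permits a blow-up at the imaginary axis. It is removed by the maximum
  principle for \<open>g(w) (w\<^sup>2 + \<rho>\<^sup>2)\<^sup>b\<close> on \<open>\<bar>w\<bar> = \<rho>\<close>, where \<open>\<bar>w\<^sup>2 + \<rho>\<^sup>2\<bar> = 2 \<rho> \<bar>Re w\<bar>\<close>. Then \<open>g\<close> is a polynomial,
  and without zeroes it is constant.\<close>

lemma zero_free_entire_growth_imp_constant:
  fixes g :: "complex \<Rightarrow> complex"
  assumes hol: "g holomorphic_on UNIV" and nz: "\<And>\<xi>. g \<xi> \<noteq> 0"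
    and growth: "\<And>\<xi>. \<rho>0 \<le> norm \<xi> \<Longrightarrow> norm (g \<xi>) * \<bar>Re \<xi>\<bar> ^ b \<le> C * norm \<xi> ^ a"
  shows "\<exists>c. \<forall>\<xi>. g \<xi> = c"
proof -
  have poly_growth: "norm (g \<xi>) \<le> (2^b * C * 2^a) * norm \<xi> ^ a" if "max \<rho>0 1 \<le> norm \<xi>" for \<xi>
  proof -
    define \<rho> where "\<rho> = 2 * norm \<xi>"
    have \<rho>: "2 \<le> \<rho>" "\<rho>0 \<le> \<rho>" using that by (auto simp: \<rho>_def)
    define F where "F = (\<lambda>w. g w * (w\<^sup>2 + (of_real \<rho>)\<^sup>2) ^ b)"
    have holF: "F holomorphic_on UNIV" unfolding F_def using hol by (intro holomorphic_intros)
    have "norm (F \<xi>) \<le> (2*\<rho>)^b * (C * \<rho>^a)"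
    proof (rule maximum_modulus_frontier[of F "cball 0 \<rho>"])
      show "F holomorphic_on interior (cball 0 \<rho>)" using holF holomorphic_on_subset by blast
      show "continuous_on (closure (cball 0 \<rho>)) F"
        using holF holomorphic_on_imp_continuous_on continuous_on_subset by blast
      show "\<xi> \<in> cball 0 \<rho>" using \<rho>_def by simp
      fix w assume "w \<in> frontier (cball (0::complex) \<rho>)"
      then have w: "norm w = \<rho>" using \<rho> by simp
      have "w\<^sup>2 + (of_real \<rho>)\<^sup>2 = w * (w + cnj w)"
        using w complex_norm_square[of w] by (simp add: algebra_simps power2_eq_square)
      also have "\<dots> = w * of_real (2 * Re w)" by (simp add: complex_add_cnj)
      finally have "norm (w\<^sup>2 + (of_real \<rho>)\<^sup>2) = 2 * \<rho> * \<bar>Re w\<bar>"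
        using w \<rho> by (simp add: norm_mult)
      then have "norm (F w) = (2*\<rho>)^b * (norm (g w) * \<bar>Re w\<bar>^b)"
        unfolding F_def by (simp add: norm_mult norm_power power_mult_distrib)
      also have "\<dots> \<le> (2*\<rho>)^b * (C * \<rho>^a)"
        using growth[of w] w \<rho> by (intro mult_left_mono) auto
      finally show "norm (F w) \<le> (2*\<rho>)^b * (C * \<rho>^a)" .
    qed auto
    moreover have "\<rho> \<le> norm (\<xi>\<^sup>2 + (of_real \<rho>)\<^sup>2)"
    proof -
      have "norm ((of_real \<rho>)\<^sup>2 + \<xi>\<^sup>2 :: complex) \<ge> norm ((of_real \<rho>)\<^sup>2::complex) - norm (\<xi>\<^sup>2)" by norm
      moreover have "norm ((of_real \<rho>)\<^sup>2::complex) = \<rho>\<^sup>2" using \<rho> by (simp add: norm_power)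
      moreover have "norm (\<xi>\<^sup>2) = \<rho>\<^sup>2 / 4" by (simp add: \<rho>_def norm_power power_mult_distrib)
      moreover have "\<rho> * 2 \<le> \<rho>\<^sup>2" using \<rho> by (simp add: power2_eq_square)
      ultimately show ?thesis using \<rho> by (simp add: add.commute)
    qed
    then have "norm (g \<xi>) * \<rho>^b \<le> norm (F \<xi>)"
      unfolding F_def norm_mult norm_power using \<rho> by (intro mult_left_mono power_mono) auto
    ultimately have "norm (g \<xi>) * \<rho>^b \<le> (2^b * (C * \<rho>^a)) * \<rho>^b"
      by (simp add: power_mult_distrib algebra_simps)
    then have "norm (g \<xi>) \<le> 2^b * (C * \<rho>^a)" using \<rho> by simp
    then show ?thesis by (simp add: \<rho>_def power_mult_distrib algebra_simps)
  qed
  define c where "c = (\<lambda>k. (deriv^^k) g 0 / fact k)"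
  have g_eq: "g \<xi> = (\<Sum>k\<le>a. c k * \<xi> ^ k)" for \<xi>
    unfolding c_def by (rule Liouville_polynomial[OF hol poly_growth, where A = "max \<rho>0 1"])
  show ?thesis
  proof (cases "\<exists>k\<in>{1..a}. c k \<noteq> 0")
    case True
    then obtain \<xi> where "(\<Sum>k\<le>a. c k * \<xi> ^ k) = 0"
      using fundamental_theorem_of_algebra[of c a] by blast
    with nz g_eq show ?thesis by metis
  next
    case False
    have "g \<xi> = (\<Sum>k\<le>a. if k = 0 then c 0 else 0)" for \<xi>
      unfolding g_eq using False by (intro sum.cong) auto
    then show ?thesis by metis
  qed
qed

section \<open>Polynomials whose coefficients depend on a parameter\<close>

lemma poly_eq_sum_atMost:
  fixes p :: "complex poly"
  assumes "degree p \<le> d"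
  shows "poly p x = (\<Sum>k\<le>d. coeff p k * x ^ k)"
  unfolding poly_altdef using assms by (intro sum.mono_neutral_left) (auto simp: coeff_eq_0)

definition Lagrange :: "(nat \<Rightarrow> complex) \<Rightarrow> nat \<Rightarrow> nat \<Rightarrow> complex poly" where
  "Lagrange \<sigma> d j = smult (inverse (\<Prod>i\<in>{..d}-{j}. \<sigma> j - \<sigma> i)) (\<Prod>i\<in>{..d}-{j}. [:- \<sigma> i, 1:])"

lemma degree_Lagrange: "j \<le> d \<Longrightarrow> degree (Lagrange \<sigma> d j) \<le> d"
proof -
  assume j: "j \<le> d"
  have "degree (\<Prod>i\<in>{..d}-{j}. [:- \<sigma> i, 1:]) \<le> (\<Sum>i\<in>{..d}-{j}. degree [:- \<sigma> i, 1:])"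
    using degree_prod_sum_le[of "{..d}-{j}" "\<lambda>i. [:- \<sigma> i, 1:]"] by (simp add: o_def)
  also have "\<dots> = d" using j by simp
  finally show ?thesis unfolding Lagrange_def using degree_smult_le order_trans by blast
qed

lemma poly_Lagrange:
  assumes inj: "inj \<sigma>" and ij: "i \<le> d" "j \<le> d"
  shows "poly (Lagrange \<sigma> d j) (\<sigma> i) = (if i = j then 1 else 0)"
proof -
  have nz: "(\<Prod>i\<in>{..d}-{j}. \<sigma> j - \<sigma> i) \<noteq> 0" using inj by (auto simp: inj_def prod_zero_iff)
  show ?thesis
  proof (cases "i = j")
    case True
    then show ?thesis using nz by (simp add: Lagrange_def poly_prod)
  next
    case False
    then have "(\<Prod>k\<in>{..d}-{j}. \<sigma> i - \<sigma> k) = 0" using ij by (intro prod_zero) auto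
    then show ?thesis using False by (simp add: Lagrange_def poly_prod)
  qed
qed

lemma Lagrange_interpolation:
  assumes inj: "inj \<sigma>" and deg: "degree p \<le> d"
  shows "p = (\<Sum>j\<le>d. smult (poly p (\<sigma> j)) (Lagrange \<sigma> d j))"
proof (rule poly_eqI_degree[of "\<sigma> ` {..d}"])
  have card: "card (\<sigma> ` {..d}) = Suc d" using inj inj_on_subset by (subst card_image) auto
  have "degree (\<Sum>j\<le>d. smult (poly p (\<sigma> j)) (Lagrange \<sigma> d j)) \<le> d"
    by (intro degree_sum_le order_trans[OF degree_smult_le]) (auto intro: degree_Lagrange)
  then show "degree (\<Sum>j\<le>d. smult (poly p (\<sigma> j)) (Lagrange \<sigma> d j)) < card (\<sigma> ` {..d})" using card by simp
  show "degree p < card (\<sigma> ` {..d})" using card deg by simp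
  fix x assume "x \<in> \<sigma> ` {..d}"
  then obtain i where i: "i \<le> d" and x: "x = \<sigma> i" by auto
  have "poly (\<Sum>j\<le>d. smult (poly p (\<sigma> j)) (Lagrange \<sigma> d j)) (\<sigma> i) = (\<Sum>j\<le>d. if j = i then poly p (\<sigma> i) else 0)"
    unfolding poly_sum by (intro sum.cong) (auto simp: poly_Lagrange[OF inj i])
  then show "poly p x = poly (\<Sum>j\<le>d. smult (poly p (\<sigma> j)) (Lagrange \<sigma> d j)) x" using i x by simp
qed

lemma holomorphic_on_coeff_pcompose_shift:
  fixes q :: "complex poly"
  shows "(\<lambda>u. coeff (pcompose q [:u, 1:]) k) holomorphic_on S"
proof (induction q arbitrary: k)
  case (pCons a q)
  have "coeff (pcompose (pCons a q) [:u, 1:]) k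
      = coeff [:a:] k + (u * coeff (pcompose q [:u, 1:]) k + (if k = 0 then 0 else coeff (pcompose q [:u, 1:]) (k - 1)))" for u
    by (cases k) (simp_all add: pcompose_pCons)
  then show ?case using pCons.IH by (cases "k = 0") (auto intro!: holomorphic_intros)
qed simp

text \<open>On each line \<open>u + w = s\<close> the function \<open>(w, u) \<mapsto> h\<^sub>u(w)\<close> is holomorphic, for each \<open>u\<close> it is a
  polynomial of unspecified degree. Some degree bound holds on an uncountable set of \<open>u\<close>, and there
  Lagrange interpolation in \<open>s\<close> expresses \<open>h\<^sub>u\<close> through its values on finitely many of the lines. Both
  sides are holomorphic in \<open>u\<close>, so the interpolation formula persists for all \<open>u\<close>.\<close>

lemma diagonal_holomorphic_imp_holomorphic_coeffs:
  fixes h :: "complex \<Rightarrow> complex poly"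
  assumes diag: "\<And>s. 0 < Re s \<Longrightarrow> (\<lambda>\<xi>. poly (h (s - \<xi>)) \<xi>) holomorphic_on {\<xi>. Re \<xi> < 0}"
    and \<eta>: "0 < \<eta>"
  obtains d where "\<And>u. \<eta> < Re u \<Longrightarrow> degree (h u) \<le> d"
    "\<And>k. (\<lambda>u. coeff (h u) k) holomorphic_on {u. \<eta> < Re u}"
proof -
  let ?U = "{u. \<eta> < Re u}"
  have U: "open ?U" "connected ?U"
    by (auto simp: open_halfspace_Re_gt convex_halfspace_Re_gt convex_connected)
  define g where "g = (\<lambda>s u. poly (h u) (s - u))"
  have g_hol: "g s holomorphic_on ?U" if "0 < Re s" "Re s < \<eta>" for s
  proof -
    have "(\<lambda>\<xi>. poly (h (s - \<xi>)) \<xi>) \<circ> (\<lambda>u. s - u) holomorphic_on ?U"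
      by (rule holomorphic_on_compose_gen[OF _ diag[OF that(1)]]) (use that in \<open>auto intro!: holomorphic_intros\<close>)
    then show ?thesis by (simp add: o_def g_def[abs_def])
  qed
  (* the nodes lie in (0, \<eta>), so that the lines u + w = \<sigma> j meet every u with Re u > \<eta> at a w with Re w < 0 *)
  define \<sigma> where "\<sigma> = (\<lambda>j::nat. complex_of_real (\<eta> / (real j + 2)))"
  have inj: "inj \<sigma>" using \<eta> by (auto simp: inj_def \<sigma>_def field_simps)
  have \<sigma>: "0 < Re (\<sigma> j)" "Re (\<sigma> j) < \<eta>" for j
  proof -
    show "0 < Re (\<sigma> j)" using \<eta> by (simp add: \<sigma>_def)
    have "\<eta> * 1 < \<eta> * (real j + 2)" using \<eta> by (intro mult_strict_left_mono) auto
    then show "Re (\<sigma> j) < \<eta>" using \<eta> by (simp add: \<sigma>_def field_simps)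
  qed
  define K where "K = cball (complex_of_real (\<eta> + 2)) 1"
  have cK: "compact K" by (simp add: K_def)
  have KU: "K \<subseteq> ?U"
  proof
    fix u assume "u \<in> K"
    then have "norm (complex_of_real (\<eta> + 2) - u) \<le> 1" by (simp add: K_def dist_norm)
    then have "\<bar>Re (complex_of_real (\<eta> + 2) - u)\<bar> \<le> 1" using abs_Re_le_cmod order_trans by blast
    then show "u \<in> ?U" by simp
  qed
  have "\<exists>d. infinite {u\<in>K. degree (h u) \<le> d}"
  proof (rule ccontr)
    assume "\<nexists>d. infinite {u\<in>K. degree (h u) \<le> d}"
    then have "countable (\<Union>d. {u\<in>K. degree (h u) \<le> d})"
      by (intro countable_UN countableI_type) (auto intro: countable_finite)
    moreover have "K = (\<Union>d. {u\<in>K. degree (h u) \<le> d})" by auto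
    ultimately have "countable K" by simp
    moreover have "uncountable K" unfolding K_def by (rule uncountable_cball) simp
    ultimately show False by simp
  qed
  then obtain d where inf: "infinite {u\<in>K. degree (h u) \<le> d}" by blast
  then obtain x where x: "x \<in> K" "x islimpt {u\<in>K. degree (h u) \<le> d}"
    using Heine_Borel_imp_Bolzano_Weierstrass[OF cK inf] by auto
  have g_pcompose: "g s u = poly (pcompose (h u) [:- u, 1:]) s" for s u
    by (simp add: g_def poly_pcompose)
  have interp: "g s u = (\<Sum>j\<le>d. g (\<sigma> j) u * poly (Lagrange \<sigma> d j) s)"
    if s: "0 < Re s" "Re s < \<eta>" and u: "u \<in> ?U" for s u
  proof -
    let ?f = "\<lambda>u. g s u - (\<Sum>j\<le>d. g (\<sigma> j) u * poly (Lagrange \<sigma> d j) s)"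
    have "?f u = 0"
    proof (rule analytic_continuation[OF _ U _ _ x(2) _ u])
      show "?f holomorphic_on ?U" using g_hol s \<sigma> by (intro holomorphic_intros) auto
      fix v assume "v \<in> {u\<in>K. degree (h u) \<le> d}"
      then have "degree (pcompose (h v) [:- v, 1:]) \<le> d" by (simp add: degree_pcompose)
      from arg_cong[OF Lagrange_interpolation[OF inj this], of "\<lambda>p. poly p s"]
      show "?f v = 0" by (simp add: g_pcompose[symmetric] poly_sum)
    qed (use KU x(1) in auto)
    then show ?thesis by simp
  qed
  have h_eq: "h u = (\<Sum>j\<le>d. smult (g (\<sigma> j) u) (pcompose (Lagrange \<sigma> d j) [:u, 1:]))"
    and deg: "degree (h u) \<le> d" if u: "\<eta> < Re u" for u
  proof -
    let ?p = "pcompose (h u) [:- u, 1:]" and ?q = "\<Sum>j\<le>d. smult (g (\<sigma> j) u) (Lagrange \<sigma> d j)"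
    have degq: "degree ?q \<le> d"
      by (intro degree_sum_le order_trans[OF degree_smult_le]) (auto intro: degree_Lagrange)
    have pq: "?p = ?q"
    proof (rule poly_eqI_degree[of "\<sigma> ` {..max d (degree ?p)}"])
      have card: "card (\<sigma> ` {..max d (degree ?p)}) = Suc (max d (degree ?p))"
        using inj inj_on_subset by (subst card_image) auto
      show "degree ?p < card (\<sigma> ` {..max d (degree ?p)})" using card by simp
      show "degree ?q < card (\<sigma> ` {..max d (degree ?p)})" using card degq by simp
      show "poly ?p x = poly ?q x" if "x \<in> \<sigma> ` {..max d (degree ?p)}" for x
      proof -
        from that obtain i where "x = \<sigma> i" by auto
        then show ?thesis using interp[OF \<sigma>, of u i] u by (simp add: g_pcompose[symmetric] poly_sum)
      qed
    qed
    have "degree (h u) = degree ?p" by (simp add: degree_pcompose)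
    then show "degree (h u) \<le> d" using pq degq by simp
    have "h u = pcompose ?p [:u, 1:]"
      by (simp add: pcompose_assoc[symmetric] pcompose_pCons)
    also have "\<dots> = pcompose ?q [:u, 1:]" by (simp only: pq)
    also have "\<dots> = (\<Sum>j\<le>d. smult (g (\<sigma> j) u) (pcompose (Lagrange \<sigma> d j) [:u, 1:]))"
      by (simp add: pcompose_sum pcompose_smult)
    finally show "h u = (\<Sum>j\<le>d. smult (g (\<sigma> j) u) (pcompose (Lagrange \<sigma> d j) [:u, 1:]))" .
  qed
  have "(\<lambda>u. coeff (h u) k) holomorphic_on ?U" for k
  proof -
    have "(\<lambda>u. \<Sum>j\<le>d. g (\<sigma> j) u * coeff (pcompose (Lagrange \<sigma> d j) [:u, 1:]) k) holomorphic_on ?U"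
      using g_hol \<sigma> by (intro holomorphic_intros holomorphic_on_coeff_pcompose_shift) auto
    then show ?thesis
      by (rule holomorphic_transform) (subst h_eq, auto simp: coeff_sum)
  qed
  with deg that show ?thesis by blast
qed

lemma uniform_limit_if_continuous_on_product:
  fixes f :: "'a::metric_space \<Rightarrow> 'b::metric_space \<Rightarrow> 'c::metric_space"
  assumes "compact T" "compact K" "continuous_on (T \<times> K) (\<lambda>(t, w). f t w)"
    and t: "\<And>n. t n \<in> T" "t \<longlonglongrightarrow> t0" "t0 \<in> T"
  shows "uniform_limit K (\<lambda>n. f (t n)) (f t0) sequentially"
proof (rule uniform_limitI)
  fix e :: real assume "0 < e"
  have "uniformly_continuous_on (T \<times> K) (\<lambda>(t, w). f t w)"
    by (rule compact_uniformly_continuous) (use assms in \<open>auto intro: compact_Times\<close>)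
  then obtain d where d: "0 < d" "\<And>x x'. x \<in> T \<times> K \<Longrightarrow> x' \<in> T \<times> K \<Longrightarrow> dist x' x < d \<Longrightarrow>
      dist (case x' of (t, w) \<Rightarrow> f t w) (case x of (t, w) \<Rightarrow> f t w) < e"
    using \<open>0 < e\<close> unfolding uniformly_continuous_on_def by metis
  have "\<forall>\<^sub>F n in sequentially. dist (t n) t0 < d" using t(2) d(1) by (rule tendstoD)
  then show "\<forall>\<^sub>F n in sequentially. \<forall>w\<in>K. dist (f (t n) w) (f t0 w) < e"
  proof eventually_elim
    case (elim n)
    show ?case
    proof
      fix w assume "w \<in> K"
      then show "dist (f (t n) w) (f t0 w) < e"
        using d(2)[of "(t0, w)" "(t n, w)"] elim t by (simp add: dist_Pair_Pair)
    qed
  qed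
qed

text \<open>As \<open>\<delta> \<rightarrow> 0+\<close> the functions \<open>u \<mapsto> \<delta>\<^sup>d p\<^sub>u(1/\<delta>)\<close> converge to the coefficient of degree \<open>d\<close>. They have
  no zeroes, so by Hurwitz's theorem the limit has none either: the degree cannot drop.\<close>

lemma top_coeff_nonzero:
  fixes P :: "complex \<Rightarrow> complex poly"
  assumes deg: "\<And>u. \<eta> < Re u \<Longrightarrow> degree (P u) \<le> d"
    and hol: "\<And>k. (\<lambda>u. coeff (P u) k) holomorphic_on {u. \<eta> < Re u}"
    and nz: "\<And>u w. \<eta> < Re u \<Longrightarrow> 0 \<le> Re w \<Longrightarrow> poly (P u) w \<noteq> 0"
    and u0: "\<eta> < Re u0" "coeff (P u0) d \<noteq> 0" and u: "\<eta> < Re u"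
  shows "coeff (P u) d \<noteq> 0"
proof (cases "(\<lambda>u. coeff (P u) d) constant_on {u. \<eta> < Re u}")
  case True
  then show ?thesis using u0 u by (force simp: constant_on_def)
next
  case False
  define \<delta> where "\<delta> = (\<lambda>n. inverse (of_nat (Suc n)) :: complex)"
  have \<delta>: "\<delta> n \<noteq> 0" "0 \<le> Re (inverse (\<delta> n))" for n by (simp_all add: \<delta>_def del: of_nat_Suc)
  define F where "F = (\<lambda>n u. \<Sum>k\<le>d. coeff (P u) k * \<delta> n ^ (d - k))"
  have F_eq: "F n u = \<delta> n ^ d * poly (P u) (inverse (\<delta> n))" if "\<eta> < Re u" for n u
  proof -
    have "poly (P u) (inverse (\<delta> n)) = (\<Sum>k\<le>d. coeff (P u) k * inverse (\<delta> n) ^ k)"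
      using deg[OF that] by (rule poly_eq_sum_atMost)
    moreover have eq: "\<delta> n ^ d * (coeff (P u) k * inverse (\<delta> n) ^ k) = coeff (P u) k * \<delta> n ^ (d - k)" if "k \<le> d" for k
      using that \<delta>(1)[of n] by (simp add: power_diff field_simps)
    moreover have "F n u = (\<Sum>k\<le>d. \<delta> n ^ d * (coeff (P u) k * inverse (\<delta> n) ^ k))"
      unfolding F_def by (rule sum.cong[OF refl]) (rule eq[symmetric], simp)
    ultimately show ?thesis by (simp only: sum_distrib_left)
  qed
  show ?thesis
  proof (rule Hurwitz_no_zeros[where S = "{u. \<eta> < Re u}" and \<F> = F and g = "\<lambda>u. coeff (P u) d"])
    show "F n holomorphic_on {u. \<eta> < Re u}" for n
      unfolding F_def using hol by (intro holomorphic_intros)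
    show "F n v \<noteq> 0" if "v \<in> {u. \<eta> < Re u}" for n v
      using F_eq[of v n] nz[of v "inverse (\<delta> n)"] that \<delta> by simp
    fix K assume K: "compact K" "K \<subseteq> {u. \<eta> < Re u}"
    have lim\<delta>: "\<delta> \<longlonglongrightarrow> 0" unfolding \<delta>_def by (rule LIMSEQ_Suc[OF lim_inverse_n])
    have "uniform_limit K (\<lambda>n. (\<lambda>x u. \<Sum>k\<le>d. coeff (P u) k * x ^ (d - k)) (\<delta> n))
        ((\<lambda>x u. \<Sum>k\<le>d. coeff (P u) k * x ^ (d - k)) 0) sequentially"
    proof (rule uniform_limit_if_continuous_on_product[where T = "cball 0 1"])
      have "continuous_on (cball 0 1 \<times> K) (\<lambda>z. coeff (P (snd z)) k)" for k
        using holomorphic_on_imp_continuous_on[OF holomorphic_on_subset[OF hol K(2)]]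
        by (rule continuous_on_compose2) (auto intro!: continuous_intros)
      then show "continuous_on (cball 0 1 \<times> K) (\<lambda>(x, u). \<Sum>k\<le>d. coeff (P u) k * x ^ (d - k))"
        unfolding case_prod_unfold by (intro continuous_intros)
      show "\<delta> n \<in> cball 0 1" for n by (simp add: \<delta>_def norm_inverse inverse_le_1_iff del: of_nat_Suc)
    qed (use K lim\<delta> in auto)
    moreover have "(\<Sum>k\<le>d. coeff (P u) k * 0 ^ (d - k)) = coeff (P u) d" for u
    proof -
      have "(\<Sum>k\<le>d. coeff (P u) k * 0 ^ (d - k)) = (\<Sum>k\<le>d. if k = d then coeff (P u) d else 0)"
        by (intro sum.cong) auto
      then show ?thesis by simp
    qed
    ultimately show "uniform_limit K F (\<lambda>u. coeff (P u) d) sequentially" unfolding F_def by simp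
  qed (use hol False u in \<open>auto simp: open_halfspace_Re_gt convex_halfspace_Re_gt convex_connected\<close>)
qed

lemma exact_degree_bound:
  fixes P :: "complex \<Rightarrow> complex poly"
  assumes bd: "\<And>u. \<eta> < Re u \<Longrightarrow> degree (P u) \<le> D"
    and nz: "\<And>u. \<eta> < Re u \<Longrightarrow> P u \<noteq> 0"
  obtains d u0 where "\<And>u. \<eta> < Re u \<Longrightarrow> degree (P u) \<le> d" "\<eta> < Re u0" "coeff (P u0) d \<noteq> 0"
proof -
  define d where "d = (LEAST d. \<forall>u. \<eta> < Re u \<longrightarrow> degree (P u) \<le> d)"
  have d: "\<forall>u. \<eta> < Re u \<longrightarrow> degree (P u) \<le> d"
    unfolding d_def by (rule LeastI[of _ D]) (use bd in blast)
  have "\<exists>u0. \<eta> < Re u0 \<and> degree (P u0) = d"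
  proof (rule ccontr)
    assume no: "\<nexists>u0. \<eta> < Re u0 \<and> degree (P u0) = d"
    have "d \<noteq> 0"
    proof
      assume "d = 0"
      define u1 where "u1 = complex_of_real (\<eta> + 1)"
      have u1: "\<eta> < Re u1" by (simp add: u1_def)
      then have "degree (P u1) = d" using d \<open>d = 0\<close> by simp
      with u1 no show False by blast
    qed
    moreover have "\<forall>u. \<eta> < Re u \<longrightarrow> degree (P u) \<le> d - 1"
    proof (intro allI impI)
      fix u assume "\<eta> < Re u"
      then have "degree (P u) \<le> d" "degree (P u) \<noteq> d" using d no by blast+
      then show "degree (P u) \<le> d - 1" by linarith
    qed
    then have "d \<le> d - 1" unfolding d_def by (rule Least_le)
    ultimately show False by simp
  qed
  then obtain u0 where u0: "\<eta> < Re u0" "degree (P u0) = d" by blast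
  have "coeff (P u0) d \<noteq> 0" using nz[OF u0(1)] unfolding u0(2)[symmetric] by simp
  then show ?thesis using that[of d u0] d u0(1) by blast
qed

lemma degree_le_if_dominated:
  fixes p q :: "complex poly"
  assumes "\<And>x::real. 0 \<le> x \<Longrightarrow> norm (poly p (of_real x)) \<le> norm (poly q (of_real x))"
  shows "degree p \<le> degree q"
proof (rule ccontr)
  assume "\<not> degree p \<le> degree q"
  then have less: "degree q < degree p" by simp
  have p0: "lead_coeff p \<noteq> 0" using less by auto
  let ?y = "\<lambda>n. inverse (of_nat (Suc n)) :: complex"
  have y0: "?y \<longlonglongrightarrow> 0" by (rule LIMSEQ_Suc[OF lim_inverse_n])
  have rp: "(\<lambda>n. norm (poly (reflect_poly p) (?y n))) \<longlonglongrightarrow> norm (lead_coeff p)"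
    using tendsto_norm[OF isCont_tendsto_compose[OF poly_isCont y0, of "reflect_poly p"]] by simp
  have "(\<lambda>n. norm (?y n) ^ (degree p - degree q) * norm (poly (reflect_poly q) (?y n)))
      \<longlonglongrightarrow> norm (0::complex) ^ (degree p - degree q) * norm (poly (reflect_poly q) 0)"
    by (intro tendsto_mult tendsto_power tendsto_norm isCont_tendsto_compose[OF poly_isCont y0] y0)
  then have rq: "(\<lambda>n. norm (?y n) ^ (degree p - degree q) * norm (poly (reflect_poly q) (?y n))) \<longlonglongrightarrow> 0"
    using less by (simp add: power_0_left)
  have "norm (lead_coeff p) \<le> 0"
  proof (rule LIMSEQ_le[OF rp rq])
    have "norm (poly (reflect_poly p) (?y n)) \<le> norm (?y n) ^ (degree p - degree q) * norm (poly (reflect_poly q) (?y n))" for n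
    proof -
      have y: "?y n \<noteq> 0" by (simp del: of_nat_Suc)
      have "norm (poly (reflect_poly p) (?y n)) = norm (?y n) ^ degree p * norm (poly p (of_nat (Suc n)))"
        by (simp add: poly_reflect_poly_nz[OF y] norm_mult norm_power del: of_nat_Suc)
      also have "\<dots> \<le> norm (?y n) ^ degree p * norm (poly q (of_nat (Suc n)))"
        using assms[of "real (Suc n)"] by (intro mult_left_mono) (simp_all del: of_nat_Suc)
      also have "norm (?y n) ^ degree p = norm (?y n) ^ (degree p - degree q) * norm (?y n) ^ degree q"
        using less by (simp add: power_add[symmetric])
      also have "\<dots> * norm (poly q (of_nat (Suc n))) = norm (?y n) ^ (degree p - degree q) * norm (poly (reflect_poly q) (?y n))"
        by (simp add: poly_reflect_poly_nz[OF y] norm_mult norm_power del: of_nat_Suc)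
      finally show ?thesis .
    qed
    then show "\<exists>N. \<forall>n\<ge>N. norm (poly (reflect_poly p) (?y n)) \<le> norm (?y n) ^ (degree p - degree q) * norm (poly (reflect_poly q) (?y n))"
      by blast
  qed
  with p0 show False by simp
qed

section \<open>Polynomial families with zeroes in the left half-plane\<close>

text \<open>The Cayley transform \<open>\<xi> = - (1 + w) / (1 - w)\<close> maps the unit disc onto the left half-plane and
  \<open>w = 1\<close> to infinity. The function \<open>disc_poly d p\<close> is \<open>p\<close> in the variable \<open>w\<close>, multiplied by
  \<open>(1 - w)\<^sup>d\<close>: homogenised in this way, the polynomial has a value at infinity too.\<close>

definition disc_poly :: "nat \<Rightarrow> complex poly \<Rightarrow> complex \<Rightarrow> complex" where
  "disc_poly d p w = (\<Sum>k\<le>d. coeff p k * (- (1 + w)) ^ k * (1 - w) ^ (d - k))"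

lemma disc_poly_eq:
  assumes "degree p \<le> d" "w \<noteq> 1"
  shows "disc_poly d p w = (1 - w) ^ d * poly p (- (1 + w) / (1 - w))"
proof -
  have eq: "(1 - w) ^ d * (coeff p k * (- (1 + w) / (1 - w)) ^ k) = coeff p k * (- (1 + w)) ^ k * (1 - w) ^ (d - k)"
    if "k \<le> d" for k
  proof -
    have "(1 - w) ^ d = (1 - w) ^ (d - k) * (1 - w) ^ k" using that by (simp add: power_add[symmetric])
    then show ?thesis using assms by (simp only: power_divide) (simp add: field_simps)
  qed
  show ?thesis
    unfolding poly_eq_sum_atMost[OF assms(1)] sum_distrib_left disc_poly_def
    by (rule sum.cong[OF refl]) (rule eq[symmetric], simp)
qed

lemma disc_poly_1: "disc_poly d p 1 = coeff p d * (- 2) ^ d"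
proof -
  have "disc_poly d p 1 = (\<Sum>k\<le>d. if k = d then coeff p d * (- 2) ^ d else 0)"
    unfolding disc_poly_def by (intro sum.cong) auto
  then show ?thesis by simp
qed

lemma Re_Cayley: "Re (- (1 + w) / (1 - w)) = ((norm w)\<^sup>2 - 1) / (norm (1 - w))\<^sup>2"
  unfolding Re_divide cmod_power2
  by (rule arg_cong2[where f = "(/)"]) (simp_all add: power2_eq_square algebra_simps)

lemma Cayley_inverse:
  assumes "Re \<xi> < 0"
  defines "w \<equiv> (\<xi> + 1) / (\<xi> - 1)"
  shows "norm w < 1" "- (1 + w) / (1 - w) = \<xi>" "w \<noteq> 1" "2 * \<bar>Re \<xi>\<bar> / (norm (\<xi> - 1))\<^sup>2 \<le> 1 - norm w"
proof -
  have ne: "\<xi> - 1 \<noteq> 0" using assms(1) by auto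
  have sq: "(norm (\<xi> - 1))\<^sup>2 - (norm (\<xi> + 1))\<^sup>2 = 4 * \<bar>Re \<xi>\<bar>"
    using assms(1) unfolding cmod_power2 by (simp add: power2_eq_square algebra_simps)
  then have "(norm (\<xi> + 1))\<^sup>2 < (norm (\<xi> - 1))\<^sup>2" using assms(1) by simp
  then have "norm (\<xi> + 1) < norm (\<xi> - 1)" by (rule power2_less_imp_less) simp
  then show w: "norm w < 1" using ne by (simp add: w_def norm_divide)
  then show "w \<noteq> 1" by auto
  have 1: "1 - w = - 2 / (\<xi> - 1)" using ne by (simp add: w_def field_simps)
  have 2: "1 + w = 2 * \<xi> / (\<xi> - 1)" using ne by (simp add: w_def field_simps)
  show "- (1 + w) / (1 - w) = \<xi>" unfolding 1 2 using ne by (simp add: field_simps)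
  have "1 - (norm w)\<^sup>2 = 4 * \<bar>Re \<xi>\<bar> / (norm (\<xi> - 1))\<^sup>2"
    unfolding sq[symmetric] using ne by (simp add: w_def norm_divide power_divide diff_divide_distrib)
  moreover have "1 - (norm w)\<^sup>2 \<le> 2 * (1 - norm w)"
    using zero_le_power2[of "1 - norm w"] by (simp add: power2_eq_square algebra_simps)
  ultimately show "2 * \<bar>Re \<xi>\<bar> / (norm (\<xi> - 1))\<^sup>2 \<le> 1 - norm w" by simp
qed

text \<open>The two families of interest are \<open>h\<^sub>2\<close> and \<open>h\<^sub>2 - z h\<^sub>1\<close>. The assumption \<open>top\<close> says that no
  zero escapes to infinity; after the Cayley transform this is the same as having no zero at \<open>1\<close>.\<close>

locale stable_family =
  fixes P :: "complex \<Rightarrow> complex poly" and d :: nat and \<eta> :: real and s :: complex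
  assumes degree_P: "\<And>u. \<eta> < Re u \<Longrightarrow> degree (P u) \<le> d"
    and coeff_P: "\<And>k. (\<lambda>u. coeff (P u) k) holomorphic_on {u. \<eta> < Re u}"
    and stable: "\<And>u w. \<eta> < Re u \<Longrightarrow> 0 \<le> Re w \<Longrightarrow> poly (P u) w \<noteq> 0"
    and top: "\<And>u. \<eta> < Re u \<Longrightarrow> coeff (P u) d \<noteq> 0"
    and s: "\<eta> < Re s"
begin

text \<open>In the variable \<open>w\<close> the diagonal \<open>u = s - \<xi>\<close> is \<open>u = param 1 w\<close>, which is singular at the boundary
  point \<open>1\<close>. With \<open>r w\<close> in place of \<open>w\<close> in the parameter only, \<open>r < 1\<close>, all functions are holomorphic
  beyond the closed disc, while the zeroes of the polynomial for each single \<open>u\<close> stay in the open disc.\<close>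

definition param :: "real \<Rightarrow> complex \<Rightarrow> complex" where
  "param r w = s + (1 + complex_of_real r * w) / (1 - complex_of_real r * w)"

definition diag :: "complex \<Rightarrow> complex" where
  "diag \<xi> = poly (P (s - \<xi>)) \<xi>"

definition diag_r :: "real \<Rightarrow> complex \<Rightarrow> complex" where
  "diag_r r w = disc_poly d (P (param r w)) w"

lemma Re_param: "norm (complex_of_real r * w) < 1 \<Longrightarrow> \<eta> < Re (param r w)"
proof -
  assume "norm (complex_of_real r * w) < 1"
  then have "(norm (complex_of_real r * w))\<^sup>2 \<le> 1" by (simp add: abs_square_le_1)
  then have "Re (- (1 + complex_of_real r * w) / (1 - complex_of_real r * w)) \<le> 0" unfolding Re_Cayley by (intro divide_nonpos_nonneg) auto
  moreover have "Re (param r w) = Re s - Re (- (1 + complex_of_real r * w) / (1 - complex_of_real r * w))"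
    by (simp only: param_def minus_divide_left[symmetric]) simp
  ultimately show ?thesis using s by simp
qed

lemma disc_poly_nonzero:
  assumes u: "\<eta> < Re u" and w: "1 \<le> norm w"
  shows "disc_poly d (P u) w \<noteq> 0"
proof (cases "w = 1")
  case True
  then show ?thesis using top[OF u] by (simp add: disc_poly_1)
next
  case False
  have "1 \<le> (norm w)\<^sup>2" using w by simp
  then have "0 \<le> Re (- (1 + w) / (1 - w))" unfolding Re_Cayley by simp
  with False show ?thesis using stable[OF u] disc_poly_eq[OF degree_P[OF u] False] by simp
qed

lemma diag_r_nonzero: "norm (complex_of_real r * w) < 1 \<Longrightarrow> 1 \<le> norm w \<Longrightarrow> diag_r r w \<noteq> 0"
  unfolding diag_r_def using disc_poly_nonzero Re_param by blast

lemma diag_r_1: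
  assumes "norm w < 1"
  shows "diag_r 1 w = (1 - w) ^ d * diag (- (1 + w) / (1 - w))"
proof -
  have w: "w \<noteq> 1" using assms by auto
  have "param 1 w = s - (- (1 + w) / (1 - w))"
    by (simp only: param_def of_real_1 mult_1 minus_divide_left[symmetric] diff_minus_eq_add)
  moreover have "\<eta> < Re (param 1 w)" using assms by (intro Re_param) simp
  ultimately show ?thesis
    unfolding diag_r_def diag_def using disc_poly_eq[OF degree_P w, of "param 1 w"] by simp
qed

lemma holomorphic_on_param: "param r holomorphic_on {w. norm (complex_of_real r * w) < 1}"
proof -
  have "1 - complex_of_real r * w \<noteq> 0" if "norm (complex_of_real r * w) < 1" for w
  proof
    assume "1 - complex_of_real r * w = 0"
    then have "complex_of_real r * w = 1" by simp
    with that show False by simp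
  qed
  then show ?thesis unfolding param_def[abs_def] by (intro holomorphic_intros) auto
qed

lemma holomorphic_on_diag_r: "diag_r r holomorphic_on {w. norm (complex_of_real r * w) < 1}"
proof -
  have "(\<lambda>w. coeff (P (param r w)) k) holomorphic_on {w. norm (complex_of_real r * w) < 1}" for k
    using holomorphic_on_compose_gen[OF holomorphic_on_param coeff_P[of k]] Re_param by (auto simp: o_def)
  then show ?thesis
    unfolding diag_r_def[abs_def] disc_poly_def by (intro holomorphic_intros)
qed

lemma continuous_on_diag_r:
  assumes "\<And>r w. r \<in> T \<Longrightarrow> w \<in> K \<Longrightarrow> norm (complex_of_real r * w) < 1"
  shows "continuous_on (T \<times> K) (\<lambda>(r, w). diag_r r w)"
proof -
  have nz: "1 - complex_of_real (fst z) * snd z \<noteq> 0" if "z \<in> T \<times> K" for z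
  proof
    assume "1 - complex_of_real (fst z) * snd z = 0"
    then have "complex_of_real (fst z) * snd z = 1" by simp
    then show False using assms[of "fst z" "snd z"] that by auto
  qed
  have "continuous_on (T \<times> K) (\<lambda>z. param (fst z) (snd z))"
    unfolding param_def using nz by (intro continuous_intros) auto
  then have "continuous_on (T \<times> K) (\<lambda>z. coeff (P (param (fst z) (snd z))) k)" for k
    by (rule continuous_on_compose2[OF holomorphic_on_imp_continuous_on[OF coeff_P]])
      (use assms Re_param in auto)
  then show ?thesis
    unfolding diag_r_def disc_poly_def case_prod_unfold by (intro continuous_intros)
qed

lemma holomorphic_on_diag: "diag holomorphic_on {\<xi>. Re \<xi> < Re s - \<eta>}"
proof -
  have c: "(\<lambda>\<xi>. coeff (P (s - \<xi>)) k) holomorphic_on {\<xi>. Re \<xi> < Re s - \<eta>}" for k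
  proof -
    have "(\<lambda>u. coeff (P u) k) \<circ> (\<lambda>\<xi>. s - \<xi>) holomorphic_on {\<xi>. Re \<xi> < Re s - \<eta>}"
      by (rule holomorphic_on_compose_gen[OF _ coeff_P]) (auto intro!: holomorphic_intros)
    then show ?thesis by (simp add: o_def)
  qed
  have "(\<lambda>\<xi>. \<Sum>k\<le>d. coeff (P (s - \<xi>)) k * \<xi> ^ k) holomorphic_on {\<xi>. Re \<xi> < Re s - \<eta>}"
    using c by (intro holomorphic_intros)
  then show ?thesis
  proof (rule holomorphic_transform)
    fix \<xi> assume "\<xi> \<in> {\<xi>. Re \<xi> < Re s - \<eta>}"
    then have "\<eta> < Re (s - \<xi>)" by simp
    then show "(\<Sum>k\<le>d. coeff (P (s - \<xi>)) k * \<xi> ^ k) = diag \<xi>"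
      unfolding diag_def by (intro poly_eq_sum_atMost[OF degree_P, symmetric])
  qed
qed

lemma diag_nonzero: "0 \<le> Re \<xi> \<Longrightarrow> Re \<xi> < Re s - \<eta> \<Longrightarrow> diag \<xi> \<noteq> 0"
  unfolding diag_def by (rule stable) auto

text \<open>Otherwise \<open>diag\<close> would vanish on the strip beyond the imaginary axis as well.\<close>

lemma diag_nonzero_left: "\<exists>\<xi>. Re \<xi> < 0 \<and> diag \<xi> \<noteq> 0"
proof (rule ccontr)
  assume a: "\<nexists>\<xi>. Re \<xi> < 0 \<and> diag \<xi> \<noteq> 0"
  have "diag 0 = 0"
  proof (rule analytic_continuation_open[where s = "{\<xi>. Re \<xi> < 0}" and s' = "{\<xi>. Re \<xi> < Re s - \<eta>}" and f = diag and g = "\<lambda>_. 0"])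
    show "{\<xi>::complex. Re \<xi> < 0} \<noteq> {}" by (auto intro: exI[of _ "-1"])
  qed (use a s holomorphic_on_diag in \<open>auto simp: open_halfspace_Re_lt convex_halfspace_Re_lt convex_connected\<close>)
  then show False using diag_nonzero[of 0] s by simp
qed

lemma diag_r_1_nonzero: "\<exists>w. norm w < 1 \<and> diag_r 1 w \<noteq> 0"
proof -
  obtain \<xi> where \<xi>: "Re \<xi> < 0" "diag \<xi> \<noteq> 0" using diag_nonzero_left by blast
  note C = Cayley_inverse[OF \<xi>(1)]
  have "diag_r 1 ((\<xi> + 1) / (\<xi> - 1)) \<noteq> 0"
    unfolding diag_r_1[OF C(1)] C(2) using \<xi>(2) C(3) by simp
  with C(1) show ?thesis by blast
qed

definition zero_count :: "real \<Rightarrow> int" where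
  "zero_count r = (\<Sum>p\<in>{w\<in>ball 0 1. diag_r r w = 0}. zorder (diag_r r) p)"

lemma larger_disc:
  assumes "0 \<le> r" "r < 1"
  obtains \<rho> where "1 < \<rho>" "\<And>w. norm w < \<rho> \<Longrightarrow> norm (complex_of_real r * w) < 1"
proof
  show "1 < 2 / (1 + r)" using assms by (simp add: field_simps)
  fix w :: complex assume "norm w < 2 / (1 + r)"
  then have "r * norm w \<le> r * (2 / (1 + r))" using assms by (intro mult_left_mono) auto
  also have "\<dots> < 1" using assms by (simp add: field_simps)
  finally show "norm (complex_of_real r * w) < 1" using assms by (simp add: norm_mult)
qed

text \<open>The zeroes cannot cross the unit circle while \<open>r\<close> varies: by compactness there is a lower
  bound for \<open>\<bar>diag_r r w\<bar>\<close> on the circle, and Rouche's theorem applies to small changes of \<open>r\<close>.\<close>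

lemma zero_count_const:
  assumes "0 \<le> r" "r < 1"
  shows "zero_count r = zero_count 0"
proof -
  have lt1: "norm (complex_of_real x * w) < 1" if "x \<in> {0..r}" "norm w = 1" for x w
    using that assms by (simp add: norm_mult)
  have cont: "continuous_on ({0..r} \<times> sphere 0 1) (\<lambda>(x, w). diag_r x w)"
    by (rule continuous_on_diag_r) (use lt1 in auto)
  have comp: "compact ({0..r} \<times> sphere (0::complex) 1)" by (intro compact_Times) auto
  have ne: "{0..r} \<times> sphere (0::complex) 1 \<noteq> {}"
  proof -
    have "(0, 1) \<in> {0..r} \<times> sphere (0::complex) 1" using assms by simp
    then show ?thesis by blast
  qed
  have cn: "continuous_on ({0..r} \<times> sphere 0 1) (\<lambda>z. norm (case z of (x, w) \<Rightarrow> diag_r x w))"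
    using cont by (rule continuous_on_norm)
  obtain z0 where z0: "z0 \<in> {0..r} \<times> sphere (0::complex) 1"
      "\<forall>z\<in>{0..r} \<times> sphere 0 1. norm (case z0 of (x, w) \<Rightarrow> diag_r x w) \<le> norm (case z of (x, w) \<Rightarrow> diag_r x w)"
    using continuous_attains_inf[OF comp ne cn] by (rule bexE)
  define m where "m = norm (case z0 of (x, w) \<Rightarrow> diag_r x w)"
  have m: "0 < m" "\<And>x w. x \<in> {0..r} \<Longrightarrow> norm w = 1 \<Longrightarrow> m \<le> norm (diag_r x w)"
  proof -
    show "0 < m" using z0(1) lt1 diag_r_nonzero by (auto simp: m_def)
    show "m \<le> norm (diag_r x w)" if "x \<in> {0..r}" "norm w = 1" for x w
      using bspec[OF z0(2), of "(x, w)"] that by (simp add: m_def)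
  qed
  have "uniformly_continuous_on ({0..r} \<times> sphere 0 1) (\<lambda>(x, w). diag_r x w)"
    using cont comp by (rule compact_uniformly_continuous)
  from uniformly_continuous_onE[OF this m(1)] obtain \<delta> where \<delta>: "0 < \<delta>"
      "\<And>z z'. z \<in> {0..r} \<times> sphere 0 1 \<Longrightarrow> z' \<in> {0..r} \<times> sphere 0 1 \<Longrightarrow> dist z' z < \<delta> \<Longrightarrow>
      dist (case z' of (x, w) \<Rightarrow> diag_r x w) (case z of (x, w) \<Rightarrow> diag_r x w) < m"
    by metis
  obtain \<rho> where \<rho>: "1 < \<rho>" "\<And>w. norm w < \<rho> \<Longrightarrow> norm (complex_of_real r * w) < 1"
    using larger_disc[OF assms] by blast
  have local_const: "zero_count y = zero_count x" if xy: "x \<in> {0..r}" "y \<in> {0..r}" "\<bar>y - x\<bar> < \<delta>" for x y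
    unfolding zero_count_def
  proof (rule Rouche_unit_circle(3)[OF \<rho>(1)])
    have hol: "diag_r t holomorphic_on ball 0 \<rho>" if "t \<in> {0..r}" for t
    proof (rule holomorphic_on_subset[OF holomorphic_on_diag_r])
      show "ball 0 \<rho> \<subseteq> {w. norm (complex_of_real t * w) < 1}"
      proof
        fix w :: complex assume "w \<in> ball 0 \<rho>"
        then have "norm (complex_of_real r * w) < 1" using \<rho>(2) by simp
        moreover have "t * norm w \<le> r * norm w" using that by (intro mult_right_mono) auto
        ultimately show "w \<in> {w. norm (complex_of_real t * w) < 1}" using that assms by (simp add: norm_mult)
      qed
    qed
    show "diag_r x holomorphic_on ball 0 \<rho>" "diag_r y holomorphic_on ball 0 \<rho>" using hol xy by auto
    fix w :: complex assume w: "norm w = 1"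
    have "dist (diag_r y w) (diag_r x w) < m"
      using \<delta>(2)[of "(x, w)" "(y, w)"] xy w by (simp add: dist_Pair_Pair dist_real_def)
    then show "norm (diag_r y w - diag_r x w) < norm (diag_r x w)"
      using m(2)[OF xy(1) w] by (simp add: dist_norm)
  qed
  have chain: "zero_count (min (real j * (\<delta>/2)) r) = zero_count 0" for j
  proof (induction j)
    case 0 show ?case using assms by simp
  next
    case (Suc j)
    have "zero_count (min (real (Suc j) * (\<delta>/2)) r) = zero_count (min (real j * (\<delta>/2)) r)"
    proof (rule local_const)
      have step: "real (Suc j) * (\<delta>/2) = real j * (\<delta>/2) + \<delta>/2" by (simp add: algebra_simps)
      show "\<bar>min (real (Suc j) * (\<delta>/2)) r - min (real j * (\<delta>/2)) r\<bar> < \<delta>"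
        unfolding step using \<delta>(1) by linarith
    qed (use \<delta>(1) assms in auto)
    with Suc show ?case by simp
  qed
  obtain j where "r / (\<delta>/2) < real j" using reals_Archimedean2 by blast
  then have "min (real j * (\<delta>/2)) r = r" using \<delta>(1) by (simp add: field_simps min_def)
  with chain[of j] show ?thesis by simp
qed

lemma diag_r_factorization:
  assumes r: "0 \<le> r" "r < 1"
  obtains q k \<rho> where "1 < \<rho>" "k holomorphic_on ball 0 \<rho>" "\<And>w. w \<in> ball 0 \<rho> \<Longrightarrow> k w \<noteq> 0"
    "\<And>w. w \<in> ball 0 \<rho> \<Longrightarrow> diag_r r w = (\<Prod>i=1..nat (zero_count 0). w - q i) * k w"
    "\<And>i. i \<in> {1..nat (zero_count 0)} \<Longrightarrow> norm (q i :: complex) < 1"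
proof -
  obtain \<rho> where \<rho>: "1 < \<rho>" "\<And>w. norm w < \<rho> \<Longrightarrow> norm (complex_of_real r * w) < 1"
    using larger_disc[OF r] by blast
  have hol: "diag_r r holomorphic_on ball 0 \<rho>"
    by (rule holomorphic_on_subset[OF holomorphic_on_diag_r]) (use \<rho>(2) in auto)
  have out: "diag_r r w \<noteq> 0" if "w \<in> ball 0 \<rho>" "1 \<le> norm w" for w
    using diag_r_nonzero \<rho>(2) that by simp
  have Z: "{w\<in>ball 0 \<rho>. diag_r r w = 0} = {w\<in>ball 0 1. diag_r r w = 0}"
  proof -
    have "norm w < 1" if "w \<in> ball 0 \<rho>" "diag_r r w = 0" for w
      using out[OF that(1)] that(2) by (meson not_le)
    then show ?thesis using \<rho>(1) by auto
  qed
  have fin: "finite {w\<in>ball 0 \<rho>. diag_r r w = 0}"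
    unfolding Z by (rule Rouche_unit_circle(1)[OF \<rho>(1) hol hol]) (use out \<rho>(1) in auto)
  have ex: "\<exists>w\<in>ball 0 \<rho>. diag_r r w \<noteq> 0" using out[of 1] \<rho>(1) by (intro bexI[of _ 1]) auto
  obtain n q k where lz: "lists_zeroes (diag_r r) (ball 0 \<rho>) n q" and k: "k holomorphic_on ball 0 \<rho>"
      "\<And>w. w \<in> ball 0 \<rho> \<Longrightarrow> k w \<noteq> 0" "\<And>w. w \<in> ball 0 \<rho> \<Longrightarrow> diag_r r w = (\<Prod>i=1..n. w - q i) * k w"
      and n: "int n = (\<Sum>p\<in>{w\<in>ball 0 \<rho>. diag_r r w = 0}. zorder (diag_r r) p)"
    by (rule factor_out_zeroes[OF hol open_ball connected_ball fin ex]) blast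
  have "int n = zero_count 0" using n zero_count_const[OF r] unfolding Z zero_count_def by simp
  then have N: "n = nat (zero_count 0)" by simp
  have "norm (q i) < 1" if "i \<in> {1..n}" for i
  proof -
    have "q i \<in> {w\<in>ball 0 \<rho>. diag_r r w = 0}" using lz that unfolding lists_zeroes_def by blast
    then show ?thesis unfolding Z by simp
  qed
  then show ?thesis using that[OF \<rho>(1) k[unfolded N]] N by blast
qed

end

text \<open>Hurwitz's theorem on a small disc that the zeroes of the approximating functions have left.\<close>

lemma zeroes_of_limit:
  fixes F :: "nat \<Rightarrow> complex \<Rightarrow> complex"
  assumes hol: "\<And>n. F n holomorphic_on ball 0 1" "f holomorphic_on ball 0 1"
    and lim: "\<And>K. compact K \<Longrightarrow> K \<subseteq> ball 0 1 \<Longrightarrow> uniform_limit K F f sequentially"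
    and zeroes: "\<And>n w. w \<in> ball 0 1 \<Longrightarrow> F n w = 0 \<Longrightarrow> \<exists>i\<in>{1..N}. w = q n i"
    and q: "\<And>i. i \<in> {1..N} \<Longrightarrow> (\<lambda>n. q n i) \<longlonglongrightarrow> q' i"
    and nz: "\<exists>w\<in>ball 0 1. f w \<noteq> 0" and w: "w \<in> ball 0 1" "f w = 0"
  shows "\<exists>i\<in>{1..N::nat}. w = q' i"
proof (rule ccontr)
  assume "\<not> (\<exists>i\<in>{1..N}. w = q' i)"
  then have "w \<notin> q' ` {1..N}" by auto
  then have "open (ball 0 1 - q' ` {1..N})" "w \<in> ball 0 1 - q' ` {1..N}"
    using w by (auto intro!: open_Diff finite_imp_closed)
  then obtain \<delta> where \<delta>: "0 < \<delta>" "ball w \<delta> \<subseteq> ball 0 1 - q' ` {1..N}"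
    using open_contains_ball by blast
  have "\<forall>\<^sub>F n in sequentially. \<forall>i\<in>{1..N}. dist (q n i) (q' i) < \<delta>/2"
    by (intro eventually_ball_finite ballI tendstoD[OF q]) (use \<delta>(1) in auto)
  then obtain n0 where n0: "\<And>n i. n0 \<le> n \<Longrightarrow> i \<in> {1..N} \<Longrightarrow> dist (q n i) (q' i) < \<delta>/2"
    unfolding eventually_sequentially by blast
  have sub: "ball w (\<delta>/2) \<subseteq> ball 0 1" using \<delta> by force
  have "f w \<noteq> 0"
  proof (rule Hurwitz_no_zeros[where S = "ball w (\<delta>/2)" and \<F> = "\<lambda>n. F (n + n0)" and g = f])
    show "F (n + n0) holomorphic_on ball w (\<delta>/2)" for n using hol(1) sub holomorphic_on_subset by blast
    show "f holomorphic_on ball w (\<delta>/2)" using hol(2) sub holomorphic_on_subset by blast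
    show "uniform_limit K (\<lambda>n. F (n + n0)) f sequentially" if "compact K" "K \<subseteq> ball w (\<delta>/2)" for K
    proof -
      have "uniform_limit K F f sequentially" using lim that sub by blast
      then show ?thesis by (rule filterlim_compose[OF _ filterlim_add_const_nat_at_top])
    qed
    show "\<not> f constant_on ball w (\<delta>/2)"
    proof
      assume "f constant_on ball w (\<delta>/2)"
      then have z: "f v = 0" if "v \<in> ball w (\<delta>/2)" for v
        using that w \<delta>(1) unfolding constant_on_def by (metis centre_in_ball half_gt_zero)
      have "f v = 0" if "v \<in> ball 0 1" for v
        by (rule analytic_continuation_open[where s = "ball w (\<delta>/2)" and s' = "ball 0 1" and f = f and g = "\<lambda>_. 0"])
          (use \<delta>(1) sub hol z that in auto)
      with nz show False by blast
    qed
    show "F (n + n0) v \<noteq> 0" if v: "v \<in> ball w (\<delta>/2)" for n v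
    proof
      assume "F (n + n0) v = 0"
      then obtain i where i: "i \<in> {1..N}" "v = q (n + n0) i" using zeroes v sub by blast
      have "dist w (q' i) \<le> dist w v + dist v (q' i)" by (rule dist_triangle)
      then have "q' i \<in> ball w \<delta>" using v n0[of "n + n0" i] i by simp
      then show False using \<delta>(2) i by blast
    qed
  qed (use \<delta>(1) in auto)
  with w show False by simp
qed

definition reflected_prod :: "nat \<Rightarrow> (nat \<Rightarrow> complex) \<Rightarrow> complex \<Rightarrow> complex" where
  "reflected_prod N q w = (\<Prod>i=1..N. (w - q i) * (1 - cnj (q i) * w))"

text \<open>On the unit circle \<open>(w - q) (1 - cnj q w) = w \<bar>w - q\<bar>\<^sup>2\<close>. Since \<open>f0\<close> and \<open>fz\<close> have equally
  many zeroes, multiplying \<open>f0 / fz\<close> by the quotient of these products, which removes its zeroes and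
  poles, does not change its argument on the circle. So the result has positive real part there,
  hence in the disc, and Harnack's inequality applies.\<close>

lemma Harnack_for_quotient:
  fixes f0 fz :: "complex \<Rightarrow> complex"
  assumes \<rho>: "1 < \<rho>"
    and k: "k0 holomorphic_on ball 0 \<rho>" "\<And>w. w \<in> ball 0 \<rho> \<Longrightarrow> k0 w \<noteq> 0"
      "kz holomorphic_on ball 0 \<rho>" "\<And>w. w \<in> ball 0 \<rho> \<Longrightarrow> kz w \<noteq> 0"
    and f0: "\<And>w. w \<in> ball 0 \<rho> \<Longrightarrow> f0 w = (\<Prod>i=1..N. w - p i) * k0 w"
    and fz: "\<And>w. w \<in> ball 0 \<rho> \<Longrightarrow> fz w = (\<Prod>i=1..N. w - q i) * kz w"
    and pq: "\<And>i. i \<in> {1..N} \<Longrightarrow> norm (p i) < 1" "\<And>i. i \<in> {1..N} \<Longrightarrow> norm (q i) < 1"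
    and close: "\<And>w. norm w = 1 \<Longrightarrow> norm (fz w - f0 w) < norm (f0 w)"
    and w: "norm w < 1" and v: "norm v < 1"
  shows "norm (f0 w * reflected_prod N q w) * norm (fz v * reflected_prod N p v) * ((1 - norm w) * (1 - norm v))
    \<le> 4 * (norm (f0 v * reflected_prod N q v) * norm (fz w * reflected_prod N p w))"
proof -
  let ?R = "\<lambda>a w. \<Prod>i=1..N. 1 - cnj (a i) * w"
  have Rp: "?R p w \<noteq> 0" if w: "norm w \<le> 1" for w
  proof -
    have "1 - cnj (p i) * w \<noteq> 0" if i: "i \<in> {1..N}" for i
    proof
      assume "1 - cnj (p i) * w = 0"
      then have "norm (cnj (p i) * w) = 1" by (metis eq_iff_diff_eq_0 norm_one)
      moreover have "norm (p i) * norm w \<le> norm (p i) * 1" using w by (intro mult_left_mono) auto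
      ultimately show False using pq(1)[OF i] by (simp add: norm_mult)
    qed
    then show ?thesis by (subst prod_zero_iff) auto
  qed
  have mem: "w \<in> ball 0 \<rho>" if "norm w \<le> 1" for w :: complex using that \<rho> by simp
  define \<Psi> where "\<Psi> = (\<lambda>w. k0 w * ?R q w / (kz w * ?R p w))"
  have id: "f0 w * reflected_prod N q w = \<Psi> w * (fz w * reflected_prod N p w)" if "norm w \<le> 1" for w
  proof -
    have alg: "a * x * (b * y) = x * y / (u * v) * (b * u * (a * v))" if "u \<noteq> 0" "v \<noteq> 0" for a b x y u v :: complex
      using that by (simp add: field_simps)
    show ?thesis
      unfolding f0[OF mem[OF that]] fz[OF mem[OF that]] \<Psi>_def reflected_prod_def prod.distrib
      by (rule alg[OF k(4)[OF mem[OF that]] Rp[OF that]])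
  qed
  have cont: "continuous_on (cball 0 1) \<Psi>"
  proof -
    have "continuous_on (cball 0 1) k0" "continuous_on (cball 0 1) kz"
      using k(1,3) mem by (auto intro: continuous_on_subset[OF holomorphic_on_imp_continuous_on])
    moreover have "kz w * ?R p w \<noteq> 0" if "w \<in> cball 0 1" for w
      using k(4)[OF mem] Rp that by simp
    ultimately show ?thesis unfolding \<Psi>_def by (intro continuous_intros) auto
  qed
  have hol: "\<Psi> holomorphic_on ball 0 1"
  proof -
    have "ball 0 1 \<subseteq> ball (0::complex) \<rho>" using \<rho> by auto
    then have "k0 holomorphic_on ball 0 1" "kz holomorphic_on ball 0 1"
      using k(1,3) holomorphic_on_subset by blast+
    moreover have "kz w * ?R p w \<noteq> 0" if "w \<in> ball 0 1" for w
      using k(4)[OF mem] Rp[of w] that by simp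
    ultimately show ?thesis unfolding \<Psi>_def by (intro holomorphic_intros) auto
  qed
  have circle: "0 < Re (\<Psi> w)" if w: "norm w = 1" for w
  proof -
    have refl: "(w - a) * (1 - cnj a * w) = w * of_real ((norm (w - a))\<^sup>2)" for a
    proof -
      have "w * cnj w = 1" using w complex_norm_square[of w] by simp
      then have "(w - a) * (1 - cnj a * w) = w * ((w - a) * cnj (w - a))" by (simp add: algebra_simps)
      then show ?thesis by (simp only: complex_norm_square)
    qed
    have refl_prod: "reflected_prod N a w = w ^ N * of_real (\<Prod>i=1..N. (norm (w - a i))\<^sup>2)" for a
      unfolding reflected_prod_def refl by (simp add: prod.distrib)
    have pos: "0 < (\<Prod>i=1..N. (norm (w - a i))\<^sup>2)" if "\<And>i. i \<in> {1..N} \<Longrightarrow> norm (a i) < 1" for a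
    proof (rule prod_pos)
      fix i assume "i \<in> {1..N}"
      then have "norm (a i) < 1" by (rule that)
      then have "a i \<noteq> w" using w by auto
      then show "0 < (norm (w - a i))\<^sup>2" by simp
    qed
    have w0: "w \<noteq> 0" using w by auto
    have f0w: "f0 w \<noteq> 0" using close[OF w] by auto
    have fzw: "fz w \<noteq> 0" using close[OF w] by auto
    define X where "X = (\<lambda>a. \<Prod>i=1..N. (norm (w - a i))\<^sup>2)"
    have X: "0 < X p" "0 < X q" using pos[of p] pos[of q] pq by (simp_all add: X_def)
    have "f0 w * (w ^ N * of_real (X q)) = \<Psi> w * (fz w * (w ^ N * of_real (X p)))"
      using id[of w] w unfolding refl_prod X_def by simp
    then have "f0 w * of_real (X q) = \<Psi> w * (fz w * of_real (X p))"
      using w0 by (simp add: mult_ac)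
    then have \<Psi>_eq: "\<Psi> w = f0 w / fz w * of_real (X q / X p)"
      unfolding of_real_divide using fzw X by (simp add: field_simps)
    have pos_Re: "0 < Re (f0 w / fz w)"
    proof -
      have "norm (fz w / f0 w - 1) < 1"
      proof -
        have "fz w / f0 w - 1 = (fz w - f0 w) / f0 w" using f0w by (simp add: diff_divide_distrib)
        then show ?thesis using close[OF w] f0w by (simp add: norm_divide)
      qed
      then have "\<bar>Re (fz w / f0 w - 1)\<bar> < 1" using abs_Re_le_cmod le_less_trans by blast
      then have Z: "0 < Re (fz w / f0 w)" by simp
      then have "0 < (Re (fz w / f0 w))\<^sup>2 + (Im (fz w / f0 w))\<^sup>2"
        by (intro add_pos_nonneg) auto
      with Z have "0 < Re (inverse (fz w / f0 w))"
        unfolding inverse_complex.sel by (rule divide_pos_pos)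
      then show ?thesis by simp
    qed
    have "Re (y * of_real x) = Re y * x" for y x by simp
    then show ?thesis unfolding \<Psi>_eq using pos_Re X by (simp only: mult_pos_pos divide_pos_pos)
  qed
  have "0 < Re (\<Psi> w)" if w: "norm w < 1" for w
  proof -
    have "continuous_on (sphere 0 1) (\<lambda>w. Re (\<Psi> w))"
      by (intro continuous_intros continuous_on_subset[OF cont]) auto
    then obtain w1 where w1: "norm w1 = 1" "\<And>u. norm u = 1 \<Longrightarrow> Re (\<Psi> w1) \<le> Re (\<Psi> u)"
      using continuous_attains_inf[of "sphere (0::complex) 1" "\<lambda>w. Re (\<Psi> w)"] by auto
    have "Re (- \<Psi> w) \<le> - Re (\<Psi> w1)"
    proof (rule maximum_real_frontier[of "\<lambda>w. - \<Psi> w" "cball 0 1"])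
      show "(\<lambda>w. - \<Psi> w) holomorphic_on interior (cball 0 1)" using hol by (auto intro!: holomorphic_intros)
      show "continuous_on (closure (cball 0 1)) (\<lambda>w. - \<Psi> w)" using cont by (auto intro!: continuous_intros)
    qed (use w w1(2) in auto)
    then show ?thesis using circle[OF w1(1)] by simp
  qed
  then have "norm (\<Psi> w) * ((1 - norm w) * (1 - norm v)) \<le> 4 * norm (\<Psi> v)"
    using Re_pos_Harnack[OF hol _ w v] by blast
  then have "norm (\<Psi> w) * ((1 - norm w) * (1 - norm v)) * (norm (fz w * reflected_prod N p w) * norm (fz v * reflected_prod N p v))
      \<le> 4 * norm (\<Psi> v) * (norm (fz w * reflected_prod N p w) * norm (fz v * reflected_prod N p v))"
    by (intro mult_right_mono) auto
  moreover have "norm (f0 w * reflected_prod N q w) = norm (\<Psi> w) * norm (fz w * reflected_prod N p w)"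
    unfolding norm_mult[symmetric] using id[of w] w by simp
  moreover have "norm (f0 v * reflected_prod N q v) = norm (\<Psi> v) * norm (fz v * reflected_prod N p v)"
    unfolding norm_mult[symmetric] using id[of v] v by simp
  ultimately show ?thesis by (simp only: mult_ac)
qed

section \<open>Zeroes and growth on the diagonal\<close>

lemma Cayley_factor_lower_bound:
  fixes q :: complex
  assumes q: "norm q \<le> 1" and \<xi>: "Re \<xi> < 0" and large: "(if q = 1 then 0 else 3 / norm (1 - q)) \<le> norm \<xi>"
  shows "1 / norm (\<xi> - 1) \<le> norm ((\<xi> + 1) / (\<xi> - 1) - q)"
proof -
  have ne: "\<xi> - 1 \<noteq> 0" using \<xi> by auto
  have "(\<xi> + 1) / (\<xi> - 1) - q = ((1 - q) * \<xi> + (1 + q)) / (\<xi> - 1)"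
    using ne by (simp add: field_simps)
  moreover have "1 \<le> norm ((1 - q) * \<xi> + (1 + q))"
  proof (cases "q = 1")
    case False
    have "3 / norm (1 - q) \<le> norm \<xi>" using large False by simp
    then have "3 \<le> norm ((1 - q) * \<xi>)" unfolding norm_mult using False by (simp add: pos_divide_le_eq mult.commute)
    moreover have "norm (1 + q) \<le> 2" using norm_triangle_ineq[of 1 q] q by simp
    moreover have "norm ((1 - q) * \<xi>) - norm (1 + q) \<le> norm ((1 - q) * \<xi> + (1 + q))"
      using norm_diff_ineq by blast
    ultimately show ?thesis by linarith
  qed simp
  ultimately show ?thesis by (simp add: norm_divide divide_right_mono)
qed

lemma norm_reflected_prod_le:
  assumes "\<And>i. i \<in> {1..N} \<Longrightarrow> norm (p i) \<le> 1" "norm w \<le> 1"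
  shows "norm (reflected_prod N p w) \<le> 4 ^ N"
proof -
  have "norm (reflected_prod N p w) = (\<Prod>i=1..N. norm ((w - p i) * (1 - cnj (p i) * w)))"
    by (simp add: reflected_prod_def prod_norm)
  also have "\<dots> \<le> (\<Prod>i=1..N. 4)"
  proof (rule prod_mono)
    fix i assume i: "i \<in> {1..N}"
    have "norm (w - p i) \<le> 2" using norm_triangle_ineq4[of w "p i"] assms(1)[OF i] assms(2) by linarith
    moreover have "norm (1 - cnj (p i) * w) \<le> 2"
    proof -
      have "norm (cnj (p i) * w) \<le> 1" using assms(1)[OF i] assms(2) by (simp add: norm_mult mult_le_one)
      then show ?thesis using norm_triangle_ineq4[of 1 "cnj (p i) * w"] by simp
    qed
    ultimately have "norm (w - p i) * norm (1 - cnj (p i) * w) \<le> 2 * 2" by (intro mult_mono) auto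
    then show "0 \<le> norm ((w - p i) * (1 - cnj (p i) * w)) \<and> norm ((w - p i) * (1 - cnj (p i) * w)) \<le> 4"
      by (simp add: norm_mult)
  qed
  finally show ?thesis by simp
qed

lemma norm_reflected_prod_ge:
  assumes q: "\<And>i. i \<in> {1..N} \<Longrightarrow> norm (q i) \<le> 1" and w: "norm w \<le> 1"
    and c: "\<And>i. i \<in> {1..N} \<Longrightarrow> c \<le> norm (w - q i)" and "0 \<le> c"
  shows "(c * (1 - norm w)) ^ N \<le> norm (reflected_prod N q w)"
proof -
  have "(c * (1 - norm w)) ^ N = (\<Prod>i=1..N. c * (1 - norm w))" by simp
  also have "\<dots> \<le> (\<Prod>i=1..N. norm ((w - q i) * (1 - cnj (q i) * w)))"
  proof (rule prod_mono)
    fix i assume i: "i \<in> {1..N}"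
    have "norm (cnj (q i) * w) \<le> norm w" using q[OF i] by (simp add: norm_mult mult_left_le_one_le)
    then have "1 - norm w \<le> norm (1 - cnj (q i) * w)" using norm_triangle_ineq2[of 1 "cnj (q i) * w"] by simp
    then have "c * (1 - norm w) \<le> norm (w - q i) * norm (1 - cnj (q i) * w)"
      using c[OF i] \<open>0 \<le> c\<close> w by (intro mult_mono) auto
    then show "0 \<le> c * (1 - norm w) \<and> c * (1 - norm w) \<le> norm ((w - q i) * (1 - cnj (q i) * w))"
      using \<open>0 \<le> c\<close> w by (simp add: norm_mult)
  qed
  also have "\<dots> = norm (reflected_prod N q w)" by (simp add: reflected_prod_def prod_norm)
  finally show ?thesis .
qed

text \<open>At \<open>w = 1\<close>, where \<open>disc_poly\<close> is essentially the coefficient of degree \<open>d\<close>, by continuity.\<close>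

lemma disc_poly_close:
  assumes deg: "degree p0 \<le> d" "degree pz \<le> d"
    and close: "\<And>w. 0 \<le> Re w \<Longrightarrow> norm (poly pz w - poly p0 w) \<le> \<theta> * norm (poly p0 w)"
    and w: "1 \<le> norm w"
  shows "norm (disc_poly d pz w - disc_poly d p0 w) \<le> \<theta> * norm (disc_poly d p0 w)"
proof -
  have ne: "norm (disc_poly d pz w - disc_poly d p0 w) \<le> \<theta> * norm (disc_poly d p0 w)"
    if "w \<noteq> 1" "1 \<le> norm w" for w
  proof -
    let ?\<xi> = "- (1 + w) / (1 - w)"
    have "1 \<le> (norm w)\<^sup>2" using that by simp
    then have "0 \<le> Re ?\<xi>" unfolding Re_Cayley by simp
    then have "norm ((1 - w) ^ d) * norm (poly pz ?\<xi> - poly p0 ?\<xi>) \<le> norm ((1 - w) ^ d) * (\<theta> * norm (poly p0 ?\<xi>))"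
      by (intro mult_left_mono close) auto
    then show ?thesis
      unfolding disc_poly_eq[OF deg(1) that(1)] disc_poly_eq[OF deg(2) that(1)] right_diff_distrib[symmetric] norm_mult
      by (simp only: mult_ac)
  qed
  show ?thesis
  proof (cases "w = 1")
    case True
    define x where "x = (\<lambda>n. 1 + inverse (of_nat (Suc n)) :: complex)"
    have "x \<longlonglongrightarrow> 1 + 0" unfolding x_def by (intro tendsto_intros LIMSEQ_Suc[OF lim_inverse_n])
    then have x1: "x \<longlonglongrightarrow> 1" by simp
    have cont: "isCont (disc_poly d p) 1" for p unfolding disc_poly_def by (intro continuous_intros)
    have "(\<lambda>n. norm (disc_poly d pz (x n) - disc_poly d p0 (x n))) \<longlonglongrightarrow> norm (disc_poly d pz 1 - disc_poly d p0 1)"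
      by (intro tendsto_intros isCont_tendsto_compose[OF cont x1])
    moreover have "(\<lambda>n. \<theta> * norm (disc_poly d p0 (x n))) \<longlonglongrightarrow> \<theta> * norm (disc_poly d p0 1)"
      by (intro tendsto_intros isCont_tendsto_compose[OF cont x1])
    moreover have "norm (disc_poly d pz (x n) - disc_poly d p0 (x n)) \<le> \<theta> * norm (disc_poly d p0 (x n))" for n
    proof (rule ne)
      show "x n \<noteq> 1" by (simp add: x_def del: of_nat_Suc)
      have "\<bar>Re (x n)\<bar> \<le> norm (x n)" by (rule abs_Re_le_cmod)
      moreover have "1 \<le> Re (x n)"
      proof -
        have "x n = complex_of_real (1 + inverse (real (Suc n)))" by (simp add: x_def del: of_nat_Suc)
        then show ?thesis by (simp del: of_nat_Suc)
      qed
      ultimately show "1 \<le> norm (x n)" by simp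
    qed
    ultimately show ?thesis unfolding True by (intro LIMSEQ_le) auto
  qed (use ne w in blast)
qed

text \<open>The central estimate. For \<open>r < 1\<close> the functions \<open>diag_r r\<close> are holomorphic beyond the closed
  disc, so the Harnack bound for quotients applies; the numbers of zeroes do not depend on \<open>r\<close>.
  Along a sequence \<open>r \<rightarrow> 1\<close> all zeroes converge in the closed disc, and the bound survives. Zeroes that
  reach the unit circle are harmless, as only upper and lower bounds for the products are used.\<close>

lemma diag_zeroes_and_growth:
  assumes sf0: "stable_family P0 d \<eta> s" and sfz: "stable_family Pz d \<eta> s"
    and close: "\<And>u w. \<eta> < Re u \<Longrightarrow> 0 \<le> Re w \<Longrightarrow> norm (poly (Pz u) w - poly (P0 u) w) \<le> \<theta> * norm (poly (P0 u) w)"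
    and \<theta>: "\<theta> < 1"
  defines "f0 \<equiv> stable_family.diag P0 s" and "fz \<equiv> stable_family.diag Pz s"
  shows "finite {\<xi>. Re \<xi> < 0 \<and> f0 \<xi> = 0}" "finite {\<xi>. Re \<xi> < 0 \<and> fz \<xi> = 0}"
    "\<exists>\<rho>0 a b C. \<forall>\<xi>. \<rho>0 \<le> norm \<xi> \<longrightarrow> Re \<xi> < 0 \<longrightarrow> norm (f0 \<xi>) * \<bar>Re \<xi>\<bar> ^ b \<le> C * norm \<xi> ^ a * norm (fz \<xi>)"
proof -
  interpret S0: stable_family P0 d \<eta> s by (rule sf0)
  interpret Sz: stable_family Pz d \<eta> s by (rule sfz)
  have close_r: "norm (Sz.diag_r r w - S0.diag_r r w) < norm (S0.diag_r r w)"
    if "norm (complex_of_real r * w) < 1" "norm w = 1" for r w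
  proof -
    have u: "\<eta> < Re (S0.param r w)" using that(1) by (rule S0.Re_param)
    have "norm (Sz.diag_r r w - S0.diag_r r w) \<le> \<theta> * norm (S0.diag_r r w)"
      unfolding Sz.diag_r_def S0.diag_r_def
      by (rule disc_poly_close[OF S0.degree_P[OF u] Sz.degree_P[OF u] close[OF u]]) (use that in auto)
    also have "\<dots> < 1 * norm (S0.diag_r r w)"
      using S0.diag_r_nonzero[OF that(1)] that(2) \<theta> by (intro mult_strict_right_mono) auto
    finally show ?thesis by simp
  qed
  define N where "N = nat (S0.zero_count 0)"
  have "Sz.zero_count 0 = S0.zero_count 0"
    unfolding Sz.zero_count_def S0.zero_count_def
  proof (rule Rouche_unit_circle(3)[of 2])
    show "S0.diag_r 0 holomorphic_on ball 0 2" "Sz.diag_r 0 holomorphic_on ball 0 2"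
      using S0.holomorphic_on_diag_r[of 0] Sz.holomorphic_on_diag_r[of 0] by (auto intro: holomorphic_on_subset)
  qed (use close_r[of 0] in auto)
  then have Nz: "nat (Sz.zero_count 0) = N" by (simp add: N_def)
  define t where "t = (\<lambda>n. 1 - inverse (real (Suc n)))"
  have t: "0 \<le> t n" "t n < 1" for n by (simp_all add: t_def inverse_le_1_iff del: of_nat_Suc)
  have "t \<longlonglongrightarrow> 1 - 0" unfolding t_def by (intro tendsto_intros LIMSEQ_inverse_real_of_nat)
  then have t_lim: "t \<longlonglongrightarrow> 1" by simp
  (* \<Phi> n p q: p and q list the zeroes for r = t n, with the resulting Harnack bound *)
  define \<Phi> where "\<Phi> = (\<lambda>n p q. (\<forall>i\<in>{1..N}. norm (p i :: complex) < 1 \<and> norm (q i :: complex) < 1) \<and>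
     (\<forall>w\<in>ball 0 1. S0.diag_r (t n) w = 0 \<longrightarrow> (\<exists>i\<in>{1..N}. w = p i)) \<and>
     (\<forall>w\<in>ball 0 1. Sz.diag_r (t n) w = 0 \<longrightarrow> (\<exists>i\<in>{1..N}. w = q i)) \<and>
     (\<forall>w v. norm w < 1 \<longrightarrow> norm v < 1 \<longrightarrow>
       norm (S0.diag_r (t n) w * reflected_prod N q w) * norm (Sz.diag_r (t n) v * reflected_prod N p v) * ((1 - norm w) * (1 - norm v))
       \<le> 4 * (norm (S0.diag_r (t n) v * reflected_prod N q v) * norm (Sz.diag_r (t n) w * reflected_prod N p w))))"
  have ex: "\<exists>p q. \<Phi> n p q" for n
  proof -
    obtain p k0 \<rho>1 where \<rho>1: "1 < \<rho>1" "k0 holomorphic_on ball 0 \<rho>1" "\<And>w. w \<in> ball 0 \<rho>1 \<Longrightarrow> k0 w \<noteq> 0"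
      "\<And>w. w \<in> ball 0 \<rho>1 \<Longrightarrow> S0.diag_r (t n) w = (\<Prod>i=1..N. w - p i) * k0 w"
      "\<And>i. i \<in> {1..N} \<Longrightarrow> norm (p i) < 1"
      by (rule S0.diag_r_factorization[OF t(1)[of n] t(2)[of n], folded N_def]) blast
    obtain q kz \<rho>2 where \<rho>2: "1 < \<rho>2" "kz holomorphic_on ball 0 \<rho>2" "\<And>w. w \<in> ball 0 \<rho>2 \<Longrightarrow> kz w \<noteq> 0"
      "\<And>w. w \<in> ball 0 \<rho>2 \<Longrightarrow> Sz.diag_r (t n) w = (\<Prod>i=1..N. w - q i) * kz w"
      "\<And>i. i \<in> {1..N} \<Longrightarrow> norm (q i) < 1"
      by (rule Sz.diag_r_factorization[OF t(1)[of n] t(2)[of n], unfolded Nz]) blast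
    have sub: "ball 0 (min \<rho>1 \<rho>2) \<subseteq> ball (0::complex) \<rho>1" "ball 0 (min \<rho>1 \<rho>2) \<subseteq> ball (0::complex) \<rho>2" by auto
    have "norm (S0.diag_r (t n) w * reflected_prod N q w) * norm (Sz.diag_r (t n) v * reflected_prod N p v) * ((1 - norm w) * (1 - norm v))
       \<le> 4 * (norm (S0.diag_r (t n) v * reflected_prod N q v) * norm (Sz.diag_r (t n) w * reflected_prod N p w))"
      if "norm w < 1" "norm v < 1" for w v
    proof (rule Harnack_for_quotient[where \<rho> = "min \<rho>1 \<rho>2" and ?k0.0 = k0 and kz = kz])
      show "k0 holomorphic_on ball 0 (min \<rho>1 \<rho>2)" using \<rho>1(2) sub(1) holomorphic_on_subset by blast
      show "kz holomorphic_on ball 0 (min \<rho>1 \<rho>2)" using \<rho>2(2) sub(2) holomorphic_on_subset by blast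
      show "norm (Sz.diag_r (t n) w - S0.diag_r (t n) w) < norm (S0.diag_r (t n) w)" if "norm w = 1" for w
        using close_r[of "t n" w] that t[of n] by (simp add: norm_mult)
    qed (use \<rho>1 \<rho>2 that in auto)
    moreover have "\<exists>i\<in>{1..N}. w = p i" if "w \<in> ball 0 1" "S0.diag_r (t n) w = 0" for w
    proof -
      have "w \<in> ball 0 \<rho>1" using that(1) \<rho>1(1) by simp
      then have "(\<Prod>i=1..N. w - p i) = 0" using \<rho>1(3,4)[of w] that(2) by simp
      then show ?thesis by (auto simp: prod_zero_iff)
    qed
    moreover have "\<exists>i\<in>{1..N}. w = q i" if "w \<in> ball 0 1" "Sz.diag_r (t n) w = 0" for w
    proof -
      have "w \<in> ball 0 \<rho>2" using that(1) \<rho>2(1) by simp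
      then have "(\<Prod>i=1..N. w - q i) = 0" using \<rho>2(3,4)[of w] that(2) by simp
      then show ?thesis by (auto simp: prod_zero_iff)
    qed
    ultimately have "\<Phi> n p q" unfolding \<Phi>_def using \<rho>1(5) \<rho>2(5) by blast
    then show ?thesis by blast
  qed
  obtain p where "\<forall>n. \<exists>q. \<Phi> n (p n) q" using choice[of "\<lambda>n p. \<exists>q. \<Phi> n p q"] ex by blast
  then obtain q where \<Phi>: "\<And>n. \<Phi> n (p n) (q n)" using choice[of "\<lambda>n q. \<Phi> n (p n) q"] by blast
  (* both lists of zeroes in one family, to extract a common subsequence *)
  define F where "F = (\<lambda>n (b, i). if b then p n i else q n i)"
  have cS: "countable (UNIV \<times> {1..N} :: (bool \<times> nat) set)" by simp
  have bF: "norm (F n x) \<le> 1" if "x \<in> UNIV \<times> {1..N}" for n x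
    using \<Phi>[of n] that unfolding \<Phi>_def by (auto simp: F_def less_imp_le)
  obtain \<phi> where \<phi>: "strict_mono (\<phi>::nat \<Rightarrow> nat)" "\<And>x. x \<in> UNIV \<times> {1..N} \<Longrightarrow> \<exists>l. (\<lambda>n. F (\<phi> n) x) \<longlonglongrightarrow> l"
    by (rule function_convergent_subsequence[where f = F, OF cS bF]) blast+
  define p' where "p' = (\<lambda>i. lim (\<lambda>n. p (\<phi> n) i))"
  define q' where "q' = (\<lambda>i. lim (\<lambda>n. q (\<phi> n) i))"
  have plim: "(\<lambda>n. p (\<phi> n) i) \<longlonglongrightarrow> p' i" and qlim: "(\<lambda>n. q (\<phi> n) i) \<longlonglongrightarrow> q' i" if "i \<in> {1..N}" for i
    using \<phi>(2)[of "(True, i)"] \<phi>(2)[of "(False, i)"] that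
    by (auto simp: F_def p'_def q'_def convergent_def[symmetric] convergent_LIMSEQ_iff)
  have p'1: "norm (p' i) \<le> 1" if "i \<in> {1..N}" for i
    by (rule LIMSEQ_le_const2[OF tendsto_norm[OF plim[OF that]]])
      (use \<Phi> that in \<open>auto simp: \<Phi>_def less_imp_le\<close>)
  have q'1: "norm (q' i) \<le> 1" if "i \<in> {1..N}" for i
    by (rule LIMSEQ_le_const2[OF tendsto_norm[OF qlim[OF that]]])
      (use \<Phi> that in \<open>auto simp: \<Phi>_def less_imp_le\<close>)
  have t\<phi>: "(\<lambda>n. t (\<phi> n)) \<longlonglongrightarrow> 1" using LIMSEQ_subseq_LIMSEQ[OF t_lim \<phi>(1)] by (simp add: o_def)
  have unif: "uniform_limit K (\<lambda>n. stable_family.diag_r P d s (t (\<phi> n))) (stable_family.diag_r P d s 1) sequentially"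
    if "stable_family P d \<eta> s" "compact K" "K \<subseteq> ball 0 1" for P K
  proof (rule uniform_limit_if_continuous_on_product[where T = "{0..1}"])
    show "continuous_on ({0..1} \<times> K) (\<lambda>(r, w). stable_family.diag_r P d s r w)"
    proof (rule stable_family.continuous_on_diag_r[OF that(1)])
      fix r :: real and w assume r: "r \<in> {0..1}" and w: "w \<in> K"
      have "norm w < 1" using w that(3) by auto
      moreover have "r * norm w \<le> 1 * norm w" using r by (intro mult_right_mono) auto
      ultimately show "norm (complex_of_real r * w) < 1" using r by (simp add: norm_mult)
    qed
  qed (use that t t\<phi> in \<open>auto simp: less_imp_le\<close>)
  have hol: "stable_family.diag_r P d s r holomorphic_on ball 0 1" if "stable_family P d \<eta> s" "0 \<le> r" "r \<le> 1" for P r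
  proof (rule holomorphic_on_subset[OF stable_family.holomorphic_on_diag_r[OF that(1)]])
    show "ball 0 1 \<subseteq> {w. norm (complex_of_real r * w) < 1}"
    proof
      fix w :: complex assume "w \<in> ball 0 1"
      moreover have "r * norm w \<le> 1 * norm w" using that by (intro mult_right_mono) auto
      ultimately show "w \<in> {w. norm (complex_of_real r * w) < 1}" using that by (simp add: norm_mult)
    qed
  qed
  have zeroes0: "\<exists>i\<in>{1..N}. w = p' i" if "norm w < 1" "S0.diag_r 1 w = 0" for w
  proof (rule zeroes_of_limit[where F = "\<lambda>n. S0.diag_r (t (\<phi> n))" and q = "\<lambda>n. p (\<phi> n)" and f = "S0.diag_r 1"])
    show "\<exists>i\<in>{1..N}. w = p (\<phi> n) i" if "w \<in> ball 0 1" "S0.diag_r (t (\<phi> n)) w = 0" for n w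
      using \<Phi>[of "\<phi> n"] that unfolding \<Phi>_def by blast
    show "\<exists>w\<in>ball 0 1. S0.diag_r 1 w \<noteq> 0" using S0.diag_r_1_nonzero by auto
  qed (use that hol[OF sf0] unif[OF sf0] t plim in \<open>auto simp: less_imp_le\<close>)
  have zeroesz: "\<exists>i\<in>{1..N}. w = q' i" if "norm w < 1" "Sz.diag_r 1 w = 0" for w
  proof (rule zeroes_of_limit[where F = "\<lambda>n. Sz.diag_r (t (\<phi> n))" and q = "\<lambda>n. q (\<phi> n)" and f = "Sz.diag_r 1"])
    show "\<exists>i\<in>{1..N}. w = q (\<phi> n) i" if "w \<in> ball 0 1" "Sz.diag_r (t (\<phi> n)) w = 0" for n w
      using \<Phi>[of "\<phi> n"] that unfolding \<Phi>_def by blast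
    show "\<exists>w\<in>ball 0 1. Sz.diag_r 1 w \<noteq> 0" using Sz.diag_r_1_nonzero by auto
  qed (use that hol[OF sfz] unif[OF sfz] t qlim in \<open>auto simp: less_imp_le\<close>)
  have fin: "finite {\<xi>. Re \<xi> < 0 \<and> stable_family.diag P s \<xi> = 0}"
    if sf: "stable_family P d \<eta> s" and Z: "\<And>w. norm w < 1 \<Longrightarrow> stable_family.diag_r P d s 1 w = 0 \<Longrightarrow> \<exists>i\<in>{1..N}. w = x i" for P x
  proof (rule finite_subset)
    show "{\<xi>. Re \<xi> < 0 \<and> stable_family.diag P s \<xi> = 0} \<subseteq> (\<lambda>i. - (1 + x i) / (1 - x i)) ` {1..N}"
    proof
      fix \<xi> assume "\<xi> \<in> {\<xi>. Re \<xi> < 0 \<and> stable_family.diag P s \<xi> = 0}"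
      then have \<xi>: "Re \<xi> < 0" "stable_family.diag P s \<xi> = 0" by auto
      note C = Cayley_inverse[OF \<xi>(1)]
      have "stable_family.diag_r P d s 1 ((\<xi> + 1) / (\<xi> - 1)) = 0"
        unfolding stable_family.diag_r_1[OF sf C(1)] C(2) \<xi>(2) by simp
      then obtain i where "i \<in> {1..N}" "(\<xi> + 1) / (\<xi> - 1) = x i" using Z[OF C(1)] by blast
      then show "\<xi> \<in> (\<lambda>i. - (1 + x i) / (1 - x i)) ` {1..N}" using C(2) by (intro image_eqI[of _ _ i]) auto
    qed
  qed simp
  show "finite {\<xi>. Re \<xi> < 0 \<and> f0 \<xi> = 0}" unfolding f0_def by (rule fin[OF sf0 zeroes0])
  show "finite {\<xi>. Re \<xi> < 0 \<and> fz \<xi> = 0}" unfolding fz_def by (rule fin[OF sfz zeroesz])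

  have pw: "(\<lambda>n. stable_family.diag_r P d s (t (\<phi> n)) w) \<longlonglongrightarrow> stable_family.diag_r P d s 1 w"
    if "stable_family P d \<eta> s" "norm w < 1" for P w
    by (rule tendsto_uniform_limitI[OF unif[OF that(1), of "{w}"]]) (use that in auto)
  have rp: "(\<lambda>n. reflected_prod N (p (\<phi> n)) w) \<longlonglongrightarrow> reflected_prod N p' w" for w
    unfolding reflected_prod_def by (intro tendsto_intros plim)
  have rq: "(\<lambda>n. reflected_prod N (q (\<phi> n)) w) \<longlonglongrightarrow> reflected_prod N q' w" for w
    unfolding reflected_prod_def by (intro tendsto_intros qlim)
  let ?f = "\<lambda>n. S0.diag_r (t (\<phi> n))" and ?g = "\<lambda>n. Sz.diag_r (t (\<phi> n))"
  let ?P = "\<lambda>n. reflected_prod N (p (\<phi> n))" and ?Q = "\<lambda>n. reflected_prod N (q (\<phi> n))"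
  have ineq: "norm (S0.diag_r 1 w * reflected_prod N q' w) * norm (Sz.diag_r 1 v * reflected_prod N p' v) * ((1 - norm w) * (1 - norm v))
       \<le> 4 * (norm (S0.diag_r 1 v * reflected_prod N q' v) * norm (Sz.diag_r 1 w * reflected_prod N p' w))"
    if w: "norm w < 1" and v: "norm v < 1" for w v
  proof (rule LIMSEQ_le)
    show "(\<lambda>n. norm (?f n w * ?Q n w) * norm (?g n v * ?P n v) * ((1 - norm w) * (1 - norm v)))
      \<longlonglongrightarrow> norm (S0.diag_r 1 w * reflected_prod N q' w) * norm (Sz.diag_r 1 v * reflected_prod N p' v) * ((1 - norm w) * (1 - norm v))"
      by (intro tendsto_intros pw[OF sf0 w] pw[OF sfz v] rp rq)
    show "(\<lambda>n. 4 * (norm (?f n v * ?Q n v) * norm (?g n w * ?P n w)))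
      \<longlonglongrightarrow> 4 * (norm (S0.diag_r 1 v * reflected_prod N q' v) * norm (Sz.diag_r 1 w * reflected_prod N p' w))"
      by (intro tendsto_intros pw[OF sf0 v] pw[OF sfz w] rp rq)
    show "\<exists>n0. \<forall>n\<ge>n0. norm (?f n w * ?Q n w) * norm (?g n v * ?P n v) * ((1 - norm w) * (1 - norm v))
       \<le> 4 * (norm (?f n v * ?Q n v) * norm (?g n w * ?P n w))"
      using \<Phi> w v unfolding \<Phi>_def by blast
  qed

  have "infinite (ball (0::complex) 1)" using uncountable_ball[of 1 "0::complex"] countable_finite by auto
  then have "infinite (ball 0 1 - (p' ` {1..N} \<union> q' ` {1..N}))" by (intro Diff_infinite_finite) auto
  then have "ball 0 1 - (p' ` {1..N} \<union> q' ` {1..N}) \<noteq> {}" by (rule infinite_imp_nonempty)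
  then obtain v where "v \<in> ball 0 1 - (p' ` {1..N} \<union> q' ` {1..N})" by blast
  then have v: "norm v < 1" "v \<notin> p' ` {1..N}" "v \<notin> q' ` {1..N}" by simp_all
  define cv where "cv = norm (Sz.diag_r 1 v * reflected_prod N p' v) * (1 - norm v)"
  define Cv where "Cv = 4 * norm (S0.diag_r 1 v * reflected_prod N q' v)"
  have cv: "0 < cv"
  proof -
    have "Sz.diag_r 1 v \<noteq> 0" using zeroesz[OF v(1)] v(3) by blast
    moreover have "(v - p' i) * (1 - cnj (p' i) * v) \<noteq> 0" if i: "i \<in> {1..N}" for i
    proof -
      have "norm (cnj (p' i) * v) < 1"
        using p'1[OF i] v(1) by (simp add: norm_mult) (meson le_less_trans mult_left_le_one_le norm_ge_zero)
      then have "cnj (p' i) * v \<noteq> 1" by auto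
      then show ?thesis using v(2) i by auto
    qed
    then have "reflected_prod N p' v \<noteq> 0" unfolding reflected_prod_def by (subst prod_zero_iff) auto
    ultimately show ?thesis using v(1) by (simp add: cv_def)
  qed
  have Cv: "0 \<le> Cv" by (simp add: Cv_def)
  let ?g = "\<lambda>i. if q' i = 1 then 0 else 3 / norm (1 - q' i)"
  define \<rho>0 where "\<rho>0 = 1 + (\<Sum>i=1..N. ?g i)"
  define C where "C = Cv * 4 ^ N / (2 ^ Suc N * cv) * 2 ^ (3 * N + 2)"
  have main: "norm (f0 \<xi>) * \<bar>Re \<xi>\<bar> ^ Suc N \<le> C * norm \<xi> ^ (3 * N + 2) * norm (fz \<xi>)"
    if \<xi>: "\<rho>0 \<le> norm \<xi>" "Re \<xi> < 0" for \<xi>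
  proof -
    define w where "w = (\<xi> + 1) / (\<xi> - 1)"
    note W = Cayley_inverse[OF \<xi>(2), folded w_def]
    define m where "m = norm (\<xi> - 1)"
    define y where "y = \<bar>Re \<xi>\<bar>"
    define x where "x = 2 * y / m\<^sup>2"
    have m: "0 < m" using \<xi>(2) unfolding m_def by auto
    have y: "0 < y" using \<xi>(2) by (simp add: y_def)
    have x: "0 < x" "x \<le> 1 - norm w" using m y W(4) by (simp_all add: x_def y_def m_def)
    have sum0: "0 \<le> (\<Sum>i=1..N. ?g i)" by (rule sum_nonneg) auto
    have large: "?g i \<le> norm \<xi>" if "i \<in> {1..N}" for i
    proof -
      have "?g i \<le> (\<Sum>i=1..N. ?g i)" using that by (intro member_le_sum) auto
      then show ?thesis using \<xi>(1) by (simp add: \<rho>0_def)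
    qed
    have low: "1 / m \<le> norm (w - q' i)" if "i \<in> {1..N}" for i
      unfolding w_def m_def by (rule Cayley_factor_lower_bound[OF q'1[OF that] \<xi>(2) large[OF that]])
    have eq0: "S0.diag_r 1 w = (1 - w) ^ d * f0 \<xi>" unfolding S0.diag_r_1[OF W(1)] W(2) f0_def ..
    have eqz: "Sz.diag_r 1 w = (1 - w) ^ d * fz \<xi>" unfolding Sz.diag_r_1[OF W(1)] W(2) fz_def ..
    have pos: "0 < norm ((1 - w) ^ d)" using W(3) by simp
    have "norm (S0.diag_r 1 w * reflected_prod N q' w) * (cv * (1 - norm w)) \<le> Cv * norm (Sz.diag_r 1 w * reflected_prod N p' w)"
      using ineq[OF W(1) v(1)] by (simp only: cv_def Cv_def mult_ac)
    then have "norm ((1 - w) ^ d) * (norm (f0 \<xi>) * norm (reflected_prod N q' w) * (cv * (1 - norm w)))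
        \<le> norm ((1 - w) ^ d) * (Cv * (norm (fz \<xi>) * norm (reflected_prod N p' w)))"
      unfolding eq0 eqz norm_mult by (simp only: mult_ac)
    then have 1: "norm (f0 \<xi>) * norm (reflected_prod N q' w) * (cv * (1 - norm w)) \<le> Cv * (norm (fz \<xi>) * norm (reflected_prod N p' w))"
      using pos by (simp only: mult_le_cancel_left_pos)
    have "(1 / m * x) ^ N \<le> (1 / m * (1 - norm w)) ^ N"
      using x m by (intro power_mono mult_left_mono) auto
    also have "\<dots> \<le> norm (reflected_prod N q' w)"
      by (rule norm_reflected_prod_ge) (use q'1 W(1) low m in auto)
    finally have "norm (f0 \<xi>) * (1 / m * x) ^ N * (cv * x) \<le> norm (f0 \<xi>) * norm (reflected_prod N q' w) * (cv * (1 - norm w))"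
      using x cv m by (intro mult_mono) auto
    also have "\<dots> \<le> Cv * (norm (fz \<xi>) * 4 ^ N)"
    proof (rule order_trans[OF 1])
      have "norm (reflected_prod N p' w) \<le> 4 ^ N" by (rule norm_reflected_prod_le) (use p'1 W(1) in auto)
      then show "Cv * (norm (fz \<xi>) * norm (reflected_prod N p' w)) \<le> Cv * (norm (fz \<xi>) * 4 ^ N)"
        using Cv by (intro mult_left_mono) auto
    qed
    finally have 2: "norm (f0 \<xi>) * (1 / m * x) ^ N * (cv * x) \<le> Cv * (norm (fz \<xi>) * 4 ^ N)" .
    have eq: "(1 / m * x) ^ N * (cv * x) * m ^ (3 * N + 2) = 2 ^ Suc N * cv * y ^ Suc N"
    proof -
      have "(1 / m * x) * m ^ 3 = 2 * y" using m by (simp add: x_def power2_eq_square power3_eq_cube)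
      then have "(1 / m * x) ^ N * (m ^ 3) ^ N = (2 * y) ^ N" by (metis power_mult_distrib)
      moreover have "x * m\<^sup>2 = 2 * y" using m by (simp add: x_def)
      moreover have "(1 / m * x) ^ N * (cv * x) * m ^ (3 * N + 2) = ((1 / m * x) ^ N * (m ^ 3) ^ N) * (cv * (x * m\<^sup>2))"
      proof -
        have "m ^ (3 * N + 2) = (m ^ 3) ^ N * m\<^sup>2" by (simp only: power_add power_mult)
        then show ?thesis by (simp only: mult_ac)
      qed
      ultimately show ?thesis by (simp only: power_mult_distrib power_Suc mult_ac)
    qed
    have "norm (f0 \<xi>) * (2 ^ Suc N * cv * y ^ Suc N) = (norm (f0 \<xi>) * (1 / m * x) ^ N * (cv * x)) * m ^ (3 * N + 2)"
      unfolding eq[symmetric] by (simp only: mult.assoc)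
    also have "\<dots> \<le> Cv * (norm (fz \<xi>) * 4 ^ N) * m ^ (3 * N + 2)"
      using 2 m by (intro mult_right_mono) auto
    also have "\<dots> \<le> Cv * (norm (fz \<xi>) * 4 ^ N) * (2 * norm \<xi>) ^ (3 * N + 2)"
    proof -
      have "m \<le> norm \<xi> + 1" unfolding m_def using norm_triangle_ineq4[of \<xi> 1] by simp
      also have "\<dots> \<le> 2 * norm \<xi>" using \<xi>(1) sum0 by (simp add: \<rho>0_def)
      finally show ?thesis using m Cv by (intro mult_left_mono power_mono) auto
    qed
    finally have "norm (f0 \<xi>) * y ^ Suc N * (2 ^ Suc N * cv) \<le> Cv * (norm (fz \<xi>) * 4 ^ N) * (2 * norm \<xi>) ^ (3 * N + 2)"
      by (simp only: mult_ac)
    then have "norm (f0 \<xi>) * y ^ Suc N \<le> Cv * (norm (fz \<xi>) * 4 ^ N) * (2 * norm \<xi>) ^ (3 * N + 2) / (2 ^ Suc N * cv)"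
      using cv by (simp only: pos_le_divide_eq mult_pos_pos zero_less_power zero_less_numeral)
    also have "\<dots> = C * norm \<xi> ^ (3 * N + 2) * norm (fz \<xi>)"
      unfolding C_def power_mult_distrib by (simp add: mult_ac)
    finally show ?thesis by (simp only: y_def)
  qed
  then show "\<exists>\<rho>0 a b C. \<forall>\<xi>. \<rho>0 \<le> norm \<xi> \<longrightarrow> Re \<xi> < 0 \<longrightarrow> norm (f0 \<xi>) * \<bar>Re \<xi>\<bar> ^ b \<le> C * norm \<xi> ^ a * norm (fz \<xi>)"
    by blast
qed

section \<open>Power series of bounded holomorphic functions and exponential integrals\<close>

lemma holomorphic_on_suminf_power:
  fixes g :: "nat \<Rightarrow> complex \<Rightarrow> complex"
  assumes S: "open S" and hol: "\<And>n. g n holomorphic_on S"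
    and bd: "\<And>n \<xi>. \<xi> \<in> S \<Longrightarrow> norm (g n \<xi>) \<le> 1" and z: "norm z < 1"
  shows "(\<lambda>\<xi>. \<Sum>n. z ^ n * g n \<xi>) holomorphic_on S"
proof (rule holomorphic_uniform_sequence[OF S, where f = "\<lambda>N \<xi>. \<Sum>n<N. z ^ n * g n \<xi>"])
  show "(\<lambda>\<xi>. \<Sum>n<N. z ^ n * g n \<xi>) holomorphic_on S" for N
    using hol by (intro holomorphic_intros)
  fix x assume "x \<in> S"
  then obtain d where d: "0 < d" "cball x d \<subseteq> S" using S open_contains_cball by blast
  have "uniform_limit (cball x d) (\<lambda>N \<xi>. \<Sum>n<N. z ^ n * g n \<xi>) (\<lambda>\<xi>. \<Sum>n. z ^ n * g n \<xi>) sequentially"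
  proof (rule Weierstrass_m_test)
    show "summable (\<lambda>n. norm z ^ n)" using z by (simp add: summable_geometric)
    fix n \<xi> assume "\<xi> \<in> cball x d"
    then have "norm (g n \<xi>) \<le> 1" using bd d by blast
    then show "norm (z ^ n * g n \<xi>) \<le> norm z ^ n"
      by (simp add: norm_mult norm_power mult_left_le)
  qed
  with d show "\<exists>d>0. cball x d \<subseteq> S \<and> uniform_limit (cball x d) (\<lambda>N \<xi>. \<Sum>n<N. z ^ n * g n \<xi>) (\<lambda>\<xi>. \<Sum>n. z ^ n * g n \<xi>) sequentially"
    by blast
qed

lemma summable_power_times_bounded:
  fixes g :: "nat \<Rightarrow> complex"
  assumes "\<And>n. norm (g n) \<le> 1" "norm z < 1"
  shows "summable (\<lambda>n. z ^ n * g n)" "norm (\<Sum>n. z ^ n * g n) \<le> 1 / (1 - norm z)"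
proof -
  have le: "norm (z ^ n * g n) \<le> norm z ^ n" for n
    using assms(1)[of n] by (auto simp: norm_mult norm_power intro: mult_left_le)
  have sm: "summable (\<lambda>n. norm z ^ n)" using assms by (simp add: summable_geometric)
  show "summable (\<lambda>n. z ^ n * g n)" by (rule summable_comparison_test'[OF sm le])
  have "norm (\<Sum>n. z ^ n * g n) \<le> (\<Sum>n. norm z ^ n)" by (rule norm_suminf_le[OF le sm])
  then show "norm (\<Sum>n. z ^ n * g n) \<le> 1 / (1 - norm z)" using assms by (simp add: suminf_geometric)
qed

text \<open>Differentiation under the integral sign. The difference quotients are dominated because
  Cauchy's inequality turns the bound on the integrand into a Lipschitz bound on a smaller disc.\<close>

lemma (in prob_space) holomorphic_on_exp_integral:
  fixes Y :: "'a \<Rightarrow> real" and Z :: "'a \<Rightarrow> complex"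
  assumes meas [measurable]: "Y \<in> borel_measurable M" "Z \<in> borel_measurable M"
    and S: "open S" and bd: "AE \<omega> in M. \<forall>\<xi>\<in>S. norm (Z \<omega> * exp (- \<xi> * Y \<omega>)) \<le> 1"
  shows "(\<lambda>\<xi>. CLINT \<omega>|M. Z \<omega> * exp (- \<xi> * Y \<omega>)) holomorphic_on S"
proof -
  let ?\<phi> = "\<lambda>\<omega> \<xi>. Z \<omega> * exp (- \<xi> * complex_of_real (Y \<omega>))"
  let ?\<phi>' = "\<lambda>\<omega> \<xi>. - complex_of_real (Y \<omega>) * ?\<phi> \<omega> \<xi>"
  have int: "integrable M (\<lambda>\<omega>. ?\<phi> \<omega> \<xi>)" if "\<xi> \<in> S" for \<xi>
    by (rule integrable_const_bound[where B = 1]) (use bd that in auto)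
  have "((\<lambda>\<xi>. CLINT \<omega>|M. ?\<phi> \<omega> \<xi>) has_field_derivative (CLINT \<omega>|M. ?\<phi>' \<omega> \<xi>0)) (at \<xi>0)"
    if \<xi>0: "\<xi>0 \<in> S" for \<xi>0
  proof -
    obtain \<delta> where \<delta>: "0 < \<delta>" "cball \<xi>0 \<delta> \<subseteq> S" using S \<xi>0 open_contains_cball by blast
    let ?U = "ball \<xi>0 (\<delta>/2)"
    have US: "?U \<subseteq> S" using \<delta> by force
    have der: "(?\<phi> \<omega> has_field_derivative ?\<phi>' \<omega> \<xi>) (at \<xi>)" for \<omega> \<xi>
      by (auto intro!: derivative_eq_intros simp: algebra_simps)
    have lip: "norm (?\<phi> \<omega> \<xi> - ?\<phi> \<omega> \<xi>0) \<le> (2/\<delta>) * norm (\<xi> - \<xi>0)"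
      if b: "\<forall>\<xi>\<in>S. norm (?\<phi> \<omega> \<xi>) \<le> 1" and \<xi>: "\<xi> \<in> ?U" for \<omega> \<xi>
    proof (rule field_differentiable_bound[of ?U "?\<phi> \<omega>" "?\<phi>' \<omega>"])
      show "(?\<phi> \<omega> has_field_derivative ?\<phi>' \<omega> w) (at w within ?U)" for w
        using der has_field_derivative_at_within by blast
      fix w assume w: "w \<in> ?U"
      have "norm ((deriv ^^ 1) (?\<phi> \<omega>) w) \<le> fact 1 * 1 / (\<delta>/2) ^ 1"
      proof (rule Cauchy_inequality)
        show "?\<phi> \<omega> holomorphic_on ball w (\<delta>/2)" by (intro holomorphic_intros)
        show "continuous_on (cball w (\<delta>/2)) (?\<phi> \<omega>)" by (intro continuous_intros)
        show "norm (?\<phi> \<omega> x) \<le> 1" if "norm (w - x) = \<delta>/2" for x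
        proof -
          have "dist \<xi>0 x \<le> dist \<xi>0 w + dist w x" by (rule dist_triangle)
          then have "x \<in> cball \<xi>0 \<delta>" using w that by (simp add: dist_norm)
          then show ?thesis using b \<delta> by blast
        qed
      qed (use \<delta> in auto)
      then show "norm (?\<phi>' \<omega> w) \<le> 2/\<delta>" using DERIV_imp_deriv[OF der, of \<omega> w] by simp
    qed (use \<xi> \<delta> in auto)
    have "((\<lambda>\<xi>. ((CLINT \<omega>|M. ?\<phi> \<omega> \<xi>) - (CLINT \<omega>|M. ?\<phi> \<omega> \<xi>0)) / (\<xi> - \<xi>0)) \<longlongrightarrow> (CLINT \<omega>|M. ?\<phi>' \<omega> \<xi>0)) (at \<xi>0 within ?U)"
      unfolding tendsto_at_iff_sequentially
    proof (intro allI impI)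
      fix x :: "nat \<Rightarrow> complex" assume x: "\<forall>i. x i \<in> ?U - {\<xi>0}" and lim: "x \<longlonglongrightarrow> \<xi>0"
      have "(\<lambda>i. CLINT \<omega>|M. (?\<phi> \<omega> (x i) - ?\<phi> \<omega> \<xi>0) / (x i - \<xi>0)) \<longlonglongrightarrow> (CLINT \<omega>|M. ?\<phi>' \<omega> \<xi>0)"
      proof (rule integral_dominated_convergence[where w = "\<lambda>_. 2/\<delta>"])
        show "AE \<omega> in M. (\<lambda>i. (?\<phi> \<omega> (x i) - ?\<phi> \<omega> \<xi>0) / (x i - \<xi>0)) \<longlonglongrightarrow> ?\<phi>' \<omega> \<xi>0"
        proof (rule AE_I2)
          fix \<omega>
          have "((\<lambda>\<xi>. (?\<phi> \<omega> \<xi> - ?\<phi> \<omega> \<xi>0) / (\<xi> - \<xi>0)) \<longlongrightarrow> ?\<phi>' \<omega> \<xi>0) (at \<xi>0)"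
            using der[of \<omega> \<xi>0] by (simp only: has_field_derivative_iff)
          moreover have "filterlim x (at \<xi>0) sequentially"
            using x lim by (auto simp: filterlim_at)
          ultimately show "(\<lambda>i. (?\<phi> \<omega> (x i) - ?\<phi> \<omega> \<xi>0) / (x i - \<xi>0)) \<longlonglongrightarrow> ?\<phi>' \<omega> \<xi>0"
            by (rule filterlim_compose)
        qed
        show "AE \<omega> in M. norm ((?\<phi> \<omega> (x i) - ?\<phi> \<omega> \<xi>0) / (x i - \<xi>0)) \<le> 2/\<delta>" for i
          using bd
        proof eventually_elim
          case (elim \<omega>)
          have "norm (?\<phi> \<omega> (x i) - ?\<phi> \<omega> \<xi>0) \<le> (2/\<delta>) * norm (x i - \<xi>0)"
            using lip[OF elim] x by blast
          moreover have "0 < norm (x i - \<xi>0)" using x by auto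
          ultimately show ?case unfolding norm_divide by (simp only: pos_divide_le_eq)
        qed
      qed simp_all
      moreover have "(CLINT \<omega>|M. (?\<phi> \<omega> (x i) - ?\<phi> \<omega> \<xi>0) / (x i - \<xi>0))
          = ((CLINT \<omega>|M. ?\<phi> \<omega> (x i)) - (CLINT \<omega>|M. ?\<phi> \<omega> \<xi>0)) / (x i - \<xi>0)" for i
      proof -
        have "x i \<in> S" using x US by blast
        then show ?thesis by (simp only: integral_divide_zero Bochner_Integration.integral_diff[OF int int[OF \<xi>0]])
      qed
      ultimately show "((\<lambda>\<xi>. ((CLINT \<omega>|M. ?\<phi> \<omega> \<xi>) - (CLINT \<omega>|M. ?\<phi> \<omega> \<xi>0)) / (\<xi> - \<xi>0)) \<circ> x) \<longlonglongrightarrow> (CLINT \<omega>|M. ?\<phi>' \<omega> \<xi>0)"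
        by (simp only: o_def)
    qed
    then show ?thesis
      unfolding has_field_derivative_iff using \<delta> by (simp add: at_within_open[of \<xi>0 ?U])
  qed
  then show ?thesis
    using S by (auto simp: holomorphic_on_open)
qed

section \<open>The walk up to its exit from a set\<close>

locale bivariate_walk = prob_space M for M :: "'a measure" +
  fixes B A :: "'a \<Rightarrow> real" and Bs As :: "nat \<Rightarrow> 'a \<Rightarrow> real"
  assumes meas: "(\<lambda>\<omega>. (B \<omega>, A \<omega>)) \<in> borel_measurable M"
    and nonneg: "\<And>\<omega>. \<omega> \<in> space M \<Longrightarrow> 0 \<le> B \<omega> \<and> 0 \<le> A \<omega>"
    and indep: "indep_vars (\<lambda>_. borel) (\<lambda>i \<omega>. (Bs i \<omega>, As i \<omega>)) {1..}"
    and copies: "\<And>i. 1 \<le> i \<Longrightarrow>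
      distr M borel (\<lambda>\<omega>. (Bs i \<omega>, As i \<omega>)) = distr M borel (\<lambda>\<omega>. (B \<omega>, A \<omega>))"
begin

text \<open>With \<open>a\<^sub>n\<close> the sum of the \<open>A\<^sub>i\<close>, the weight of a path is \<open>exp (- \<xi> S\<^sub>n - s a\<^sub>n)\<close>: one step
  contributes \<open>exp (- \<xi> B - (s - \<xi>) A)\<close>, whose mean is \<open>h(\<xi>, s - \<xi>)\<close>.\<close>

definition weight :: "complex \<Rightarrow> nat \<Rightarrow> complex \<Rightarrow> 'a \<Rightarrow> complex" where
  "weight s n \<xi> \<omega> = exp (- \<xi> * complex_of_real (walk Bs As n \<omega>) - s * complex_of_real (partial_sum As n \<omega>))"

definition stays :: "real set \<Rightarrow> nat \<Rightarrow> 'a \<Rightarrow> bool" where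
  "stays D n \<omega> \<longleftrightarrow> (\<forall>j\<in>{1..n}. walk Bs As j \<omega> \<in> D)"

definition stay_transform :: "real set \<Rightarrow> complex \<Rightarrow> nat \<Rightarrow> complex \<Rightarrow> complex" where
  "stay_transform D s n \<xi> = (CLINT \<omega>|M. if stays D n \<omega> then weight s n \<xi> \<omega> else 0)"

definition exit_transform :: "real set \<Rightarrow> complex \<Rightarrow> nat \<Rightarrow> complex \<Rightarrow> complex" where
  "exit_transform D s n \<xi> =
     (CLINT \<omega>|M. if stays D (n - 1) \<omega> \<and> walk Bs As n \<omega> \<notin> D then weight s n \<xi> \<omega> else 0)"

lemma measurable_pair: "1 \<le> i \<Longrightarrow> (\<lambda>\<omega>. (Bs i \<omega>, As i \<omega>)) \<in> borel_measurable M"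
  using indep by (simp add: indep_vars_def)

lemma measurable_Bs: "1 \<le> i \<Longrightarrow> Bs i \<in> borel_measurable M"
  using measurable_compose[OF measurable_pair, of i fst borel] by (simp add: borel_prod[symmetric])

lemma measurable_As: "1 \<le> i \<Longrightarrow> As i \<in> borel_measurable M"
  using measurable_compose[OF measurable_pair, of i snd borel] by (simp add: borel_prod[symmetric])

lemma measurable_walk [measurable]: "walk Bs As n \<in> borel_measurable M"
  unfolding walk_def using measurable_Bs measurable_As by (intro borel_measurable_sum borel_measurable_diff) auto

lemma measurable_partial_sum [measurable]: "partial_sum As n \<in> borel_measurable M"
  unfolding partial_sum_def using measurable_As by (intro borel_measurable_sum) auto

lemma measurable_weight [measurable]: "weight s n \<xi> \<in> borel_measurable M"
  unfolding weight_def by measurable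

lemma measurable_stays [measurable]: "D \<in> sets borel \<Longrightarrow> Measurable.pred M (stays D n)"
  unfolding stays_def by (intro pred_intros_finite pred_sets2[OF _ measurable_walk]) auto

lemma AE_steps_nonneg: "AE \<omega> in M. \<forall>i\<ge>1. 0 \<le> Bs i \<omega> \<and> 0 \<le> As i \<omega>"
proof -
  have "AE \<omega> in M. 0 \<le> Bs i \<omega> \<and> 0 \<le> As i \<omega>" if i: "1 \<le> i" for i
  proof -
    have ms: "Measurable.pred borel (\<lambda>p::real\<times>real. 0 \<le> fst p \<and> 0 \<le> snd p)"
      unfolding borel_prod[symmetric] by measurable
    have "AE p in distr M borel (\<lambda>\<omega>. (B \<omega>, A \<omega>)). 0 \<le> fst p \<and> 0 \<le> snd p"
      using nonneg by (subst AE_distr_iff[OF meas]) (use ms in auto)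
    then have "AE p in distr M borel (\<lambda>\<omega>. (Bs i \<omega>, As i \<omega>)). 0 \<le> fst p \<and> 0 \<le> snd p"
      unfolding copies[OF i] .
    then show ?thesis by (subst (asm) AE_distr_iff[OF measurable_pair[OF i]]) (use ms in auto)
  qed
  then show ?thesis by (auto simp: AE_all_countable)
qed

lemma walk_eq: "walk Bs As n \<omega> = partial_sum Bs n \<omega> - partial_sum As n \<omega>"
  by (simp add: walk_def partial_sum_def sum_subtractf)

lemma walk_0: "walk Bs As 0 \<omega> = 0"
  by (simp add: walk_def)

lemma AE_sums_nonneg: "AE \<omega> in M. \<forall>n. 0 \<le> partial_sum Bs n \<omega> \<and> 0 \<le> partial_sum As n \<omega>"
  using AE_steps_nonneg by eventually_elim (auto simp: partial_sum_def intro!: sum_nonneg)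

lemma norm_weight: "norm (weight s n \<xi> \<omega>) = exp (- (Re \<xi> * walk Bs As n \<omega> + Re s * partial_sum As n \<omega>))"
  by (simp add: weight_def)

text \<open>The three domains on which the weight is bounded: the strip, where the exponent is minus
  a nonnegative combination of \<open>b\<^sub>n\<close> and \<open>a\<^sub>n\<close>, extended to a half-plane according to the sign of \<open>S\<^sub>n\<close>. On the right
  \<open>a\<^sub>n \<ge> 0\<close> suffices; on the left both terms of the exponent have the favourable sign.\<close>

lemma AE_norm_weight_le_1:
  "AE \<omega> in M. \<forall>n s \<xi>. 0 \<le> Re s \<longrightarrow>
     (0 \<le> Re \<xi> \<and> Re \<xi> \<le> Re s \<longrightarrow> norm (weight s n \<xi> \<omega>) \<le> 1) \<and>
     (0 \<le> Re \<xi> \<and> 0 \<le> walk Bs As n \<omega> \<longrightarrow> norm (weight s n \<xi> \<omega>) \<le> 1) \<and>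
     (Re \<xi> \<le> Re s \<and> walk Bs As n \<omega> \<le> 0 \<longrightarrow> norm (weight s n \<xi> \<omega>) \<le> 1)"
  using AE_sums_nonneg
proof eventually_elim
  case (elim \<omega>)
  have strip: "norm (weight s n \<xi> \<omega>) \<le> 1" if "0 \<le> Re \<xi>" "Re \<xi> \<le> Re s" for n s \<xi>
  proof -
    have "Re \<xi> * walk Bs As n \<omega> + Re s * partial_sum As n \<omega>
        = Re \<xi> * partial_sum Bs n \<omega> + (Re s - Re \<xi>) * partial_sum As n \<omega>"
      unfolding walk_eq by (simp add: algebra_simps)
    also have "\<dots> \<ge> 0" using elim that by (intro add_nonneg_nonneg mult_nonneg_nonneg) auto
    finally show ?thesis by (simp add: norm_weight)
  qed
  have up: "norm (weight s n \<xi> \<omega>) \<le> 1" if "0 \<le> Re s" "0 \<le> Re \<xi>" "0 \<le> walk Bs As n \<omega>" for n s \<xi>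
  proof -
    have "0 \<le> Re \<xi> * walk Bs As n \<omega> + Re s * partial_sum As n \<omega>"
      using that elim by (intro add_nonneg_nonneg mult_nonneg_nonneg) auto
    then show ?thesis by (simp add: norm_weight)
  qed
  have down: "norm (weight s n \<xi> \<omega>) \<le> 1" if "0 \<le> Re s" "Re \<xi> \<le> Re s" "walk Bs As n \<omega> \<le> 0" for n s \<xi>
  proof (cases "0 \<le> Re \<xi>")
    case True then show ?thesis using strip that by blast
  next
    case False
    have "0 \<le> Re \<xi> * walk Bs As n \<omega>" using False that by (intro mult_nonpos_nonpos) auto
    moreover have "0 \<le> Re s * partial_sum As n \<omega>" using elim that by auto
    ultimately show ?thesis by (simp add: norm_weight)
  qed
  show ?case using strip up down by blast
qed

lemma integrable_cut_weight:
  assumes "Measurable.pred M F" "AE \<omega> in M. F \<omega> \<longrightarrow> norm (weight s n \<xi> \<omega>) \<le> 1"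
  shows "integrable M (\<lambda>\<omega>. if F \<omega> then weight s n \<xi> \<omega> else 0)"
  by (rule integrable_const_bound[where B = 1]) (use assms in auto)

lemma norm_cut_weight_le:
  assumes F: "Measurable.pred M F" and bd: "AE \<omega> in M. F \<omega> \<longrightarrow> norm (weight s n \<xi> \<omega>) \<le> 1"
  shows "norm (CLINT \<omega>|M. if F \<omega> then weight s n \<xi> \<omega> else 0) \<le> measure M {\<omega>\<in>space M. F \<omega>}"
proof -
  have ms: "{\<omega>\<in>space M. F \<omega>} \<in> sets M" using F by simp
  have "norm (CLINT \<omega>|M. if F \<omega> then weight s n \<xi> \<omega> else 0)
      \<le> (LINT \<omega>|M. norm (if F \<omega> then weight s n \<xi> \<omega> else 0))" by (rule integral_norm_bound)
  also have "\<dots> \<le> (LINT \<omega>|M. indicator {\<omega>\<in>space M. F \<omega>} \<omega>)"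
  proof (rule integral_mono_AE)
    show "integrable M (\<lambda>\<omega>. norm (if F \<omega> then weight s n \<xi> \<omega> else 0))"
      using integrable_cut_weight[OF assms] by (rule integrable_norm)
    show "integrable M (indicator {\<omega>\<in>space M. F \<omega>} :: 'a \<Rightarrow> real)"
      using ms by (simp add: emeasure_eq_measure)
    show "AE \<omega> in M. norm (if F \<omega> then weight s n \<xi> \<omega> else 0) \<le> indicator {\<omega>\<in>space M. F \<omega>} \<omega>"
      using bd AE_space by eventually_elim auto
  qed
  also have "\<dots> = measure M {\<omega>\<in>space M. F \<omega>}" using ms by simp
  finally show ?thesis .
qed

lemma holomorphic_on_cut_weight:
  assumes F: "Measurable.pred M F" and S: "open S"
    and bd: "AE \<omega> in M. \<forall>\<xi>\<in>S. F \<omega> \<longrightarrow> norm (weight s n \<xi> \<omega>) \<le> 1"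
  shows "(\<lambda>\<xi>. CLINT \<omega>|M. if F \<omega> then weight s n \<xi> \<omega> else 0) holomorphic_on S"
proof -
  define Z where "Z = (\<lambda>\<omega>. if F \<omega> then exp (- s * complex_of_real (partial_sum As n \<omega>)) else 0)"
  have eq: "(if F \<omega> then weight s n \<xi> \<omega> else 0) = Z \<omega> * exp (- \<xi> * walk Bs As n \<omega>)" for \<omega> \<xi>
    by (simp add: Z_def weight_def exp_diff exp_minus field_simps)
  have "(\<lambda>\<xi>. CLINT \<omega>|M. Z \<omega> * exp (- \<xi> * walk Bs As n \<omega>)) holomorphic_on S"
  proof (rule holomorphic_on_exp_integral[OF measurable_walk _ S])
    show "Z \<in> borel_measurable M" unfolding Z_def using F by measurable
    show "AE \<omega> in M. \<forall>\<xi>\<in>S. norm (Z \<omega> * exp (- \<xi> * walk Bs As n \<omega>)) \<le> 1"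
      using bd
    proof eventually_elim
      case (elim \<omega>)
      then have "norm (if F \<omega> then weight s n \<xi> \<omega> else 0) \<le> 1" if "\<xi> \<in> S" for \<xi> using that by auto
      then show ?case unfolding eq by blast
    qed
  qed
  then show ?thesis by (simp only: eq)
qed

lemma joint_transform_step:
  assumes "1 \<le> i"
  shows "(CLINT \<omega>|M. exp (- \<xi> * complex_of_real (Bs i \<omega> - As i \<omega>) - s * complex_of_real (As i \<omega>)))
    = joint_transform M B A \<xi> (s - \<xi>)"
proof -
  let ?e = "\<lambda>p::real\<times>real. exp (- \<xi> * complex_of_real (fst p - snd p) - s * complex_of_real (snd p))"
  have e: "?e \<in> borel_measurable borel" unfolding borel_prod[symmetric] by measurable
  have "(CLINT \<omega>|M. ?e (Bs i \<omega>, As i \<omega>)) = (CLINT p|distr M borel (\<lambda>\<omega>. (Bs i \<omega>, As i \<omega>)). ?e p)"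
    using integral_distr[OF measurable_pair[OF assms] e] by simp
  also have "\<dots> = (CLINT p|distr M borel (\<lambda>\<omega>. (B \<omega>, A \<omega>)). ?e p)" using copies[OF assms] by simp
  also have "\<dots> = (CLINT \<omega>|M. ?e (B \<omega>, A \<omega>))" using integral_distr[OF meas e] by simp
  also have "\<dots> = joint_transform M B A \<xi> (s - \<xi>)"
    unfolding joint_transform_def by (simp add: algebra_simps)
  finally show ?thesis by simp
qed

lemma norm_joint_transform_le_1:
  assumes "0 \<le> Re s1" "0 \<le> Re s2"
  shows "norm (joint_transform M B A s1 s2) \<le> 1"
proof -
  have [measurable]: "B \<in> borel_measurable M" "A \<in> borel_measurable M"
    using measurable_compose[OF meas, of fst borel] measurable_compose[OF meas, of snd borel]
    by (simp_all add: borel_prod[symmetric])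
  let ?e = "\<lambda>\<omega>. exp (- s1 * complex_of_real (B \<omega>) - s2 * complex_of_real (A \<omega>))"
  have b: "norm (?e \<omega>) \<le> 1" if "\<omega> \<in> space M" for \<omega>
  proof -
    have "0 \<le> Re s1 * B \<omega> + Re s2 * A \<omega>" using nonneg[OF that] assms by auto
    then show ?thesis by simp
  qed
  have "norm (joint_transform M B A s1 s2) \<le> (LINT \<omega>|M. norm (?e \<omega>))"
    unfolding joint_transform_def by (rule integral_norm_bound)
  also have "\<dots> \<le> (LINT \<omega>|M. 1)"
    by (rule integral_mono) (use b in \<open>auto intro!: integrable_const_bound[where B = 1]\<close>)
  also have "\<dots> = 1" by (simp add: prob_space)
  finally show ?thesis .
qed

text \<open>The next step is independent of the path so far, so one more step multiplies the transform
  by \<open>h\<close>, whether or not the walk leaves \<open>D\<close> at that step.\<close>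

lemma stay_transform_step:
  assumes D: "D \<in> sets borel" and \<xi>: "0 \<le> Re \<xi>" "Re \<xi> \<le> Re s"
  shows "stay_transform D s (Suc n) \<xi> + exit_transform D s (Suc n) \<xi>
    = stay_transform D s n \<xi> * joint_transform M B A \<xi> (s - \<xi>)"
proof -
  have strip: "AE \<omega> in M. norm (weight s m \<xi> \<omega>) \<le> 1" for m
    using AE_norm_weight_le_1 by eventually_elim (use \<xi> in force)
  let ?P = "\<lambda>i \<omega>. (Bs i \<omega>, As i \<omega>)"
  let ?N = "\<lambda>I. PiM I (\<lambda>_::nat. borel :: (real \<times> real) measure)"
  define w where "w = (\<lambda>j (f :: nat \<Rightarrow> real \<times> real). \<Sum>i=1..j. fst (f i) - snd (f i))"
  define H where "H = (\<lambda>f. if \<forall>j\<in>{1..n}. w j f \<in> D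
     then exp (- \<xi> * complex_of_real (w n f) - s * complex_of_real (\<Sum>i=1..n. snd (f i))) else 0)"
  define e where "e = (\<lambda>f :: nat \<Rightarrow> real \<times> real. exp (- \<xi> * complex_of_real (fst (f (Suc n)) - snd (f (Suc n)))
     - s * complex_of_real (snd (f (Suc n)))))"
  have [measurable]: "D \<in> sets borel" by (rule D)
  have mfst: "(\<lambda>f. fst (f i)) \<in> borel_measurable (?N I)" if "i \<in> I" for i and I
    using measurable_compose[OF measurable_component_singleton[OF that, of "\<lambda>_. borel :: (real\<times>real) measure"], of fst borel]
    by (simp add: borel_prod[symmetric])
  have msnd: "(\<lambda>f. snd (f i)) \<in> borel_measurable (?N I)" if "i \<in> I" for i and I
    using measurable_compose[OF measurable_component_singleton[OF that, of "\<lambda>_. borel :: (real\<times>real) measure"], of snd borel]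
    by (simp add: borel_prod[symmetric])
  have mw: "w j \<in> borel_measurable (?N {1..n})" if "j \<le> n" for j
    unfolding w_def using that by (intro borel_measurable_sum borel_measurable_diff mfst msnd) auto
  have ma: "(\<lambda>f. \<Sum>i=1..n. snd (f i)) \<in> borel_measurable (?N {1..n})"
    by (intro borel_measurable_sum msnd) auto
  have "{f \<in> space (?N {1..n}). w j f \<in> D} \<in> sets (?N {1..n})" if "j \<in> {1..n}" for j
    using measurable_sets[OF mw[of j] D] that by (simp add: vimage_def Int_def conj_commute)
  then have mstay: "Measurable.pred (?N {1..n}) (\<lambda>f. \<forall>j\<in>{1..n}. w j f \<in> D)"
    by (intro pred_intros_finite) (auto simp: pred_def)
  have mH: "H \<in> borel_measurable (?N {1..n})"
  proof -
    have "(\<lambda>f. exp (- \<xi> * complex_of_real (a f) - s * complex_of_real (b f))) \<in> borel_measurable (?N {1..n})"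
      if [measurable]: "a \<in> borel_measurable (?N {1..n})" "b \<in> borel_measurable (?N {1..n})"
      for a b :: "(nat \<Rightarrow> real \<times> real) \<Rightarrow> real"
      by measurable
    from this[OF mw[OF order_refl] ma] mstay show ?thesis
      unfolding H_def pred_def by (intro measurable_If) auto
  qed
  have me: "e \<in> borel_measurable (?N {Suc n})"
    unfolding e_def using mfst[of "Suc n" "{Suc n}"] msnd[of "Suc n" "{Suc n}"] by measurable
  have "indep_var (?N {1..n}) (\<lambda>\<omega>. restrict (\<lambda>i. ?P i \<omega>) {1..n}) (?N {Suc n}) (\<lambda>\<omega>. restrict (\<lambda>i. ?P i \<omega>) {Suc n})"
    by (rule indep_var_restrict[OF indep]) auto
  then have iv: "indep_var borel (H \<circ> (\<lambda>\<omega>. restrict (\<lambda>i. ?P i \<omega>) {1..n})) borel (e \<circ> (\<lambda>\<omega>. restrict (\<lambda>i. ?P i \<omega>) {Suc n}))"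
    by (rule indep_var_compose[OF _ mH me])
  let ?W = "\<lambda>\<omega>. if stays D n \<omega> then weight s n \<xi> \<omega> else 0"
  let ?E = "\<lambda>\<omega>. exp (- \<xi> * complex_of_real (Bs (Suc n) \<omega> - As (Suc n) \<omega>) - s * complex_of_real (As (Suc n) \<omega>))"
  have wr: "w j (restrict (\<lambda>i. ?P i \<omega>) {1..n}) = walk Bs As j \<omega>" if "j \<le> n" for j \<omega>
    unfolding w_def walk_def using that by (intro sum.cong) auto
  have H_eq: "H \<circ> (\<lambda>\<omega>. restrict (\<lambda>i. ?P i \<omega>) {1..n}) = ?W"
  proof
    fix \<omega>
    let ?r = "restrict (\<lambda>i. ?P i \<omega>) {1..n}"
    have 1: "(\<forall>j\<in>{1..n}. w j ?r \<in> D) \<longleftrightarrow> stays D n \<omega>"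
      unfolding stays_def using wr by (intro ball_cong) auto
    have 2: "(\<Sum>i=1..n. snd (?r i)) = partial_sum As n \<omega>"
      unfolding partial_sum_def by (intro sum.cong) auto
    show "(H \<circ> (\<lambda>\<omega>. restrict (\<lambda>i. ?P i \<omega>) {1..n})) \<omega> = ?W \<omega>"
      unfolding o_def H_def 1 2 wr[OF order_refl] weight_def ..
  qed
  have e_eq: "e \<circ> (\<lambda>\<omega>. restrict (\<lambda>i. ?P i \<omega>) {Suc n}) = ?E" by (rule ext) (simp add: e_def)
  have mul: "weight s (Suc n) \<xi> \<omega> = weight s n \<xi> \<omega> * ?E \<omega>" for \<omega>
    unfolding weight_def walk_def partial_sum_def mult_exp_exp by (simp add: algebra_simps)
  have intW: "integrable M ?W"
    by (rule integrable_cut_weight) (use strip[of n] in auto)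
  have Eb: "AE \<omega> in M. norm (?E \<omega>) \<le> 1"
    using AE_steps_nonneg
  proof eventually_elim
    case (elim \<omega>)
    have "0 \<le> Re \<xi> * Bs (Suc n) \<omega> + (Re s - Re \<xi>) * As (Suc n) \<omega>"
      using elim \<xi> by (intro add_nonneg_nonneg mult_nonneg_nonneg) auto
    then show ?case by (simp add: algebra_simps)
  qed
  have intE: "integrable M ?E"
    by (rule integrable_const_bound[OF Eb]) (use measurable_Bs[of "Suc n"] measurable_As[of "Suc n"] in measurable)
  have "stay_transform D s n \<xi> * joint_transform M B A \<xi> (s - \<xi>) = (CLINT \<omega>|M. ?W \<omega> * ?E \<omega>)"
    using indep_var_lebesgue_integral[OF iv[unfolded H_eq e_eq] intW intE] joint_transform_step[of "Suc n" \<xi> s]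
    by (simp add: stay_transform_def)
  also have "\<dots> = (CLINT \<omega>|M. (if stays D (Suc n) \<omega> then weight s (Suc n) \<xi> \<omega> else 0) +
      (if stays D (Suc n - 1) \<omega> \<and> walk Bs As (Suc n) \<omega> \<notin> D then weight s (Suc n) \<xi> \<omega> else 0))"
    by (rule Bochner_Integration.integral_cong[OF refl]) (auto simp: mul stays_def atLeastAtMostSuc_conv)
  also have "\<dots> = stay_transform D s (Suc n) \<xi> + exit_transform D s (Suc n) \<xi>"
    unfolding stay_transform_def exit_transform_def
    by (rule Bochner_Integration.integral_add; rule integrable_cut_weight) (use strip[of "Suc n"] in auto)
  finally show ?thesis by simp
qed

lemma stay_transform_0 [simp]: "stay_transform D s 0 \<xi> = 1"
  by (simp add: stay_transform_def stays_def weight_def walk_def partial_sum_def prob_space)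

definition stay_series :: "real set \<Rightarrow> complex \<Rightarrow> complex \<Rightarrow> complex \<Rightarrow> complex" where
  "stay_series D z s \<xi> = (\<Sum>n. z ^ n * stay_transform D s n \<xi>)"

definition exit_series :: "real set \<Rightarrow> complex \<Rightarrow> complex \<Rightarrow> complex \<Rightarrow> complex" where
  "exit_series D z s \<xi> = (\<Sum>n. z ^ n * (z * exit_transform D s (Suc n) \<xi>))"

lemma norm_stay_transform_le_1:
  assumes D: "D \<in> sets borel" and bd: "AE \<omega> in M. \<forall>n. stays D n \<omega> \<longrightarrow> norm (weight s n \<xi> \<omega>) \<le> 1"
  shows "norm (stay_transform D s n \<xi>) \<le> 1"
proof -
  have "norm (stay_transform D s n \<xi>) \<le> measure M {\<omega>\<in>space M. stays D n \<omega>}"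
    unfolding stay_transform_def by (rule norm_cut_weight_le) (use D bd in auto)
  also have "\<dots> \<le> 1" by simp
  finally show ?thesis .
qed

lemma norm_exit_transform_le:
  assumes D: "D \<in> sets borel" and bd: "AE \<omega> in M. \<forall>n. walk Bs As n \<omega> \<notin> D \<longrightarrow> norm (weight s n \<xi> \<omega>) \<le> 1"
  shows "norm (exit_transform D s (Suc n) \<xi>)
    \<le> measure M {\<omega>\<in>space M. stays D n \<omega>} - measure M {\<omega>\<in>space M. stays D (Suc n) \<omega>}"
proof -
  have "norm (exit_transform D s (Suc n) \<xi>) \<le> measure M {\<omega>\<in>space M. stays D n \<omega> \<and> walk Bs As (Suc n) \<omega> \<notin> D}"
    unfolding exit_transform_def diff_Suc_1
    by (rule norm_cut_weight_le) (use D bd pred_sets2[OF D measurable_walk] in auto)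
  also have "{\<omega>\<in>space M. stays D n \<omega> \<and> walk Bs As (Suc n) \<omega> \<notin> D}
      = {\<omega>\<in>space M. stays D n \<omega>} - {\<omega>\<in>space M. stays D (Suc n) \<omega>}"
    by (auto simp: stays_def atLeastAtMostSuc_conv)
  also have "measure M \<dots> = measure M {\<omega>\<in>space M. stays D n \<omega>} - measure M {\<omega>\<in>space M. stays D (Suc n) \<omega>}"
    by (rule finite_measure_Diff) (use D in \<open>auto simp: stays_def\<close>)
  finally show ?thesis .
qed

text \<open>The exit probabilities at the successive epochs add up to at most one.\<close>

lemma norm_exit_series_le:
  assumes D: "D \<in> sets borel" and bd: "AE \<omega> in M. \<forall>n. walk Bs As n \<omega> \<notin> D \<longrightarrow> norm (weight s n \<xi> \<omega>) \<le> 1"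
    and z: "norm z < 1"
  shows "norm (exit_series D z s \<xi>) \<le> norm z" "norm (exit_transform D s (Suc n) \<xi>) \<le> 1"
proof -
  define p where "p = (\<lambda>n. measure M {\<omega>\<in>space M. stays D n \<omega>})"
  have le: "norm (exit_transform D s (Suc n) \<xi>) \<le> p n - p (Suc n)" for n
    unfolding p_def by (rule norm_exit_transform_le[OF D bd])
  have p01: "0 \<le> p n" "p n \<le> 1" for n by (auto simp: p_def)
  show "norm (exit_transform D s (Suc n) \<xi>) \<le> 1" using le[of n] p01[of n] p01[of "Suc n"] by linarith
  have nn: "0 \<le> p n - p (Suc n)" for n using le[of n] norm_ge_zero order_trans by blast
  have part: "(\<Sum>n<N. p n - p (Suc n)) \<le> 1" for N
    unfolding sum_lessThan_telescope' using p01 by (smt (verit))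
  have sm: "summable (\<lambda>n. p n - p (Suc n))" by (rule summableI_nonneg_bounded[OF nn part])
  have tot: "(\<Sum>n. p n - p (Suc n)) \<le> 1" by (rule suminf_le_const[OF sm part])
  have "norm (exit_series D z s \<xi>) \<le> (\<Sum>n. norm z * (p n - p (Suc n)))"
    unfolding exit_series_def
  proof (rule norm_suminf_le)
    show "summable (\<lambda>n. norm z * (p n - p (Suc n)))" using sm by (rule summable_mult)
    fix n
    have "norm (z ^ n * (z * exit_transform D s (Suc n) \<xi>)) = norm z ^ n * (norm z * norm (exit_transform D s (Suc n) \<xi>))"
      by (simp add: norm_mult norm_power)
    also have "\<dots> \<le> 1 * (norm z * (p n - p (Suc n)))"
      using z le[of n] by (intro mult_mono) (auto simp: power_le_one)
    finally show "norm (z ^ n * (z * exit_transform D s (Suc n) \<xi>)) \<le> norm z * (p n - p (Suc n))" by simp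
  qed
  also have "\<dots> = norm z * (\<Sum>n. p n - p (Suc n))" by (rule suminf_mult[OF sm])
  also have "\<dots> \<le> norm z * 1" using tot by (intro mult_left_mono) auto
  finally show "norm (exit_series D z s \<xi>) \<le> norm z" by simp
qed

text \<open>The Wiener-Hopf identity: summation of the one-step relation against powers of \<open>z\<close>.\<close>

lemma Wiener_Hopf_identity:
  assumes D: "D \<in> sets borel" and \<xi>: "0 \<le> Re \<xi>" "Re \<xi> \<le> Re s" and z: "norm z < 1"
  shows "stay_series D z s \<xi> * (1 - z * joint_transform M B A \<xi> (s - \<xi>)) = 1 - exit_series D z s \<xi>"
proof -
  let ?h = "joint_transform M B A \<xi> (s - \<xi>)"
  let ?u = "\<lambda>n. z ^ n * stay_transform D s n \<xi>"
  let ?v = "\<lambda>n. z ^ n * (z * exit_transform D s (Suc n) \<xi>)"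
  have strip: "AE \<omega> in M. \<forall>n. norm (weight s n \<xi> \<omega>) \<le> 1"
    using AE_norm_weight_le_1 by eventually_elim (use \<xi> in force)
  have su: "summable ?u"
    by (rule summable_power_times_bounded[OF norm_stay_transform_le_1[OF D] z]) (use strip in auto)
  have sv: "summable ?v"
  proof (rule summable_power_times_bounded[OF _ z])
    fix n
    have "norm (exit_transform D s (Suc n) \<xi>) \<le> 1"
      by (rule norm_exit_series_le(2)[OF D _ z]) (use strip in auto)
    then show "norm (z * exit_transform D s (Suc n) \<xi>) \<le> 1"
      using z by (simp add: norm_mult mult_le_one)
  qed
  have step: "?u (Suc n) + ?v n = z * ?h * ?u n" for n
  proof -
    have "?u (Suc n) + ?v n = z ^ Suc n * (stay_transform D s (Suc n) \<xi> + exit_transform D s (Suc n) \<xi>)"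
      by (simp only: power_Suc distrib_left mult_ac)
    also have "\<dots> = z ^ Suc n * (stay_transform D s n \<xi> * ?h)"
      by (simp only: stay_transform_step[OF D \<xi>])
    also have "\<dots> = z * ?h * ?u n" by (simp add: mult_ac)
    finally show ?thesis .
  qed
  have su': "summable (\<lambda>n. ?u (Suc n))" using su by (subst summable_Suc_iff)
  have 1: "suminf ?u - 1 = (\<Sum>n. ?u (Suc n))" using suminf_split_head[OF su] by simp
  have 2: "(\<Sum>n. ?u (Suc n)) + suminf ?v = (\<Sum>n. ?u (Suc n) + ?v n)"
    using su' sv by (rule suminf_add)
  have 3: "(\<Sum>n. ?u (Suc n) + ?v n) = z * ?h * suminf ?u" unfolding step by (rule suminf_mult[OF su])
  have "suminf ?u - 1 + suminf ?v = z * ?h * suminf ?u" by (simp only: 1 2 3)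
  then show ?thesis unfolding stay_series_def exit_series_def by (simp add: algebra_simps)
qed

lemma holomorphic_on_stay_series:
  assumes D: "D \<in> sets borel" and S: "open S" and z: "norm z < 1"
    and bd: "AE \<omega> in M. \<forall>\<xi>\<in>S. \<forall>n. stays D n \<omega> \<longrightarrow> norm (weight s n \<xi> \<omega>) \<le> 1"
  shows "stay_series D z s holomorphic_on S" "\<And>\<xi>. \<xi> \<in> S \<Longrightarrow> norm (stay_series D z s \<xi>) \<le> 1 / (1 - norm z)"
proof -
  have b1: "norm (stay_transform D s n \<xi>) \<le> 1" if "\<xi> \<in> S" for n \<xi>
    by (rule norm_stay_transform_le_1[OF D]) (use bd that in auto)
  have hol: "(\<lambda>\<xi>. stay_transform D s n \<xi>) holomorphic_on S" for n
    unfolding stay_transform_def by (rule holomorphic_on_cut_weight[OF _ S]) (use D bd in auto)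
  show "stay_series D z s holomorphic_on S"
    unfolding stay_series_def[abs_def] by (rule holomorphic_on_suminf_power[OF S hol b1 z])
  show "norm (stay_series D z s \<xi>) \<le> 1 / (1 - norm z)" if "\<xi> \<in> S" for \<xi>
    unfolding stay_series_def by (rule summable_power_times_bounded[OF b1[OF that] z])
qed

lemma holomorphic_on_exit_series:
  assumes D: "D \<in> sets borel" and S: "open S" and z: "norm z < 1"
    and bd: "AE \<omega> in M. \<forall>\<xi>\<in>S. \<forall>n. walk Bs As n \<omega> \<notin> D \<longrightarrow> norm (weight s n \<xi> \<omega>) \<le> 1"
  shows "exit_series D z s holomorphic_on S"
proof -
  have b1: "norm (z * exit_transform D s (Suc n) \<xi>) \<le> 1" if "\<xi> \<in> S" for n \<xi>
  proof -
    have "norm (exit_transform D s (Suc n) \<xi>) \<le> 1"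
      by (rule norm_exit_series_le(2)[OF D _ z]) (use bd that in auto)
    then show ?thesis using z by (simp add: norm_mult mult_le_one)
  qed
  have "exit_transform D s (Suc n) holomorphic_on S" for n
    unfolding exit_transform_def by (rule holomorphic_on_cut_weight[OF _ S]) (use D bd in auto)
  then have hol: "(\<lambda>\<xi>. z * exit_transform D s (Suc n) \<xi>) holomorphic_on S" for n
    by (intro holomorphic_intros)
  show ?thesis
    unfolding exit_series_def[abs_def] by (rule holomorphic_on_suminf_power[OF S hol b1 z])
qed

lemma AE_weight_stays_nonneg:
  assumes "0 \<le> Re s"
  shows "AE \<omega> in M. \<forall>\<xi>\<in>{\<xi>. 0 < Re \<xi>}. \<forall>n. stays {0..} n \<omega> \<longrightarrow> norm (weight s n \<xi> \<omega>) \<le> 1"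
  using AE_norm_weight_le_1
proof eventually_elim
  case (elim \<omega>)
  have "0 \<le> walk Bs As n \<omega>" if "stays {0..} n \<omega>" for n
    using that by (cases "n = 0") (auto simp: stays_def walk_0)
  with elim assms show ?case by (auto simp: less_imp_le)
qed

lemma AE_weight_exit_nonneg:
  assumes "0 \<le> Re s"
  shows "AE \<omega> in M. \<forall>\<xi>\<in>{\<xi>. Re \<xi> \<le> Re s}. \<forall>n. walk Bs As n \<omega> \<notin> {0..} \<longrightarrow> norm (weight s n \<xi> \<omega>) \<le> 1"
  using AE_norm_weight_le_1 by eventually_elim (use assms in auto)

lemma AE_weight_stays_neg:
  assumes "0 \<le> Re s"
  shows "AE \<omega> in M. \<forall>\<xi>\<in>{\<xi>. Re \<xi> < Re s}. \<forall>n. stays {..<0} n \<omega> \<longrightarrow> norm (weight s n \<xi> \<omega>) \<le> 1"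
  using AE_norm_weight_le_1
proof eventually_elim
  case (elim \<omega>)
  have "walk Bs As n \<omega> \<le> 0" if "stays {..<0} n \<omega>" for n
    using that by (cases "n = 0") (auto simp: stays_def walk_0 less_imp_le)
  with elim assms show ?case by (auto simp: less_imp_le)
qed

lemma AE_weight_exit_neg:
  assumes "0 \<le> Re s"
  shows "AE \<omega> in M. \<forall>\<xi>\<in>{\<xi>. 0 < Re \<xi>}. \<forall>n. walk Bs As n \<omega> \<notin> {..<0} \<longrightarrow> norm (weight s n \<xi> \<omega>) \<le> 1"
  using AE_norm_weight_le_1 by eventually_elim (use assms in auto)

text \<open>Without returns to the origin, only the term for \<open>n = 0\<close> survives as \<open>\<xi> \<rightarrow> \<infinity>\<close>.\<close>

lemma stay_series_tendsto_1:
  assumes no_return: "\<And>n. 1 \<le> n \<Longrightarrow> measure M {\<omega> \<in> space M. walk Bs As n \<omega> = 0} = 0"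
    and s: "0 \<le> Re s" and z: "norm z < 1"
  shows "((\<lambda>x::real. stay_series {0..} z s (complex_of_real x)) \<longlongrightarrow> 1) at_top"
proof -
  let ?w = "\<lambda>n (x::real) \<omega>. if stays {0..} n \<omega> then weight s n (complex_of_real x) \<omega> else 0"
  have D: "{0..} \<in> sets (borel :: real measure)" by simp
  have lim: "((\<lambda>x::real. stay_transform {0..} s n (complex_of_real x)) \<longlongrightarrow> (if n = 0 then 1 else 0)) at_top" for n
  proof (cases "n = 0")
    case False
    have "AE \<omega> in M. walk Bs As n \<omega> \<noteq> 0"
    proof (rule AE_I)
      show "{\<omega> \<in> space M. \<not> walk Bs As n \<omega> \<noteq> 0} \<subseteq> {\<omega> \<in> space M. walk Bs As n \<omega> = 0}" by auto
      show "emeasure M {\<omega> \<in> space M. walk Bs As n \<omega> = 0} = 0"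
        using no_return[of n] False by (simp add: emeasure_eq_measure)
      show "{\<omega> \<in> space M. walk Bs As n \<omega> = 0} \<in> sets M" by measurable
    qed
    then have nz: "AE \<omega> in M. walk Bs As n \<omega> \<noteq> 0" .
    have exp_lim: "((\<lambda>x. exp (- (x * w + c))) \<longlongrightarrow> 0) at_top" if "0 < w" for w c :: real
      using that by real_asymp
    have pt: "((\<lambda>x. ?w n x \<omega>) \<longlongrightarrow> 0) at_top"
      if w: "walk Bs As n \<omega> \<noteq> 0" for \<omega>
    proof (cases "stays {0..} n \<omega>")
      case True
      have "n \<in> {1..n}" using False by simp
      then have "0 \<le> walk Bs As n \<omega>" using True unfolding stays_def by blast
      with w have "0 < walk Bs As n \<omega>" by simp
      then have "((\<lambda>x. norm (weight s n (complex_of_real x) \<omega>)) \<longlongrightarrow> 0) at_top"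
        unfolding norm_weight Re_complex_of_real by (rule exp_lim)
      then have "((\<lambda>x. weight s n (complex_of_real x) \<omega>) \<longlongrightarrow> 0) at_top" by (rule tendsto_norm_zero_cancel)
      then show ?thesis using True by simp
    qed simp
    have ae: "AE \<omega> in M. ((\<lambda>x. ?w n x \<omega>) \<longlongrightarrow> 0) at_top"
      by (rule AE_mp[OF nz AE_I2]) (use pt in blast)
    have "((\<lambda>x::real. CLINT \<omega>|M. ?w n x \<omega>) \<longlongrightarrow> (CLINT \<omega>|M. 0)) at_top"
    proof (rule integral_dominated_convergence_at_top[where w = "\<lambda>_. 1"])
      have "AE \<omega> in M. norm (?w n x \<omega>) \<le> 1" if "0 < x" for x
        using AE_weight_stays_nonneg[OF s] by eventually_elim (use that in auto)
      then show "\<forall>\<^sub>F x in at_top. AE \<omega> in M. norm (?w n x \<omega>) \<le> 1"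
        by (intro eventually_mono[OF eventually_gt_at_top[of 0]])
    qed (use ae in simp_all)
    then show ?thesis using False by (simp add: stay_transform_def)
  qed simp
  have bound: "norm (z ^ n * stay_transform {0..} s n (complex_of_real x)) \<le> norm z ^ n" if "0 < x" for n x
  proof -
    have "norm (stay_transform {0..} s n (complex_of_real x)) \<le> 1"
      by (rule norm_stay_transform_le_1[OF D]) (use AE_weight_stays_nonneg[OF s] that in auto)
    then show ?thesis by (simp add: norm_mult norm_power mult_left_le)
  qed
  have "((\<lambda>x. \<Sum>n. z ^ n * stay_transform {0..} s n (complex_of_real x)) \<longlongrightarrow> (\<Sum>n. z ^ n * (if n = 0 then 1 else 0))) at_top"
  proof (rule tannerys_theorem[THEN conjunct2, THEN conjunct2])
    show "((\<lambda>x. z ^ n * stay_transform {0..} s n (complex_of_real x)) \<longlongrightarrow> z ^ n * (if n = 0 then 1 else 0)) at_top" for n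
      by (intro tendsto_mult tendsto_const lim)
    show "summable (\<lambda>n. norm z ^ n)" using z by (simp add: summable_geometric)
    show "\<forall>\<^sub>F (n, x) in at_top \<times>\<^sub>F at_top. norm (z ^ n * stay_transform {0..} s n (complex_of_real x)) \<le> norm z ^ n"
      unfolding eventually_prod_filter
      by (rule exI[of _ "\<lambda>_. True"], rule exI[of _ "\<lambda>x. 0 < x"]) (use bound eventually_gt_at_top in auto)
  qed simp
  moreover have "(\<Sum>n. z ^ n * (if n = 0 then 1 else 0)) = 1"
    using suminf_finite[of "{0}" "\<lambda>n. z ^ n * (if n = 0 then 1 else 0)"] by simp
  ultimately show ?thesis by (simp add: stay_series_def)
qed

text \<open>At \<open>\<xi> = s\<close> the exponent \<open>- s S_n - s a_n\<close> collapses to \<open>- s b_n\<close>.\<close>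

lemma integral_ladder_term:
  assumes s: "0 \<le> Re s" and z: "norm z < 1"
  shows "(CLINT \<omega>|M. ladder_term Bs As z s \<omega>) = exit_series {0..} z s s"
proof -
  let ?w = "\<lambda>n \<omega>. if stays {0..} n \<omega> \<and> walk Bs As (Suc n) \<omega> \<notin> {0..} then weight s (Suc n) s \<omega> else 0"
  define f where "f = (\<lambda>n \<omega>. z ^ n * (z * ?w n \<omega>))"
  have f_eq: "f n \<omega> = (if stays {0..} n \<omega> \<and> walk Bs As (Suc n) \<omega> < 0 then z ^ Suc n * exp (- s * complex_of_real (partial_sum Bs (Suc n) \<omega>)) else 0)" for n \<omega>
    by (simp add: f_def weight_def walk_eq algebra_simps)
  have mf: "(?w n) \<in> borel_measurable M" for n
    by measurable
  have b: "AE \<omega> in M. norm (?w n \<omega>) \<le> 1" for n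
    using AE_weight_exit_nonneg[OF s] by eventually_elim auto
  have ig: "integrable M (?w n)" for n
    by (rule integrable_const_bound[OF b mf])
  have intf: "integrable M (f n)" for n unfolding f_def by (intro integrable_mult_right ig)
  have sz: "summable (\<lambda>n. norm z ^ n)" using z by (simp add: summable_geometric)
  have bf: "AE \<omega> in M. \<forall>n. norm (f n \<omega>) \<le> norm z ^ n"
    unfolding AE_all_countable
  proof
    fix n show "AE \<omega> in M. norm (f n \<omega>) \<le> norm z ^ n" using b[of n]
    proof eventually_elim
      case (elim \<omega>)
      have "norm (f n \<omega>) \<le> norm z ^ n * (1 * 1)"
        unfolding f_def norm_mult norm_power using elim z by (intro mult_left_mono mult_mono) auto
      then show ?case by simp
    qed
  qed
  have "(CLINT \<omega>|M. \<Sum>n. f n \<omega>) = (\<Sum>n. CLINT \<omega>|M. f n \<omega>)"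
  proof (rule integral_suminf[OF intf])
    show "AE \<omega> in M. summable (\<lambda>n. norm (f n \<omega>))"
      using bf by eventually_elim (auto intro: summable_comparison_test'[OF sz])
    show "summable (\<lambda>n. LINT \<omega>|M. norm (f n \<omega>))"
    proof (rule summable_comparison_test'[OF sz])
      fix n
      have "(LINT \<omega>|M. norm (f n \<omega>)) \<le> (LINT \<omega>|M. norm z ^ n)"
        by (rule integral_mono_AE) (use intf bf in auto)
      also have "\<dots> = norm z ^ n" by (simp add: prob_space)
      finally show "norm (LINT \<omega>|M. norm (f n \<omega>)) \<le> norm z ^ n" by simp
    qed
  qed
  also have "\<dots> = exit_series {0..} z s s"
    unfolding exit_series_def exit_transform_def f_def by (simp add: ig)
  finally have 1: "(CLINT \<omega>|M. \<Sum>n. f n \<omega>) = exit_series {0..} z s s" .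
  have "ladder_term Bs As z s \<omega> = (\<Sum>n. f n \<omega>)" for \<omega>
  proof (cases "\<exists>n. 1 \<le> n \<and> walk Bs As n \<omega> < 0")
    case False
    then have "f n \<omega> = 0" for n by (auto simp: f_eq)
    moreover have "{n. 1 \<le> n \<and> walk Bs As n \<omega> < 0} = {}" using False by auto
    then have "ladder_epoch Bs As \<omega> = \<infinity>" unfolding ladder_epoch_def by (simp only: image_empty Inf_empty top_enat_def)
    ultimately show ?thesis by (simp add: ladder_term_def)
  next
    case True
    define N where "N = (LEAST n. 1 \<le> n \<and> walk Bs As n \<omega> < 0)"
    have N: "1 \<le> N" "walk Bs As N \<omega> < 0" using LeastI_ex[OF True] by (auto simp: N_def)
    have least: "N \<le> n" if "1 \<le> n" "walk Bs As n \<omega> < 0" for n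
      unfolding N_def by (rule Least_le) (use that in auto)
    have "ladder_epoch Bs As \<omega> = enat N"
      unfolding ladder_epoch_def
      by (rule antisym) (use N least in \<open>auto intro!: INF_lower INF_greatest\<close>)
    moreover have "(\<Sum>n. f n \<omega>) = (\<Sum>n\<in>{N - 1}. f n \<omega>)"
    proof (rule suminf_finite)
      fix n assume "n \<notin> {N - 1}"
      then have "n < N - 1 \<or> N \<le> n" by auto
      then show "f n \<omega> = 0"
      proof
        assume "N \<le> n"
        then have "\<not> stays {0..} n \<omega>" using N by (auto simp: stays_def not_le intro!: bexI[of _ N])
        then show ?thesis by (simp add: f_eq)
      next
        assume "n < N - 1"
        then have "\<not> walk Bs As (Suc n) \<omega> < 0" using least[of "Suc n"] by auto
        then show ?thesis by (simp add: f_eq)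
      qed
    qed simp
    moreover have "stays {0..} (N - 1) \<omega>"
      unfolding stays_def
    proof
      fix j assume j: "j \<in> {1..N - 1}"
      then have "\<not> walk Bs As j \<omega> < 0" using least[of j] N by auto
      then show "walk Bs As j \<omega> \<in> {0..}" by simp
    qed
    ultimately show ?thesis using N by (simp add: ladder_term_def f_eq)
  qed
  with 1 show ?thesis by simp
qed

end

section \<open>The two Wiener-Hopf factors\<close>

context bivariate_walk
begin

text \<open>For the exit from \<open>{0..}\<close> the paths that stay have \<open>S\<^sub>n \<ge> 0\<close>, so their series extends to the right;
  at the exit \<open>S\<^sub>n < 0\<close>, so that series extends to the left.\<close>

definition plus_factor :: "complex \<Rightarrow> complex \<Rightarrow> complex \<Rightarrow> complex" where
  "plus_factor z s \<xi> = stay_series {0..} z s \<xi>"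

definition minus_factor :: "complex \<Rightarrow> complex \<Rightarrow> complex \<Rightarrow> complex" where
  "minus_factor z s \<xi> = 1 - exit_series {0..} z s \<xi>"

lemma one_minus_bounds:
  fixes e z :: complex
  assumes "norm e \<le> norm z" "norm z < 1"
  shows "norm (1 - e) \<le> 2" "1 - e \<noteq> 0"
  using norm_triangle_ineq4[of 1 e] assms by auto

lemma plus_factor:
  assumes s: "0 \<le> Re s" and z: "norm z < 1"
  shows "plus_factor z s holomorphic_on {\<xi>. 0 < Re \<xi>}"
    "\<And>\<xi>. 0 < Re \<xi> \<Longrightarrow> norm (plus_factor z s \<xi>) \<le> 1 / (1 - norm z)"
proof -
  have eq: "plus_factor z s = stay_series {0..} z s" by (rule ext) (simp add: plus_factor_def)
  have D: "{0..} \<in> sets (borel :: real measure)" by simp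
  have op: "open {\<xi>. 0 < Re \<xi>}" by (rule open_halfspace_Re_gt)
  note * = holomorphic_on_stay_series[OF D op z AE_weight_stays_nonneg[OF s]]
  show "plus_factor z s holomorphic_on {\<xi>. 0 < Re \<xi>}" unfolding eq by (rule *(1))
  show "norm (plus_factor z s \<xi>) \<le> 1 / (1 - norm z)" if "0 < Re \<xi>" for \<xi>
    unfolding eq by (rule *(2)) (use that in simp)
qed

lemma minus_factor:
  assumes s: "0 \<le> Re s" and z: "norm z < 1"
  shows "minus_factor z s holomorphic_on {\<xi>. Re \<xi> < Re s}"
    "\<And>\<xi>. Re \<xi> \<le> Re s \<Longrightarrow> norm (minus_factor z s \<xi>) \<le> 2"
    "\<And>\<xi>. Re \<xi> \<le> Re s \<Longrightarrow> minus_factor z s \<xi> \<noteq> 0"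
proof -
  have D: "{0..} \<in> sets (borel :: real measure)" by simp
  have op: "open {\<xi>. Re \<xi> < Re s}" by (rule open_halfspace_Re_lt)
  have "exit_series {0..} z s holomorphic_on {\<xi>. Re \<xi> < Re s}"
    by (rule holomorphic_on_exit_series[OF D op z])
      (rule AE_mp[OF AE_weight_exit_nonneg[OF s] AE_I2], auto)
  then show "minus_factor z s holomorphic_on {\<xi>. Re \<xi> < Re s}"
    unfolding minus_factor_def[abs_def] by (intro holomorphic_intros)
  have le: "norm (exit_series {0..} z s \<xi>) \<le> norm z" if "Re \<xi> \<le> Re s" for \<xi>
    by (rule norm_exit_series_le(1)[OF D _ z])
      (rule AE_mp[OF AE_weight_exit_nonneg[OF s] AE_I2], use that in auto)
  show "norm (minus_factor z s \<xi>) \<le> 2" "minus_factor z s \<xi> \<noteq> 0" if "Re \<xi> \<le> Re s" for \<xi>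
    unfolding minus_factor_def using one_minus_bounds[OF le[OF that] z] by auto
qed

lemma factor_identity:
  assumes "0 \<le> Re \<xi>" "Re \<xi> \<le> Re s" "norm z < 1"
  shows "plus_factor z s \<xi> * (1 - z * joint_transform M B A \<xi> (s - \<xi>)) = minus_factor z s \<xi>"
  unfolding plus_factor_def minus_factor_def by (rule Wiener_Hopf_identity) (use assms in auto)

text \<open>The factorisation for the exit from \<open>{..<0}\<close> has the half-planes interchanged. The two products
  of corresponding factors agree on the common strip, so together they form a bounded entire
  function: a nonzero constant.\<close>

lemma plus_factor_nonzero:
  assumes s: "0 < Re s" and z: "norm z < 1" and \<xi>: "0 < Re \<xi>"
  shows "plus_factor z s \<xi> \<noteq> 0"
proof -
  define Hm where "Hm = stay_series {..<0} z s"
  define Hp where "Hp = (\<lambda>\<xi>. 1 - exit_series {..<0} z s \<xi>)"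
  have D: "{..<0} \<in> sets (borel :: real measure)" by simp
  have s0: "0 \<le> Re s" using s by simp
  have op: "open {\<xi>. 0 < Re \<xi>}" "open {\<xi>. Re \<xi> < Re s}" by (auto simp: open_halfspace_Re_gt open_halfspace_Re_lt)
  note m = holomorphic_on_stay_series[OF D op(2) z AE_weight_stays_neg[OF s0], folded Hm_def]
  have p1: "Hp holomorphic_on {\<xi>. 0 < Re \<xi>}"
    unfolding Hp_def using holomorphic_on_exit_series[OF D op(1) z AE_weight_exit_neg[OF s0]]
    by (intro holomorphic_intros)
  have le: "norm (exit_series {..<0} z s \<xi>) \<le> norm z" if "0 < Re \<xi>" for \<xi>
    by (rule norm_exit_series_le(1)[OF D _ z])
      (rule AE_mp[OF AE_weight_exit_neg[OF s0] AE_I2], use that in auto)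
  have p2: "norm (Hp \<xi>) \<le> 2" "Hp \<xi> \<noteq> 0" if "0 < Re \<xi>" for \<xi>
    unfolding Hp_def using one_minus_bounds[OF le[OF that] z] by auto
  have strip: "plus_factor z s \<xi> * Hp \<xi> = minus_factor z s \<xi> * Hm \<xi>" if "0 < Re \<xi>" "Re \<xi> < Re s" for \<xi>
  proof -
    have 1: "Hm \<xi> * (1 - z * joint_transform M B A \<xi> (s - \<xi>)) = Hp \<xi>"
      unfolding Hm_def Hp_def by (rule Wiener_Hopf_identity[OF D]) (use that z in auto)
    have 2: "plus_factor z s \<xi> * (1 - z * joint_transform M B A \<xi> (s - \<xi>)) = minus_factor z s \<xi>"
      by (rule factor_identity) (use that z in auto)
    show ?thesis unfolding 1[symmetric] 2[symmetric] by (simp only: mult_ac)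
  qed
  define E where "E = (\<lambda>\<xi>. if \<xi> \<in> {\<xi>. 0 < Re \<xi>} then plus_factor z s \<xi> * Hp \<xi> else minus_factor z s \<xi> * Hm \<xi>)"
  have "E holomorphic_on ({\<xi>. 0 < Re \<xi>} \<union> {\<xi>. Re \<xi> < Re s})"
    unfolding E_def
    by (rule holomorphic_on_If_Un) (use plus_factor(1)[OF s0 z] minus_factor(1)[OF s0 z] m(1) p1 strip op in
        \<open>auto intro!: holomorphic_intros\<close>)
  moreover have "{\<xi>. 0 < Re \<xi>} \<union> {\<xi>. Re \<xi> < Re s} = UNIV" using s by auto
  ultimately have E_hol: "E holomorphic_on UNIV" by simp
  have "norm (E \<xi>) \<le> 2 / (1 - norm z)" for \<xi>
  proof (cases "0 < Re \<xi>")
    case True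
    have "norm (plus_factor z s \<xi>) * norm (Hp \<xi>) \<le> 1 / (1 - norm z) * 2"
      by (rule mult_mono[OF plus_factor(2)[OF s0 z True] p2(1)[OF True]]) (use z in auto)
    then show ?thesis using True by (simp add: E_def norm_mult)
  next
    case False
    then have \<xi>_le: "Re \<xi> \<le> Re s" "\<xi> \<in> {\<xi>. Re \<xi> < Re s}" using s by auto
    have "norm (minus_factor z s \<xi>) * norm (Hm \<xi>) \<le> 2 * (1 / (1 - norm z))"
      by (rule mult_mono[OF minus_factor(2)[OF s0 z \<xi>_le(1)] m(2)[OF \<xi>_le(2)]]) auto
    then show ?thesis using False by (simp add: E_def norm_mult)
  qed
  then have "bounded (range E)" by (auto simp: bounded_iff)
  then obtain c where c: "\<And>\<xi>. E \<xi> = c"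
    using Liouville_theorem[OF E_hol] by (auto simp: constant_on_def)
  define \<xi>1 where "\<xi>1 = complex_of_real (Re s / 2)"
  have \<xi>1: "0 < Re \<xi>1" "Re \<xi>1 < Re s" using s by (auto simp: \<xi>1_def)
  have "plus_factor z s \<xi>1 \<noteq> 0"
    using factor_identity[of \<xi>1 s z] minus_factor(3)[OF s0 z, of \<xi>1] \<xi>1 z by auto
  then have "E \<xi>1 \<noteq> 0" using p2(2)[OF \<xi>1(1)] \<xi>1 by (simp add: E_def)
  then have "E \<xi> \<noteq> 0" using c by simp
  then show ?thesis using \<xi> by (simp add: E_def)
qed

end

section \<open>Identification of the factors as rational functions\<close>

lemma lists_zeroes_cong:
  "{w\<in>S. f w = 0} = {w\<in>T. f w = 0} \<Longrightarrow> lists_zeroes f S n \<xi> \<longleftrightarrow> lists_zeroes f T n \<xi>"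
  by (simp only: lists_zeroes_def)

lemma prod_linear_over_power_tendsto_1:
  fixes \<xi> :: "nat \<Rightarrow> complex"
  shows
  "((\<lambda>x::real. (\<Prod>i=1..n. complex_of_real x - \<xi> i) / complex_of_real x ^ n) \<longlongrightarrow> 1) at_top"
proof -
  have inv: "((\<lambda>x::real. inverse (complex_of_real x)) \<longlongrightarrow> 0) at_top"
  proof -
    have "((\<lambda>x::real. complex_of_real (inverse x)) \<longlongrightarrow> of_real 0) at_top"
      by (intro tendsto_of_real tendsto_inverse_0_at_top filterlim_ident)
    then show ?thesis by simp
  qed
  have "((\<lambda>x::real. \<Prod>i=1..n. 1 - \<xi> i * inverse (complex_of_real x)) \<longlongrightarrow> (\<Prod>i=1..n. 1 - \<xi> i * 0)) at_top"
    by (intro tendsto_prod tendsto_diff tendsto_mult tendsto_const inv)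
  moreover have "\<forall>\<^sub>F x::real in at_top. (\<Prod>i=1..n. 1 - \<xi> i * inverse (complex_of_real x))
      = (\<Prod>i=1..n. complex_of_real x - \<xi> i) / complex_of_real x ^ n"
    using eventually_gt_at_top[of 0]
  proof eventually_elim
    case (elim x)
    have "(\<Prod>i=1..n. complex_of_real x - \<xi> i) / complex_of_real x ^ n = (\<Prod>i=1..n. (complex_of_real x - \<xi> i) / complex_of_real x)"
      by (simp add: prod_dividef)
    also have "\<dots> = (\<Prod>i=1..n. 1 - \<xi> i * inverse (complex_of_real x))"
      using elim by (intro prod.cong) (auto simp: field_simps)
    finally show ?case by simp
  qed
  ultimately show ?thesis by (auto intro: Lim_transform_eventually)
qed

text \<open>Comparison of the powers of \<open>x\<close> as \<open>x \<rightarrow> \<infinity>\<close>.\<close>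

lemma quotient_of_products_normalised:
  fixes c :: complex and p q :: "nat \<Rightarrow> complex"
  assumes lim: "((\<lambda>x::real. G (complex_of_real x)) \<longlongrightarrow> 1) at_top" and c: "c \<noteq> 0"
    and eq: "\<And>x::real. 0 < x \<Longrightarrow> G (complex_of_real x) * (\<Prod>i=1..nz. complex_of_real x - q i) = c * (\<Prod>i=1..n0. complex_of_real x - p i)"
  shows "n0 = nz \<and> c = 1"
proof -
  let ?x = "\<lambda>x::real. complex_of_real x"
  define m0 where "m0 = (\<lambda>x::real. (\<Prod>i=1..n0. ?x x - p i) / ?x x ^ n0)"
  define mz where "mz = (\<lambda>x::real. (\<Prod>i=1..nz. ?x x - q i) / ?x x ^ nz)"
  have "((\<lambda>x. G (?x x) * mz x) \<longlongrightarrow> 1 * 1) at_top"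
    unfolding mz_def by (rule tendsto_mult[OF lim prod_linear_over_power_tendsto_1])
  then have L: "((\<lambda>x. G (?x x) * mz x) \<longlongrightarrow> 1) at_top" by simp
  have "((\<lambda>x. c * m0 x) \<longlongrightarrow> c * 1) at_top"
    unfolding m0_def by (rule tendsto_mult[OF tendsto_const prod_linear_over_power_tendsto_1])
  then have R: "((\<lambda>x. c * m0 x) \<longlongrightarrow> c) at_top" by simp
  have rel: "G (?x x) * mz x * ?x x ^ nz = c * m0 x * ?x x ^ n0" if "0 < x" for x
  proof -
    have "mz x * ?x x ^ nz = (\<Prod>i=1..nz. ?x x - q i)" "m0 x * ?x x ^ n0 = (\<Prod>i=1..n0. ?x x - p i)"
      using that by (simp_all add: mz_def m0_def)
    with eq[OF that] show ?thesis by (simp only: mult.assoc)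
  qed
  have inv: "((\<lambda>x::real. inverse (?x x) ^ k) \<longlongrightarrow> 0) at_top" if "0 < k" for k
  proof -
    have "((\<lambda>x::real. complex_of_real (inverse x ^ k)) \<longlongrightarrow> of_real (0 ^ k)) at_top"
      by (intro tendsto_of_real tendsto_power tendsto_inverse_0_at_top filterlim_ident)
    then show ?thesis using that by (simp add: power_0_left)
  qed
  have alg: "b * inverse y = a" if "a * y = b" "y \<noteq> 0" for a b y :: complex
    using that by (auto simp: field_simps)
  consider "n0 = nz" | "n0 < nz" | "nz < n0" by linarith
  then show ?thesis
  proof cases
    case 1
    have "\<forall>\<^sub>F x in at_top. G (?x x) * mz x = c * m0 x"
      using eventually_gt_at_top[of 0]
    proof eventually_elim
      case (elim x)
      then show ?case using rel[OF elim] 1 by simp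
    qed
    then have "((\<lambda>x. c * m0 x) \<longlongrightarrow> 1) at_top" by (rule Lim_transform_eventually[OF L])
    with R have "c = 1" by (rule tendsto_unique[OF trivial_limit_at_top_linorder])
    with 1 show ?thesis by simp
  next
    case 2
    have ev: "\<forall>\<^sub>F x in at_top. c * m0 x * inverse (?x x) ^ (nz - n0) = G (?x x) * mz x"
      using eventually_gt_at_top[of 0]
    proof eventually_elim
      case (elim x)
      have "?x x ^ nz = ?x x ^ n0 * ?x x ^ (nz - n0)" using 2 by (simp add: power_add[symmetric])
      then have "?x x ^ n0 * (G (?x x) * mz x * ?x x ^ (nz - n0)) = ?x x ^ n0 * (c * m0 x)"
        using rel[OF elim] by (simp only: mult_ac)
      then have "G (?x x) * mz x * ?x x ^ (nz - n0) = c * m0 x"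
        using elim by (subst (asm) mult_cancel_left) simp
      then show ?case unfolding power_inverse by (rule alg) (use elim in simp)
    qed
    have "((\<lambda>x. c * m0 x * inverse (?x x) ^ (nz - n0)) \<longlongrightarrow> c * 0) at_top"
      by (rule tendsto_mult[OF R inv]) (use 2 in simp)
    then have "((\<lambda>x. G (?x x) * mz x) \<longlongrightarrow> c * 0) at_top"
      by (rule Lim_transform_eventually[OF _ ev])
    then have "1 = c * 0" by (rule tendsto_unique[OF trivial_limit_at_top_linorder L])
    then show ?thesis by simp
  next
    case 3
    have ev: "\<forall>\<^sub>F x in at_top. G (?x x) * mz x * inverse (?x x) ^ (n0 - nz) = c * m0 x"
      using eventually_gt_at_top[of 0]
    proof eventually_elim
      case (elim x)
      have "?x x ^ n0 = ?x x ^ nz * ?x x ^ (n0 - nz)" using 3 by (simp add: power_add[symmetric])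
      then have "?x x ^ nz * (c * m0 x * ?x x ^ (n0 - nz)) = ?x x ^ nz * (G (?x x) * mz x)"
        using rel[OF elim] by (simp only: mult_ac)
      then have "c * m0 x * ?x x ^ (n0 - nz) = G (?x x) * mz x"
        using elim by (subst (asm) mult_cancel_left) simp
      then show ?case unfolding power_inverse by (rule alg) (use elim in simp)
    qed
    have "((\<lambda>x. G (?x x) * mz x * inverse (?x x) ^ (n0 - nz)) \<longlongrightarrow> 1 * 0) at_top"
      by (rule tendsto_mult[OF L inv]) (use 3 in simp)
    then have "((\<lambda>x. c * m0 x) \<longlongrightarrow> 1 * 0) at_top"
      by (rule Lim_transform_eventually[OF _ ev])
    then have "c = 1 * 0" by (rule tendsto_unique[OF trivial_limit_at_top_linorder R])
    then show ?thesis using c by simp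
  qed
qed

text \<open>Abstract form of the last step. On the left \<open>Gp\<close> continues as \<open>Gm f0 / fz\<close>; once the zeroes
  are divided out, the quotient is entire and without zeroes, so the growth estimate makes it
  constant.\<close>

lemma Wiener_Hopf_factor_eq:
  fixes f0 fz Gp Gm :: "complex \<Rightarrow> complex"
  assumes \<eta>: "0 < \<eta>"
    and hol: "f0 holomorphic_on {\<xi>. Re \<xi> < \<eta>}" "fz holomorphic_on {\<xi>. Re \<xi> < \<eta>}"
    and nz: "\<And>\<xi>. 0 \<le> Re \<xi> \<Longrightarrow> Re \<xi> < \<eta> \<Longrightarrow> f0 \<xi> \<noteq> 0 \<and> fz \<xi> \<noteq> 0"
    and fin: "finite {\<xi>. Re \<xi> < 0 \<and> f0 \<xi> = 0}" "finite {\<xi>. Re \<xi> < 0 \<and> fz \<xi> = 0}"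
    and growth: "\<And>\<xi>. \<rho>0 \<le> norm \<xi> \<Longrightarrow> Re \<xi> < 0 \<Longrightarrow> norm (f0 \<xi>) * \<bar>Re \<xi>\<bar> ^ b \<le> C * norm \<xi> ^ a * norm (fz \<xi>)"
    and Gp: "Gp holomorphic_on {\<xi>. 0 < Re \<xi>}" "\<And>\<xi>. 0 < Re \<xi> \<Longrightarrow> norm (Gp \<xi>) \<le> K"
      "\<And>\<xi>. 0 < Re \<xi> \<Longrightarrow> Gp \<xi> \<noteq> 0"
    and Gm: "Gm holomorphic_on {\<xi>. Re \<xi> < \<eta>}" "\<And>\<xi>. Re \<xi> < \<eta> \<Longrightarrow> norm (Gm \<xi>) \<le> K" "\<And>\<xi>. Re \<xi> < \<eta> \<Longrightarrow> Gm \<xi> \<noteq> 0"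
    and strip: "\<And>\<xi>. 0 < Re \<xi> \<Longrightarrow> Re \<xi> < \<eta> \<Longrightarrow> Gp \<xi> * fz \<xi> = Gm \<xi> * f0 \<xi>"
    and lim: "((\<lambda>x::real. Gp (complex_of_real x)) \<longlongrightarrow> 1) at_top"
  obtains n p q where "lists_zeroes f0 {w. Re w < 0} n p" "lists_zeroes fz {w. Re w < 0} n q"
    "\<And>\<xi>. 0 < Re \<xi> \<Longrightarrow> Gp \<xi> = (\<Prod>i=1..n. \<xi> - p i) / (\<Prod>i=1..n. \<xi> - q i)"
proof -
  let ?S = "{\<xi>. Re \<xi> < \<eta>}"
  have S: "open ?S" "connected ?S" by (auto simp: open_halfspace_Re_lt convex_halfspace_Re_lt convex_connected)
  have Z: "{w\<in>?S. f0 w = 0} = {w. Re w < 0 \<and> f0 w = 0}" "{w\<in>?S. fz w = 0} = {w. Re w < 0 \<and> fz w = 0}"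
  proof -
    have "Re w < 0" if "Re w < \<eta>" "f0 w = 0 \<or> fz w = 0" for w using nz[of w] that by (meson not_le)
    then show "{w\<in>?S. f0 w = 0} = {w. Re w < 0 \<and> f0 w = 0}" "{w\<in>?S. fz w = 0} = {w. Re w < 0 \<and> fz w = 0}"
      using \<eta> by auto
  qed
  have ex: "\<exists>w\<in>?S. f0 w \<noteq> 0" "\<exists>w\<in>?S. fz w \<noteq> 0" using nz[of 0] \<eta> by (auto intro!: exI[of _ 0])
  obtain n0 p k0 where l0: "lists_zeroes f0 ?S n0 p" and k0: "k0 holomorphic_on ?S" "\<And>w. w \<in> ?S \<Longrightarrow> k0 w \<noteq> 0"
      "\<And>w. w \<in> ?S \<Longrightarrow> f0 w = (\<Prod>i=1..n0. w - p i) * k0 w"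
    by (rule factor_out_zeroes[OF hol(1) S fin(1)[folded Z(1)] ex(1)]) blast
  obtain nz' q kz where lz: "lists_zeroes fz ?S nz' q" and kz: "kz holomorphic_on ?S" "\<And>w. w \<in> ?S \<Longrightarrow> kz w \<noteq> 0"
      "\<And>w. w \<in> ?S \<Longrightarrow> fz w = (\<Prod>i=1..nz'. w - q i) * kz w"
    by (rule factor_out_zeroes[OF hol(2) S fin(2)[folded Z(2)] ex(2)]) blast
  have lists: "lists_zeroes f0 {w. Re w < 0} n0 p" "lists_zeroes fz {w. Re w < 0} nz' q"
  proof -
    have "{w\<in>?S. f0 w = 0} = {w\<in>{w. Re w < 0}. f0 w = 0}" "{w\<in>?S. fz w = 0} = {w\<in>{w. Re w < 0}. fz w = 0}"
      using Z by simp_all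
    from lists_zeroes_cong[OF this(1)] lists_zeroes_cong[OF this(2)] l0 lz
    show "lists_zeroes f0 {w. Re w < 0} n0 p" "lists_zeroes fz {w. Re w < 0} nz' q" by blast+
  qed
  define m0 where "m0 = (\<lambda>\<xi>. \<Prod>i=1..n0. \<xi> - p i)"
  define mz where "mz = (\<lambda>\<xi>. \<Prod>i=1..nz'. \<xi> - q i)"
  have pneg: "Re (p i) < 0" if "i \<in> {1..n0}" for i
    using lists(1) that unfolding lists_zeroes_def by blast
  have qneg: "Re (q i) < 0" if "i \<in> {1..nz'}" for i
    using lists(2) that unfolding lists_zeroes_def by blast
  have m0_nz: "m0 \<xi> \<noteq> 0" if "0 \<le> Re \<xi>" for \<xi>
    unfolding m0_def using pneg that by (subst prod_zero_iff) force+
  have mz_nz: "mz \<xi> \<noteq> 0" if "0 \<le> Re \<xi>" for \<xi>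
    unfolding mz_def using qneg that by (subst prod_zero_iff) force+
  define g where "g = (\<lambda>\<xi>. if \<xi> \<in> {\<xi>. 0 < Re \<xi>} then Gp \<xi> * mz \<xi> / m0 \<xi> else Gm \<xi> * k0 \<xi> / kz \<xi>)"
  have "g holomorphic_on ({\<xi>. 0 < Re \<xi>} \<union> ?S)"
    unfolding g_def
  proof (rule holomorphic_on_If_Un)
    show "(\<lambda>\<xi>. Gp \<xi> * mz \<xi> / m0 \<xi>) holomorphic_on {\<xi>. 0 < Re \<xi>}"
      using Gp(1) m0_nz unfolding m0_def mz_def by (intro holomorphic_intros) auto
    show "(\<lambda>\<xi>. Gm \<xi> * k0 \<xi> / kz \<xi>) holomorphic_on ?S"
      using Gm(1) k0(1) kz(1,2) by (intro holomorphic_intros) auto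
    fix \<xi> assume \<xi>: "\<xi> \<in> {\<xi>. 0 < Re \<xi>}" "\<xi> \<in> ?S"
    have "Gp \<xi> * (mz \<xi> * kz \<xi>) = Gm \<xi> * (m0 \<xi> * k0 \<xi>)"
      using strip[of \<xi>] \<xi> k0(3)[OF \<xi>(2)] kz(3)[OF \<xi>(2)] unfolding m0_def mz_def by simp
    then show "Gp \<xi> * mz \<xi> / m0 \<xi> = Gm \<xi> * k0 \<xi> / kz \<xi>"
      using m0_nz[of \<xi>] kz(2)[OF \<xi>(2)] \<xi> by (simp add: field_simps)
  qed (auto simp: open_halfspace_Re_gt S)
  moreover have "{\<xi>. 0 < Re \<xi>} \<union> ?S = UNIV" using \<eta> by auto
  ultimately have g_hol: "g holomorphic_on UNIV" by simp
  have g_nz: "g \<xi> \<noteq> 0" for \<xi>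
  proof (cases "0 < Re \<xi>")
    case True
    then show ?thesis using Gp(3) mz_nz[of \<xi>] m0_nz[of \<xi>] by (simp add: g_def)
  next
    case False
    then have "\<xi> \<in> ?S" using \<eta> by simp
    with False show ?thesis using Gm(3) k0(2) kz(2) by (simp add: g_def)
  qed
  have K: "0 \<le> K" using Gm(2)[of 0] \<eta> norm_ge_zero order_trans by (metis zero_complex.sel(1))
  define \<rho>1 where "\<rho>1 = max \<rho>0 (1 + (\<Sum>i=1..n0. norm (p i)) + (\<Sum>i=1..nz'. norm (q i)))"
  define C' where "C' = K * 2 ^ nz' + K * \<bar>C\<bar> * 2 ^ nz'"
  (* the additional power of Re \<xi> covers the imaginary axis, where no estimate for f0 / fz is at hand *)
  have g_growth: "norm (g \<xi>) * \<bar>Re \<xi>\<bar> ^ Suc b \<le> C' * norm \<xi> ^ (a + nz' + Suc b)" if \<xi>: "\<rho>1 \<le> norm \<xi>" for \<xi>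
  proof -
    have sums: "0 \<le> (\<Sum>i=1..n0. norm (p i))" "0 \<le> (\<Sum>i=1..nz'. norm (q i))" by (auto intro: sum_nonneg)
    have \<xi>1: "1 \<le> norm \<xi>" using \<xi> sums by (simp add: \<rho>1_def)
    have pi: "norm (p i) + 1 \<le> norm \<xi>" if "i \<in> {1..n0}" for i
    proof -
      have "norm (p i) \<le> (\<Sum>i=1..n0. norm (p i))" using that by (intro member_le_sum) auto
      then show ?thesis using \<xi> sums by (simp add: \<rho>1_def)
    qed
    have qi: "norm (q i) + 1 \<le> norm \<xi>" if "i \<in> {1..nz'}" for i
    proof -
      have "norm (q i) \<le> (\<Sum>i=1..nz'. norm (q i))" using that by (intro member_le_sum) auto
      then show ?thesis using \<xi> sums by (simp add: \<rho>1_def)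
    qed
    have m0_ge: "1 \<le> norm (m0 \<xi>)"
    proof -
      have "(\<Prod>i=1..n0. 1) \<le> (\<Prod>i=1..n0. norm (\<xi> - p i))"
      proof (rule prod_mono)
        fix i assume "i \<in> {1..n0}"
        then show "0 \<le> (1::real) \<and> 1 \<le> norm (\<xi> - p i)" using pi[of i] norm_triangle_ineq2[of \<xi> "p i"] by simp
      qed
      then show ?thesis by (simp add: m0_def prod_norm)
    qed
    have mz_le: "norm (mz \<xi>) \<le> 2 ^ nz' * norm \<xi> ^ nz'"
    proof -
      have "(\<Prod>i=1..nz'. norm (\<xi> - q i)) \<le> (\<Prod>i=1..nz'. 2 * norm \<xi>)"
      proof (rule prod_mono)
        fix i assume "i \<in> {1..nz'}"
        then show "0 \<le> norm (\<xi> - q i) \<and> norm (\<xi> - q i) \<le> 2 * norm \<xi>"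
          using qi[of i] norm_triangle_ineq4[of \<xi> "q i"] by simp
      qed
      then show ?thesis by (simp add: mz_def prod_norm power_mult_distrib)
    qed
    have mz0: "mz \<xi> \<noteq> 0"
    proof -
      have "\<xi> - q i \<noteq> 0" if "i \<in> {1..nz'}" for i using qi[OF that] by auto
      then show ?thesis unfolding mz_def by (subst prod_zero_iff) auto
    qed
    have C'_nn: "0 \<le> K * 2 ^ nz'" "0 \<le> K * \<bar>C\<bar> * 2 ^ nz'" using K by auto
    have Re_le: "\<bar>Re \<xi>\<bar> ^ k \<le> norm \<xi> ^ k" for k by (intro power_mono abs_Re_le_cmod) auto
    consider "0 < Re \<xi>" | "Re \<xi> = 0" | "Re \<xi> < 0" by linarith
    then show ?thesis
    proof cases
      case 1
      have "norm (g \<xi>) = norm (Gp \<xi>) * norm (mz \<xi>) / norm (m0 \<xi>)" using 1 by (simp add: g_def norm_mult norm_divide)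
      also have "\<dots> \<le> norm (Gp \<xi>) * norm (mz \<xi>) / 1" using m0_ge by (intro divide_left_mono) auto
      also have "\<dots> \<le> K * (2 ^ nz' * norm \<xi> ^ nz')" using Gp(2)[OF 1] mz_le K by (simp add: mult_mono)
      finally have "norm (g \<xi>) * \<bar>Re \<xi>\<bar> ^ Suc b \<le> (K * (2 ^ nz' * norm \<xi> ^ nz')) * norm \<xi> ^ Suc b"
        by (rule mult_mono[OF _ Re_le]) (use K in auto)
      also have "\<dots> = (K * 2 ^ nz') * norm \<xi> ^ (nz' + Suc b)" by (simp only: power_add mult_ac)
      also have "\<dots> \<le> C' * norm \<xi> ^ (a + nz' + Suc b)"
        using C'_nn \<xi>1 by (intro mult_mono power_increasing) (auto simp: C'_def)
      finally show ?thesis .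
    next
      case 2
      then show ?thesis using C'_nn by (simp add: C'_def)
    next
      case 3
      then have \<xi>S: "\<xi> \<in> ?S" using \<eta> by simp
      have fz0: "fz \<xi> \<noteq> 0" using kz(2,3)[OF \<xi>S] mz0 by (simp add: mz_def)
      have m00: "m0 \<xi> \<noteq> 0" using m0_ge by auto
      have "g \<xi> = Gm \<xi> * (f0 \<xi> / fz \<xi>) * mz \<xi> / m0 \<xi>"
      proof -
        have alg: "x * (u * v / (y * w)) * y / u = x * v / w" if "u \<noteq> 0" "y \<noteq> 0" for x u v w y :: complex
          using that by simp
        have "f0 \<xi> = m0 \<xi> * k0 \<xi>" "fz \<xi> = mz \<xi> * kz \<xi>"
          unfolding m0_def mz_def by (rule k0(3)[OF \<xi>S], rule kz(3)[OF \<xi>S])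
        moreover have "g \<xi> = Gm \<xi> * k0 \<xi> / kz \<xi>" using 3 by (simp add: g_def)
        ultimately show ?thesis by (simp only: alg[OF m00 mz0])
      qed
      then have "norm (g \<xi>) = norm (Gm \<xi>) * (norm (f0 \<xi>) / norm (fz \<xi>)) * norm (mz \<xi>) / norm (m0 \<xi>)"
        by (simp only: norm_mult norm_divide)
      also have "\<dots> \<le> norm (Gm \<xi>) * (norm (f0 \<xi>) / norm (fz \<xi>)) * norm (mz \<xi>) / 1"
        using m0_ge by (intro divide_left_mono) auto
      also have "\<dots> \<le> K * (norm (f0 \<xi>) / norm (fz \<xi>)) * (2 ^ nz' * norm \<xi> ^ nz')"
        unfolding div_by_1 using Gm(2)[of \<xi>] \<xi>S mz_le K by (intro mult_mono) auto
      finally have 1: "norm (g \<xi>) \<le> K * (norm (f0 \<xi>) / norm (fz \<xi>)) * (2 ^ nz' * norm \<xi> ^ nz')" .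
      have "norm (f0 \<xi>) * \<bar>Re \<xi>\<bar> ^ b \<le> \<bar>C\<bar> * norm \<xi> ^ a * norm (fz \<xi>)"
      proof (rule order_trans[OF growth])
        show "\<rho>0 \<le> norm \<xi>" using \<xi> by (simp add: \<rho>1_def)
        show "C * norm \<xi> ^ a * norm (fz \<xi>) \<le> \<bar>C\<bar> * norm \<xi> ^ a * norm (fz \<xi>)" by (intro mult_right_mono) auto
      qed (rule 3)
      then have 2: "norm (f0 \<xi>) / norm (fz \<xi>) * \<bar>Re \<xi>\<bar> ^ b \<le> \<bar>C\<bar> * norm \<xi> ^ a"
        using fz0 by (simp add: field_simps)
      have "norm (g \<xi>) * \<bar>Re \<xi>\<bar> ^ Suc b \<le> (K * (norm (f0 \<xi>) / norm (fz \<xi>)) * (2 ^ nz' * norm \<xi> ^ nz')) * \<bar>Re \<xi>\<bar> ^ Suc b"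
        using 1 by (intro mult_right_mono) auto
      also have "\<dots> = K * (norm (f0 \<xi>) / norm (fz \<xi>) * \<bar>Re \<xi>\<bar> ^ b) * (2 ^ nz' * norm \<xi> ^ nz') * \<bar>Re \<xi>\<bar>"
        by (simp only: power_Suc mult_ac)
      also have "\<dots> \<le> K * (\<bar>C\<bar> * norm \<xi> ^ a) * (2 ^ nz' * norm \<xi> ^ nz') * norm \<xi>"
        by (rule mult_mono[OF mult_right_mono[OF mult_left_mono[OF 2 K]] abs_Re_le_cmod]) (use K in auto)
      also have "\<dots> = (K * \<bar>C\<bar> * 2 ^ nz') * norm \<xi> ^ (a + nz' + 1)"
        by (simp only: power_add power_one_right mult_ac)
      also have "\<dots> \<le> C' * norm \<xi> ^ (a + nz' + Suc b)"
        using C'_nn \<xi>1 by (intro mult_mono power_increasing) (auto simp: C'_def)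
      finally show ?thesis .
    qed
  qed
  obtain c where c: "\<And>\<xi>. g \<xi> = c"
    using zero_free_entire_growth_imp_constant[OF g_hol g_nz g_growth] by blast
  have c0: "c \<noteq> 0" using g_nz c by metis
  have right: "Gp \<xi> * mz \<xi> = c * m0 \<xi>" if "0 < Re \<xi>" for \<xi>
    using c[of \<xi>] that m0_nz[of \<xi>] by (simp add: g_def field_simps)
  have nc: "n0 = nz' \<and> c = 1"
    by (rule quotient_of_products_normalised[where p = p and q = q, OF lim c0])
      (use right in \<open>simp add: m0_def mz_def\<close>)
  have "Gp \<xi> = m0 \<xi> / mz \<xi>" if "0 < Re \<xi>" for \<xi>
    using right[OF that] nc mz_nz[of \<xi>] that by (simp add: field_simps)
  then show ?thesis using that[of n0 p q] lists nc unfolding m0_def mz_def by simp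
qed

section \<open>The transform of the first descending ladder epoch and the sum of the upward steps\<close>

theorem mainTheorem3:
  fixes M :: "'a measure"
    and B A :: "'a \<Rightarrow> real"
    and Bs As :: "nat \<Rightarrow> 'a \<Rightarrow> real"
    and h1 h2 :: "complex \<Rightarrow> complex poly"
  assumes prob: "prob_space M"
    and meas: "(\<lambda>\<omega>. (B \<omega>, A \<omega>)) \<in> borel_measurable M"
    and nonneg: "\<And>\<omega>. \<omega> \<in> space M \<Longrightarrow> 0 \<le> B \<omega> \<and> 0 \<le> A \<omega>"
    and indep: "prob_space.indep_vars M (\<lambda>_. borel) (\<lambda>i \<omega>. (Bs i \<omega>, As i \<omega>)) {1..}"
    and copies: "\<And>i. 1 \<le> i \<Longrightarrow>
      distr M borel (\<lambda>\<omega>. (Bs i \<omega>, As i \<omega>)) = distr M borel (\<lambda>\<omega>. (B \<omega>, A \<omega>))"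
    and no_return: "\<And>n. 1 \<le> n \<Longrightarrow> measure M {\<omega> \<in> space M. walk Bs As n \<omega> = 0} = 0"
    and i_rational: "\<And>s1 s2. 0 \<le> Re s1 \<Longrightarrow> 0 \<le> Re s2 \<Longrightarrow>
      joint_transform M B A s1 s2 = rat_ext h1 h2 s1 s2"
    and i_zeroes: "\<And>s1 s2. 0 \<le> Re s2 \<Longrightarrow> poly (h2 s2) s1 = 0 \<Longrightarrow> Re s1 < 0"
    and ii_meromorphic: "\<And>s. 0 \<le> Re s \<Longrightarrow>
      (\<lambda>\<xi>. rat_ext h1 h2 \<xi> (s - \<xi>)) meromorphic_on {\<xi>. Re \<xi> < 0}"
    and ii_poles: "\<And>s. 0 \<le> Re s \<Longrightarrow>
      finite {\<xi>. Re \<xi> < 0 \<and> is_pole (\<lambda>\<xi>. rat_ext h1 h2 \<xi> (s - \<xi>)) \<xi>}"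
    \<comment> \<open>implicit in speaking of zeroes with multiplicity of these functions of \<open>\<xi>\<close>\<close>
    and diagonal_analytic: "\<And>s. 0 < Re s \<Longrightarrow>
      (\<lambda>\<xi>. poly (h1 (s - \<xi>)) \<xi>) holomorphic_on {\<xi>. Re \<xi> < 0} \<and>
      (\<lambda>\<xi>. poly (h2 (s - \<xi>)) \<xi>) holomorphic_on {\<xi>. Re \<xi> < 0}"
    and iii_decay: "uniform_limit {s2. 0 \<le> Re s2} (joint_transform M B A) (\<lambda>_. 0)
      (inf at_infinity (principal {s1. 0 < Re s1}))"
  shows "\<forall>s z. 0 < Re s \<longrightarrow> norm z < 1 \<longrightarrow>
    (\<exists>n \<xi> \<xi>z.
      lists_zeroes (\<lambda>w. poly (h2 (s - w)) w) {w. Re w < 0} n \<xi> \<and>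
      lists_zeroes (\<lambda>w. poly (h2 (s - w)) w - z * poly (h1 (s - w)) w) {w. Re w < 0} n \<xi>z \<and>
      (CLINT \<omega>|M. ladder_term Bs As z s \<omega>) =
        1 - (1 - z * joint_transform M B A s 0) *
          ((\<Prod>i=1..n. s - \<xi> i) / (\<Prod>i=1..n. s - \<xi>z i)))"
proof (intro allI impI)
  fix s z :: complex assume s: "0 < Re s" and z: "norm z < 1"
  interpret prob_space M by (rule prob)
  interpret bivariate_walk M B A Bs As
    using meas nonneg indep copies by unfold_locales auto
  define \<eta> where "\<eta> = Re s / 2"
  have \<eta>: "0 < \<eta>" "\<eta> < Re s" "Re s - \<eta> = \<eta>" using s by (auto simp: \<eta>_def)
  have h2_nz: "poly (h2 u) w \<noteq> 0" if "0 \<le> Re u" "0 \<le> Re w" for u w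
    using i_zeroes[OF that(1), of w] that(2) by auto
  have dom: "norm (poly (h1 u) w) \<le> norm (poly (h2 u) w)" if "0 \<le> Re u" "0 \<le> Re w" for u w
  proof -
    have "norm (poly (h1 u) w / poly (h2 u) w) \<le> 1"
      using norm_joint_transform_le_1[OF that(2,1)] i_rational[OF that(2,1)] by (simp add: rat_ext_def)
    then show ?thesis using h2_nz[OF that] by (simp add: norm_divide)
  qed
  obtain D2 where D2: "\<And>u. \<eta> < Re u \<Longrightarrow> degree (h2 u) \<le> D2"
    and hol2: "\<And>k. (\<lambda>u. coeff (h2 u) k) holomorphic_on {u. \<eta> < Re u}"
    by (rule diagonal_holomorphic_imp_holomorphic_coeffs[OF _ \<eta>(1), of h2]) (use diagonal_analytic in blast)+
  obtain D1 where hol1: "\<And>k. (\<lambda>u. coeff (h1 u) k) holomorphic_on {u. \<eta> < Re u}"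
    by (rule diagonal_holomorphic_imp_holomorphic_coeffs[OF _ \<eta>(1), of h1]) (use diagonal_analytic in blast)+
  have h2_poly_nz: "h2 u \<noteq> 0" if "\<eta> < Re u" for u using h2_nz[of u 0] that \<eta>(1) by auto
  obtain d u0 where deg2: "\<And>u. \<eta> < Re u \<Longrightarrow> degree (h2 u) \<le> d" and u0: "\<eta> < Re u0" "coeff (h2 u0) d \<noteq> 0"
    by (rule exact_degree_bound[of \<eta> h2 D2, OF D2 h2_poly_nz]) blast+
  have deg1: "degree (h1 u) \<le> d" if "\<eta> < Re u" for u
  proof -
    have "degree (h1 u) \<le> degree (h2 u)" by (rule degree_le_if_dominated) (use dom that \<eta>(1) in auto)
    with deg2[OF that] show ?thesis by simp
  qed
  define Pz where "Pz = (\<lambda>u. h2 u - smult z (h1 u))"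
  have close: "norm (poly (Pz u) w - poly (h2 u) w) \<le> norm z * norm (poly (h2 u) w)" if "\<eta> < Re u" "0 \<le> Re w" for u w
    using dom[of u w] that \<eta>(1) by (auto simp: Pz_def norm_mult intro!: mult_left_mono)
  interpret S0: stable_family h2 d \<eta> s
  proof
    show "coeff (h2 u) d \<noteq> 0" if "\<eta> < Re u" for u
      by (rule top_coeff_nonzero[of \<eta> h2 d, OF deg2 hol2 _ u0 that]) (use h2_nz \<eta>(1) in auto)
  qed (use deg2 hol2 h2_nz \<eta> in auto)
  have degz: "degree (Pz u) \<le> d" if "\<eta> < Re u" for u
    unfolding Pz_def using deg1[OF that] deg2[OF that] by (intro degree_diff_le order_trans[OF degree_smult_le]) auto
  interpret Sz: stable_family Pz d \<eta> s
  proof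
    show "(\<lambda>u. coeff (Pz u) k) holomorphic_on {u. \<eta> < Re u}" for k
      unfolding Pz_def coeff_diff coeff_smult by (intro holomorphic_intros hol1 hol2)
    show "poly (Pz u) w \<noteq> 0" if "\<eta> < Re u" "0 \<le> Re w" for u w
    proof
      assume "poly (Pz u) w = 0"
      then have "1 * norm (poly (h2 u) w) \<le> norm z * norm (poly (h2 u) w)" using close[OF that] by simp
      then show False using z S0.stable[OF that] by (simp only: mult_le_cancel_right) auto
    qed
    show "coeff (Pz u) d \<noteq> 0" if "\<eta> < Re u" for u
    proof
      assume 0: "coeff (Pz u) d = 0"
      have "norm (disc_poly d (Pz u) 1 - disc_poly d (h2 u) 1) \<le> norm z * norm (disc_poly d (h2 u) 1)"
        by (rule disc_poly_close[OF deg2[OF that] degz[OF that] close[OF that]]) auto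
      then have "1 * norm (disc_poly d (h2 u) 1) \<le> norm z * norm (disc_poly d (h2 u) 1)"
        by (simp add: disc_poly_1 0)
      moreover have "disc_poly d (h2 u) 1 \<noteq> 0" using S0.top[OF that] by (simp add: disc_poly_1)
      ultimately show False using z by (simp only: mult_le_cancel_right) auto
    qed
  qed (use degz \<eta> in auto)
  have f0: "S0.diag = (\<lambda>w. poly (h2 (s - w)) w)" by (rule ext) (simp add: S0.diag_def)
  have fz: "Sz.diag = (\<lambda>w. poly (h2 (s - w)) w - z * poly (h1 (s - w)) w)"
    by (rule ext) (simp only: Sz.diag_def, simp add: Pz_def)
  note growth = diag_zeroes_and_growth[OF S0.stable_family_axioms Sz.stable_family_axioms close z]
  obtain \<rho>0 a b C where gr: "\<And>\<xi>. \<rho>0 \<le> norm \<xi> \<Longrightarrow> Re \<xi> < 0 \<Longrightarrow>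
      norm (S0.diag \<xi>) * \<bar>Re \<xi>\<bar> ^ b \<le> C * norm \<xi> ^ a * norm (Sz.diag \<xi>)"
    using growth(3) by blast
  have s0: "0 \<le> Re s" using s by simp
  define K where "K = max 2 (1 / (1 - norm z))"
  have sub: "{\<xi>. Re \<xi> < \<eta>} \<subseteq> {\<xi>. Re \<xi> < Re s}" using \<eta> by auto
  obtain n p q where L: "lists_zeroes S0.diag {w. Re w < 0} n p" "lists_zeroes Sz.diag {w. Re w < 0} n q"
    and G: "\<And>\<xi>. 0 < Re \<xi> \<Longrightarrow> plus_factor z s \<xi> = (\<Prod>i=1..n. \<xi> - p i) / (\<Prod>i=1..n. \<xi> - q i)"
  proof (rule Wiener_Hopf_factor_eq[of \<eta> S0.diag Sz.diag \<rho>0 b C a "plus_factor z s" K "minus_factor z s"])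
    show "plus_factor z s \<xi> * Sz.diag \<xi> = minus_factor z s \<xi> * S0.diag \<xi>" if "0 < Re \<xi>" "Re \<xi> < \<eta>" for \<xi>
    proof -
      have u: "\<eta> < Re (s - \<xi>)" "0 \<le> Re (s - \<xi>)" using that \<eta> by auto
      have nz: "S0.diag \<xi> \<noteq> 0" by (rule S0.diag_nonzero) (use that \<eta> in auto)
      have "joint_transform M B A \<xi> (s - \<xi>) = poly (h1 (s - \<xi>)) \<xi> / S0.diag \<xi>"
        using i_rational[of \<xi> "s - \<xi>"] that u by (simp add: rat_ext_def f0)
      then have "Sz.diag \<xi> = (1 - z * joint_transform M B A \<xi> (s - \<xi>)) * S0.diag \<xi>"
        using nz unfolding fz f0 by (simp add: field_simps)
      moreover have "plus_factor z s \<xi> * (1 - z * joint_transform M B A \<xi> (s - \<xi>)) = minus_factor z s \<xi>"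
        by (rule factor_identity) (use that \<eta> z in auto)
      ultimately show ?thesis by (simp only: mult.assoc[symmetric])
    qed
    show "((\<lambda>x::real. plus_factor z s (complex_of_real x)) \<longlongrightarrow> 1) at_top"
      unfolding plus_factor_def by (rule stay_series_tendsto_1[OF no_return s0 z])
    show "minus_factor z s holomorphic_on {\<xi>. Re \<xi> < \<eta>}"
      using minus_factor(1)[OF s0 z] sub by (rule holomorphic_on_subset)
    show "S0.diag holomorphic_on {\<xi>. Re \<xi> < \<eta>}" "Sz.diag holomorphic_on {\<xi>. Re \<xi> < \<eta>}"
      using S0.holomorphic_on_diag Sz.holomorphic_on_diag by (simp_all only: \<eta>(3))
    show "S0.diag \<xi> \<noteq> 0 \<and> Sz.diag \<xi> \<noteq> 0" if "0 \<le> Re \<xi>" "Re \<xi> < \<eta>" for \<xi>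
      using S0.diag_nonzero[of \<xi>] Sz.diag_nonzero[of \<xi>] that \<eta>(3) by simp
    show "norm (plus_factor z s \<xi>) \<le> K" if "0 < Re \<xi>" for \<xi>
      using plus_factor(2)[OF s0 z that] by (simp add: K_def)
    show "norm (minus_factor z s \<xi>) \<le> K" "minus_factor z s \<xi> \<noteq> 0" if "Re \<xi> < \<eta>" for \<xi>
      using minus_factor(2,3)[OF s0 z, of \<xi>] that \<eta> by (auto simp: K_def)
  qed (use \<eta>(1) growth(1,2) gr plus_factor(1)[OF s0 z] plus_factor_nonzero[OF s z] in auto)
  have "(CLINT \<omega>|M. ladder_term Bs As z s \<omega>) = 1 - minus_factor z s s"
    unfolding integral_ladder_term[OF s0 z] minus_factor_def by simp
  also have "minus_factor z s s = (1 - z * joint_transform M B A s 0) * plus_factor z s s"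
    using factor_identity[of s s z] s z by (simp add: mult.commute)
  finally have "(CLINT \<omega>|M. ladder_term Bs As z s \<omega>) =
        1 - (1 - z * joint_transform M B A s 0) * ((\<Prod>i=1..n. s - p i) / (\<Prod>i=1..n. s - q i))"
    unfolding G[OF s] .
  with L show "\<exists>n \<xi> \<xi>z.
      lists_zeroes (\<lambda>w. poly (h2 (s - w)) w) {w. Re w < 0} n \<xi> \<and>
      lists_zeroes (\<lambda>w. poly (h2 (s - w)) w - z * poly (h1 (s - w)) w) {w. Re w < 0} n \<xi>z \<and>
      (CLINT \<omega>|M. ladder_term Bs As z s \<omega>) =
        1 - (1 - z * joint_transform M B A s 0) *
          ((\<Prod>i=1..n. s - \<xi> i) / (\<Prod>i=1..n. s - \<xi>z i))"
    unfolding f0 fz by blast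
qed

end
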